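(* Let $T$ be any combinatorial triangulation of a quadrilateral, with triangles $\Delta_1,\dots,\Delta_n$, and let $p_T\in\mathbb{Z}[A_1,\dots,A_n]$ be its area polynomial. Then $p_T$ is monic in the following sense: for every $i\in\{1,\dots,n\}$ the coefficient of $A_i^d$ in $p_T$ is $\pm1$, where $d=\deg p_T$.
   Context: A combinatorial triangulation of a quadrilateral is a (finite) simplicial complex $T$ homeomorphic to a closed disk, with exactly four vertices $\mathbf{p},\mathbf{q},\mathbf{r},\mathbf{s}$ on the boundary, in this cyclic order. Orienting the boundary in the direction $\mathbf{p}\mathbf{q}\mathbf{r}\mathbf{s}$ gives an orientation of each triangle $\Delta_i$ of $T$. A drawing of $T$ with parallelogram boundary is a map $\rho$ from the vertices of $T$ to the plane such that $\rho(\mathbf{q})-\rho(\mathbf{p})=\rho(\mathbf{r})-\rho(\mathbf{s})$ (apart from this condition the positions of the vertices are arbitrary; image triangles may overlap or be degenerate). The area of $\Delta_i$ in the drawing is the signed area $a_i$ of the oriented image triangle: if $\Delta_i$ has vertices $v_1,v_2,v_3$ in the order given by its orientation and $\rho(v_j)=(x_j,y_j)$, then $a_i=\tfrac12\big[(x_2-x_1)(y_3-y_1)-(x_3-x_1)(y_2-y_1)\big]$. Area polynomial: it is known that for each such $T$ there is a unique (up to sign) nonzero homogeneous polynomial $p_T\in\mathbb{Z}[A_1,\dots,A_n]$, irreducible in $\mathbb{Z}[A_1,\dots,A_n]$, with one variable $A_i$ for each triangle $\Delta_i$, such that $p_T(a_1,\dots,a_n)=0$ for every drawing of $T$ with parallelogram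 boundary in which the triangles have areas $a_1,\dots,a_n$. This $p_T$ is called the area polynomial of $T$. *)

theory Defs
  imports
    "HOL-Analysis.Analysis"
    "HOL-Computational_Algebra.Factorial_Ring"
    "HOL-Library.Poly_Mapping"
begin

section \<open>Combinatorial triangulations of a quadrilateral\<close>

text \<open>
  A finite simplicial complex is given by a realisation in a Euclidean space of arbitrary
  dimension, \<^const>\<open>simplicial_complex\<close>. Apart from incidences, the positions of its vertices
  play no role: drawings below are arbitrary maps on the vertices.
\<close>

definition complex_vertices :: "'a::euclidean_space set set \<Rightarrow> 'a set" where
  "complex_vertices K = {v. {v} \<in> K}"

definition complex_triangles :: "'a::euclidean_space set set \<Rightarrow> 'a set set" where
  "complex_triangles K = {S \<in> K. 2 simplex S}"

text \<open>
  The image of the unit circle under a homeomorphism from the closed disk is the boundary of the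
  triangulated disk. The cyclic order is expressed by requiring this boundary to be the closed
  polygon with consecutive sides \<open>pq\<close>, \<open>qr\<close>, \<open>rs\<close>, \<open>sp\<close>.
\<close>

definition quad_triangulation ::
    "'a::euclidean_space set set \<Rightarrow> 'a \<Rightarrow> 'a \<Rightarrow> 'a \<Rightarrow> 'a \<Rightarrow> bool" where
  "quad_triangulation K p q r s \<longleftrightarrow>
     simplicial_complex K \<and>
     distinct [p, q, r, s] \<and>
     (\<exists>f g. homeomorphism (cball (0 :: real^2) 1) (\<Union>K) f g \<and>
            complex_vertices K \<inter> f ` sphere 0 1 = {p, q, r, s} \<and>
            f ` sphere 0 1 =
              closed_segment p q \<union> closed_segment q r \<union> closed_segment r s \<union> closed_segment s p)"

text \<open>
  An orientation lists the vertices of each triangle in an order that matters only up to cyclic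
  rotation. It is the one induced by orienting the boundary as \<open>pqrs\<close> when two triangles sharing
  an edge traverse it in opposite directions and the boundary edges are traversed in the
  directions \<open>pq\<close>, \<open>qr\<close>, \<open>rs\<close>, \<open>sp\<close>.
\<close>

fun directed_edges :: "'a \<times> 'a \<times> 'a \<Rightarrow> ('a \<times> 'a) set" where
  "directed_edges (a, b, c) = {(a, b), (b, c), (c, a)}"

definition boundary_orientation ::
    "('n \<Rightarrow> 'a::euclidean_space set) \<Rightarrow> 'a \<Rightarrow> 'a \<Rightarrow> 'a \<Rightarrow> 'a \<Rightarrow> ('n \<Rightarrow> 'a \<times> 'a \<times> 'a) \<Rightarrow> bool" where
  "boundary_orientation \<Delta> p q r s ori \<longleftrightarrow>
     (\<forall>i. case ori i of (a, b, c) \<Rightarrow> \<Delta> i = convex hull {a, b, c}) \<and>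
     (\<forall>i j. i \<noteq> j \<longrightarrow> directed_edges (ori i) \<inter> directed_edges (ori j) = {}) \<and>
     {(p, q), (q, r), (r, s), (s, p)} \<subseteq> (\<Union>i. directed_edges (ori i))"


section \<open>Drawings with parallelogram boundary\<close>

text \<open>Only the values of \<open>\<rho>\<close> at the vertices of the complex are relevant.\<close>

definition parallelogram_drawing ::
    "'a \<Rightarrow> 'a \<Rightarrow> 'a \<Rightarrow> 'a \<Rightarrow> ('a \<Rightarrow> real^2) \<Rightarrow> bool" where
  "parallelogram_drawing p q r s \<rho> \<longleftrightarrow> \<rho> q - \<rho> p = \<rho> r - \<rho> s"

fun signed_area :: "('a \<Rightarrow> real^2) \<Rightarrow> 'a \<times> 'a \<times> 'a \<Rightarrow> real" where
  "signed_area \<rho> (u, v, w) =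
     1 / 2 * ((\<rho> v $ 1 - \<rho> u $ 1) * (\<rho> w $ 2 - \<rho> u $ 2) -
              (\<rho> w $ 1 - \<rho> u $ 1) * (\<rho> v $ 2 - \<rho> u $ 2))"


section \<open>Integer polynomials in finitely many variables\<close>

text \<open>
  For a finite type \<open>'n\<close>, this is the polynomial ring over the integers with exactly one variable
  for each element of \<open>'n\<close>; monomials are exponent vectors.
\<close>

type_synonym 'n int_mpoly = "('n \<Rightarrow>\<^sub>0 nat) \<Rightarrow>\<^sub>0 int"

definition monom_degree :: "('n \<Rightarrow>\<^sub>0 nat) \<Rightarrow> nat" where
  "monom_degree m = (\<Sum>i\<in>Poly_Mapping.keys m. Poly_Mapping.lookup m i)"

definition total_degree :: "'n int_mpoly \<Rightarrow> nat" where
  "total_degree P = Max (insert 0 (monom_degree ` Poly_Mapping.keys P))"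

definition homogeneous :: "'n int_mpoly \<Rightarrow> bool" where
  "homogeneous P \<longleftrightarrow> (\<forall>m\<in>Poly_Mapping.keys P. monom_degree m = total_degree P)"

definition mpoly_eval :: "'n int_mpoly \<Rightarrow> ('n \<Rightarrow> real) \<Rightarrow> real" where
  "mpoly_eval P a =
     (\<Sum>m\<in>Poly_Mapping.keys P. of_int (Poly_Mapping.lookup P m) *
        (\<Prod>i\<in>Poly_Mapping.keys m. a i ^ Poly_Mapping.lookup m i))"


section \<open>The area polynomial\<close>

text \<open>
  These conditions determine the polynomial up to sign, so it is described by a predicate
  rather than by a choice of one of the two.
\<close>

definition area_polynomial ::
    "('n \<Rightarrow> 'a \<times> 'a \<times> 'a) \<Rightarrow> 'a \<Rightarrow> 'a \<Rightarrow> 'a \<Rightarrow> 'a \<Rightarrow> 'n::finite int_mpoly \<Rightarrow> bool" where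
  "area_polynomial ori p q r s P \<longleftrightarrow>
     P \<noteq> 0 \<and> homogeneous P \<and> irreducible P \<and>
     (\<forall>\<rho>. parallelogram_drawing p q r s \<rho> \<longrightarrow>
           mpoly_eval P (\<lambda>i. signed_area \<rho> (ori i)) = 0)"

end

theory Submission
  imports Defs "HOL-Computational_Algebra.Polynomial"
begin

text \<open>
The areas of a drawing satisfy two kinds of constraints, which pull in opposite directions.

Integrality: if a valuation ring of the reals contained all areas but the one of \<open>\<Delta>\<^sub>i\<close>, the colouring of
the plane used in Monsky's theorem on equidissections would give a contradiction by Sperner's lemma. Hence
every area is integral over the ring generated by the others.

Independence: after rotating the labels, \<open>pr\<close> is not an edge. Coning off the boundary and inserting \<open>pr\<close>
gives a triangulated sphere. Contracting edges one at a time shows that some placement of its vertices in space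
admits no nonzero antisymmetric edge function with vanishing weighted row sums. In a generic projection to
the plane this makes the derivative of the area map, restricted to all but one of the areas, surjective. So there
is a drawing with all but one of the areas algebraically independent.

At such a drawing the irreducible polynomial \<open>P\<close> generates the ideal of relations between the areas. By integrality
this ideal contains, for each \<open>i\<close>, a polynomial that is monic in the variable \<open>A\<^sub>i\<close>, and \<open>P\<close> divides it.
\<close>

section \<open>Valuation rings and integrality\<close>

text \<open>The cokernel of the area derivative has dimension at most one. A covector killing all
  area derivatives along parallelogram-preserving displacements leaves residues
  \<open>c, -c, c, -c\<close> at the corners, for a single vector \<open>c\<close> of the plane. One
  linear condition puts \<open>c\<close> in the direction of the diagonal, where a stress of the
  square cut along \<open>pr\<close> cancels it; absence of stresses then makes the covector vanish.
  That \<open>pr\<close> is not an edge matters twice: inserting \<open>pr\<close> is realised by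
  contracting an edge of the cone, which is legitimate only then, and the edge function coming from
  the covector has no component on \<open>pr\<close>. If \<open>pr\<close> is an edge, a discrete
  Jordan curve argument shows that \<open>qs\<close> is not. Since the coefficients are integers,
  the minimal polynomial of the remaining area must have coefficients in the ring generated by the
  others, not merely in its fraction field. This is why a Gauss lemma is needed, and why the
  independent areas are chosen one by one: each transcendental choice keeps the ring completely
  integrally closed.\<close>

definition subring_set :: "'k::comm_ring_1 set \<Rightarrow> bool" where
  "subring_set B \<longleftrightarrow> 1 \<in> B \<and> (\<forall>x\<in>B. \<forall>y\<in>B. x - y \<in> B \<and> x * y \<in> B)"

lemma subring_setD:
  assumes "subring_set B"
  shows subring_1: "1 \<in> B" and subring_0: "0 \<in> B"
    and subring_diff: "\<And>x y. x \<in> B \<Longrightarrow> y \<in> B \<Longrightarrow> x - y \<in> B"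
    and subring_mult: "\<And>x y. x \<in> B \<Longrightarrow> y \<in> B \<Longrightarrow> x * y \<in> B"
    and subring_uminus: "\<And>x. x \<in> B \<Longrightarrow> - x \<in> B"
    and subring_add: "\<And>x y. x \<in> B \<Longrightarrow> y \<in> B \<Longrightarrow> x + y \<in> B"
proof -
  show d: "x - y \<in> B" and "x * y \<in> B" if "x \<in> B" "y \<in> B" for x y
    using assms that by (auto simp: subring_set_def)
  show "1 \<in> B" using assms by (auto simp: subring_set_def)
  have "1 - 1 \<in> B" using assms by (metis subring_set_def)
  then show 0: "0 \<in> B" by simp
  show m: "- x \<in> B" if "x \<in> B" for x using d[OF 0 that] by simp
  show "x + y \<in> B" if "x \<in> B" "y \<in> B" for x y using d[OF that(1) m[OF that(2)]] by simp
qed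

lemma subring_sum: "subring_set B \<Longrightarrow> (\<And>i. i \<in> A \<Longrightarrow> f i \<in> B) \<Longrightarrow> sum f A \<in> B"
  by (induction A rule: infinite_finite_induct) (auto intro: subring_0 subring_add)

lemma subring_prod: "subring_set B \<Longrightarrow> (\<And>i. i \<in> A \<Longrightarrow> f i \<in> B) \<Longrightarrow> prod f A \<in> B"
  by (induction A rule: infinite_finite_induct) (auto intro: subring_1 subring_mult)

lemma subring_power: "subring_set B \<Longrightarrow> x \<in> B \<Longrightarrow> x ^ n \<in> B"
  by (induction n) (auto intro: subring_1 subring_mult)

lemma subring_of_nat: "subring_set B \<Longrightarrow> of_nat n \<in> B"
  by (induction n) (auto intro: subring_0 subring_1 subring_add)

lemma subring_of_int: "subring_set B \<Longrightarrow> of_int n \<in> B"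
  by (cases n rule: int_diff_cases) (auto intro: subring_diff subring_of_nat)

definition polys_over :: "'k::comm_ring_1 set \<Rightarrow> 'k poly set" where
  "polys_over B = {f. \<forall>k. coeff f k \<in> B}"

lemma polys_overI: "(\<And>k. coeff f k \<in> B) \<Longrightarrow> f \<in> polys_over B"
  and polys_overD: "f \<in> polys_over B \<Longrightarrow> coeff f k \<in> B"
  by (auto simp: polys_over_def)

lemma polys_over_mono: "B \<subseteq> C \<Longrightarrow> polys_over B \<subseteq> polys_over C"
  by (auto simp: polys_over_def)

lemma polys_over_const: "subring_set B \<Longrightarrow> c \<in> B \<Longrightarrow> [:c:] \<in> polys_over B"
  by (auto simp: polys_over_def coeff_pCons subring_0 split: nat.splits)

lemma polys_over_monom: "subring_set B \<Longrightarrow> c \<in> B \<Longrightarrow> monom c n \<in> polys_over B"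
  by (auto simp: polys_over_def subring_0)

lemma subring_polys_over:
  assumes "subring_set B" shows "subring_set (polys_over B)"
  unfolding subring_set_def
proof (intro conjI ballI)
  show "1 \<in> polys_over B" using assms by (auto simp: polys_over_def coeff_1 intro: subring_0 subring_1)
  fix f g assume "f \<in> polys_over B" "g \<in> polys_over B"
  then show "f - g \<in> polys_over B" "f * g \<in> polys_over B"
    using assms by (auto simp: polys_over_def coeff_mult intro!: subring_diff subring_sum subring_mult)
qed

lemma polys_over_smult: "subring_set B \<Longrightarrow> c \<in> B \<Longrightarrow> f \<in> polys_over B \<Longrightarrow> smult c f \<in> polys_over B"
  by (auto simp: polys_over_def intro: subring_mult)

lemma poly_polys_over:
  assumes "subring_set B" "f \<in> polys_over B" "x \<in> B" shows "poly f x \<in> B"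
  unfolding poly_altdef
  using assms by (auto intro!: subring_sum subring_mult subring_power polys_overD)

definition adjoin :: "'k::comm_ring_1 set \<Rightarrow> 'k \<Rightarrow> 'k set" where
  "adjoin B x = (\<lambda>f. poly f x) ` polys_over B"

lemma subring_adjoin:
  assumes "subring_set B" shows "subring_set (adjoin B x)"
proof -
  note P = subring_polys_over[OF assms]
  have "1 \<in> adjoin B x" unfolding adjoin_def using subring_1[OF P] by (metis image_eqI poly_1)
  moreover have "poly f x - poly g x \<in> adjoin B x" "poly f x * poly g x \<in> adjoin B x"
    if "f \<in> polys_over B" "g \<in> polys_over B" for f g
    unfolding adjoin_def using subring_diff[OF P that] subring_mult[OF P that]
    by (metis image_eqI poly_diff, metis image_eqI poly_mult)
  ultimately show ?thesis unfolding subring_set_def adjoin_def by auto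
qed

lemma adjoin_superset: "subring_set B \<Longrightarrow> B \<subseteq> adjoin B x"
  unfolding adjoin_def using polys_over_const by (force intro!: image_eqI)

lemma adjoin_mem: "subring_set B \<Longrightarrow> x \<in> adjoin B x"
  unfolding adjoin_def
  by (rule image_eqI[where x = "monom 1 1"]) (auto simp: poly_monom intro: polys_over_monom subring_1)

definition valuation_ring :: "'k::field set \<Rightarrow> bool" where
  "valuation_ring V \<longleftrightarrow> subring_set V \<and> (\<forall>y. y \<in> V \<or> inverse y \<in> V)"

definition integral_over :: "'k::comm_ring_1 set \<Rightarrow> 'k \<Rightarrow> bool" where
  "integral_over R x \<longleftrightarrow> (\<exists>f\<in>polys_over R. lead_coeff f = 1 \<and> poly f x = 0)"

text \<open>With \<open>b\<close> the constant coefficient of \<open>g\<close> and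
  \<open>t = inverse x\<close>, multiplying \<open>g (inverse y) - b = x - b\<close> by
  \<open>t * y ^ n\<close> and using \<open>t * x = 1\<close> rewrites
  \<open>(1 - t * b) * y ^ n\<close> in lower powers of \<open>y\<close>. This is what makes a
  maximal subring without \<open>x\<close> contain \<open>y\<close> or its inverse.\<close>

lemma degree_reduction_step:
  fixes x y :: "'k::field"
  assumes B: "subring_set B" and x: "x \<notin> B" "inverse x \<in> B" and y: "y \<noteq> 0"
    and f: "f \<in> polys_over B" "poly f y = x" and g: "g \<in> polys_over B" "poly g (inverse y) = x"
    and le: "degree g \<le> degree f"
  shows "\<exists>f'\<in>polys_over B. degree f' < degree f \<and> poly f' y = x"
proof -
  define n l t b where "n = degree f" and "l = degree g" and "t = inverse x" and "b = coeff g 0"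
  have x0: "x \<noteq> 0" using x subring_0[OF B] by auto
  have tx: "t * x = 1" using x0 by (simp add: t_def)
  have n0: "n \<noteq> 0"
  proof
    assume "n = 0"
    then obtain c where "f = [:c:]" by (metis n_def degree_eq_zeroE)
    then show False using f x polys_overD[OF f(1), of 0] by auto
  qed
  define f1 where "f1 = f - monom (coeff f n) n"
  define h where "h = (\<Sum>k=1..l. monom (coeff g k) (n - k))"
  \<comment> \<open>Its value is \<open>b + (1 - t * b) * x = x\<close>: the leading term of
    \<open>(1 - t * b) * f\<close> is traded for \<open>t * coeff f n * h\<close>, and
    \<open>h\<close> has degree below \<open>n\<close>.\<close>
  define f' where "f' = [:b:] + smult (1 - t * b) f1 + smult (t * coeff f n) h"
  note P = subring_polys_over[OF B]
  have tB: "t \<in> B" using x by (simp add: t_def)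
  have bB: "b \<in> B" using g polys_overD by (auto simp: b_def)
  have "f' \<in> polys_over B"
    unfolding f'_def f1_def h_def
    by (intro subring_add[OF P] polys_over_const polys_over_smult B bB subring_diff[OF P] f polys_over_monom
        subring_diff[OF B] subring_mult[OF B] subring_sum[OF P] subring_1[OF B] tB polys_overD[OF f(1)] polys_overD[OF g(1)])
  moreover have "degree f' < n"
  proof -
    have "degree f1 < n"
    proof -
      have "degree f1 \<le> n" unfolding f1_def n_def by (intro degree_diff_le) (auto simp: degree_monom_le)
      moreover have "coeff f1 n = 0" by (simp add: f1_def)
      ultimately show ?thesis using n0
        by (metis coeff_0 degree_0 gr0I leading_coeff_0_iff nat_less_le)
    qed
    moreover have "degree h < n"
      unfolding h_def using n0 by (intro degree_sum_less) (auto intro: le_less_trans[OF degree_monom_le])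
    ultimately show ?thesis unfolding f'_def using n0
      by (intro degree_add_less) (auto intro: le_less_trans[OF degree_smult_le])
  qed
  moreover have "poly f' y = x"
  proof -
    have "x = (\<Sum>k\<le>l. coeff g k * inverse y ^ k)" using g by (simp add: poly_altdef l_def)
    also have "\<dots> = b + (\<Sum>k=1..l. coeff g k * inverse y ^ k)"
      unfolding atMost_atLeast0 by (subst sum.atLeast_Suc_atMost) (auto simp: b_def)
    finally have 1: "x - b = (\<Sum>k=1..l. coeff g k * inverse y ^ k)" by (simp add: algebra_simps)
    have "poly h y = (\<Sum>k=1..l. coeff g k * y ^ (n - k))" by (simp add: h_def poly_sum poly_monom)
    also have "\<dots> = (\<Sum>k=1..l. y ^ n * (coeff g k * inverse y ^ k))"
      using le y by (intro sum.cong) (auto simp: n_def l_def power_diff field_simps)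
    also have "\<dots> = y ^ n * (x - b)" by (simp add: 1 sum_distrib_left)
    finally have 2: "poly h y = y ^ n * (x - b)" .
    have 3: "poly f1 y = x - coeff f n * y ^ n" by (simp add: f1_def poly_monom f)
    have "poly f' y = b + (1 - t * b) * (x - coeff f n * y ^ n) + t * coeff f n * (y ^ n * (x - b))"
      by (simp add: f'_def 2 3)
    also have "\<dots> = b + x - b * (t * x) - coeff f n * y ^ n * (1 - t * x)" by (simp add: algebra_simps)
    finally show ?thesis by (simp add: tx)
  qed
  ultimately show ?thesis unfolding n_def by blast
qed

text \<open>Zorn's lemma on the subrings that contain \<open>A\<close> but not \<open>x\<close>.
  Over a maximal one, any \<open>y\<close> outside makes \<open>x\<close> a polynomial in
  \<open>y\<close>; were \<open>inverse y\<close> outside too, \<open>x\<close> would also be a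
  polynomial in it, and the two least degrees contradict
  \<open>degree_reduction_step\<close>.\<close>

lemma maximal_subring_valuation:
  fixes x :: "'k::field"
  assumes A: "subring_set A" and x: "x \<notin> A" "inverse x \<in> A"
  obtains V where "valuation_ring V" "A \<subseteq> V" "x \<notin> V"
proof -
  define S where "S = {B. subring_set B \<and> A \<subseteq> B \<and> x \<notin> B}"
  have "\<exists>M\<in>S. \<forall>X\<in>S. M \<subseteq> X \<longrightarrow> X = M"
  proof (rule subset_Zorn_nonempty)
    show "S \<noteq> {}" using A x by (auto simp: S_def)
    fix C assume ne: "C \<noteq> {}" and ch: "subset.chain S C"
    have CS: "C \<subseteq> S" using ch by (auto simp: subset_chain_def)
    have pair: "\<exists>Z\<in>C. u \<in> Z \<and> v \<in> Z" if uv: "u \<in> \<Union>C" "v \<in> \<Union>C" for u v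
    proof -
      from uv obtain Z W where ZW: "Z \<in> C" "W \<in> C" "u \<in> Z" "v \<in> W" by auto
      then have "Z \<subseteq> W \<or> W \<subseteq> Z" using ch by (auto simp: subset_chain_def)
      with ZW show ?thesis by blast
    qed
    have "subring_set (\<Union>C)"
      unfolding subring_set_def
    proof (intro conjI ballI)
      show "1 \<in> \<Union>C" using ne CS by (auto simp: S_def intro: subring_1)
      fix u v assume "u \<in> \<Union>C" "v \<in> \<Union>C"
      then obtain Z where "Z \<in> C" "u \<in> Z" "v \<in> Z" using pair by blast
      moreover have "subring_set Z" using CS \<open>Z \<in> C\<close> by (auto simp: S_def)
      ultimately show "u - v \<in> \<Union>C" "u * v \<in> \<Union>C" by (auto intro: subring_diff subring_mult)
    qed
    then show "\<Union>C \<in> S" using ne CS by (auto simp: S_def)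
  qed
  then obtain V where V: "V \<in> S" and max: "\<And>X. X \<in> S \<Longrightarrow> V \<subseteq> X \<Longrightarrow> X = V" by blast
  have sV: "subring_set V" and AV: "A \<subseteq> V" and xV: "x \<notin> V" using V by (auto simp: S_def)
  have xadj: "\<exists>f\<in>polys_over V. poly f y = x" if "y \<notin> V" for y
  proof (rule ccontr)
    assume "\<not> ?thesis"
    then have "x \<notin> adjoin V y" by (auto simp: adjoin_def)
    then have "adjoin V y \<in> S" using subring_adjoin[OF sV] adjoin_superset[OF sV] AV by (auto simp: S_def)
    then have "adjoin V y = V" using max adjoin_superset[OF sV] by blast
    then show False using that adjoin_mem[OF sV] by blast
  qed
  have "y \<in> V \<or> inverse y \<in> V" for y
  proof (rule ccontr)
    assume "\<not> ?thesis"
    then have y: "y \<notin> V" "inverse y \<notin> V" by auto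
    have y0: "y \<noteq> 0" using y subring_0[OF sV] by auto
    define Q where "Q z m \<longleftrightarrow> (\<exists>f\<in>polys_over V. poly f z = x \<and> degree f = m)" for z m
    define n where "n z = (LEAST m. Q z m)" for z
    have n: "\<exists>f\<in>polys_over V. poly f z = x \<and> degree f = n z" if z: "z \<notin> V" for z
    proof -
      have "\<exists>m. Q z m" using xadj[OF z] by (auto simp: Q_def)
      then have "Q z (n z)" unfolding n_def by (rule LeastI_ex)
      then show ?thesis by (simp add: Q_def)
    qed
    have nmin: "n z \<le> degree f" if "f \<in> polys_over V" "poly f z = x" for z f
      unfolding n_def by (rule Least_le) (use that in \<open>auto simp: Q_def\<close>)
    have *: False if z: "z \<notin> V" "inverse z \<notin> V" and z0: "z \<noteq> 0" and le: "n (inverse z) \<le> n z" for z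
    proof -
      obtain f g where f: "f \<in> polys_over V" "poly f z = x" "degree f = n z"
        and g: "g \<in> polys_over V" "poly g (inverse z) = x" "degree g = n (inverse z)"
        using n z by blast
      obtain f' where "f' \<in> polys_over V" "degree f' < degree f" "poly f' z = x"
        using degree_reduction_step[OF sV xV _ z0 f(1,2) g(1,2)] le f(3) g(3) x(2) AV by auto
      then show False using nmin[of f' z] f(3) by simp
    qed
    show False 
    proof (cases "n (inverse y) \<le> n y")
      case True
      then show False using *[OF y y0] by simp
    next
      case False
      then show False using *[of "inverse y"] y y0 by simp
    qed
  qed
  then show thesis using that sV AV xV by (auto simp: valuation_ring_def)
qed

text \<open>If \<open>x\<close> lies in the ring generated by \<open>R\<close> and
  \<open>inverse x\<close>, clearing denominators in \<open>x = f (inverse x)\<close> gives a monic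
  equation. If not, a valuation ring containing that ring omits \<open>x\<close>.\<close>

lemma integral_over_if_in_valuation_rings:
  fixes x :: "'k::field"
  assumes R: "subring_set R" and x: "\<And>V. valuation_ring V \<Longrightarrow> R \<subseteq> V \<Longrightarrow> x \<in> V"
  shows "integral_over R x"
proof (cases "x = 0")
  case True
  then show ?thesis unfolding integral_over_def
    by (intro bexI[of _ "monom 1 1"]) (auto simp: poly_monom degree_monom_eq intro: polys_over_monom subring_1 R)
next
  case False
  define A where "A = adjoin R (inverse x)"
  have A: "subring_set A" "R \<subseteq> A" "inverse x \<in> A"
    using subring_adjoin[OF R] adjoin_superset[OF R] adjoin_mem[OF R] by (auto simp: A_def)
  have "x \<in> A"
  proof (rule ccontr)
    assume "x \<notin> A"
    then obtain V where "valuation_ring V" "A \<subseteq> V" "x \<notin> V"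
      using maximal_subring_valuation[OF A(1) _ A(3)] by metis
    with x A(2) show False by blast
  qed
  then obtain f where f: "f \<in> polys_over R" "x = poly f (inverse x)" by (auto simp: A_def adjoin_def)
  define n where "n = degree f"
  define h where "h = (\<Sum>k\<le>n. monom (coeff f k) (n - k))"
  define g where "g = monom 1 (Suc n) - h"
  note P = subring_polys_over[OF R]
  have "g \<in> polys_over R" unfolding g_def h_def
    by (intro subring_diff[OF P] polys_over_monom R subring_1[OF R] subring_sum[OF P] polys_overD[OF f(1)])
  moreover have dh: "degree h < Suc n"
    unfolding h_def by (intro degree_sum_less) (auto intro: le_less_trans[OF degree_monom_le])
  moreover have "lead_coeff g = 1"
  proof -
    have "degree g = Suc n" unfolding g_def using dh
      by (metis degree_add_eq_left degree_minus degree_monom_eq diff_conv_add_uminus zero_neq_one)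
    then show ?thesis using dh by (simp add: g_def coeff_eq_0)
  qed
  moreover have "poly g x = 0"
  proof -
    have "poly h x = (\<Sum>k\<le>n. coeff f k * x ^ (n - k))" by (simp add: h_def poly_sum poly_monom)
    also have "\<dots> = (\<Sum>k\<le>n. x ^ n * (coeff f k * inverse x ^ k))"
      using False by (intro sum.cong) (auto simp: power_diff field_simps)
    also have "\<dots> = x ^ n * poly f (inverse x)" by (simp add: poly_altdef n_def sum_distrib_left)
    also have "\<dots> = x ^ n * x" using f by simp
    finally show ?thesis by (simp add: g_def poly_monom)
  qed
  ultimately show ?thesis unfolding integral_over_def by blast
qed

section \<open>Stress-free positions of triangulated spheres\<close>

text \<open>Finite-dimensional duality between a span and its annihilator. It serves twice: over the
  rationals to fill a closed path by faces, and over the reals to express a trivial kernel by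
  explicit coefficients.\<close>

lemma span_duality:
  fixes f :: "'i \<Rightarrow> 'e \<Rightarrow> 'k::field"
  assumes I: "finite I" and E: "finite E"
    and z: "\<And>h. (\<And>i. i \<in> I \<Longrightarrow> (\<Sum>e\<in>E. h e * f i e) = 0) \<Longrightarrow> (\<Sum>e\<in>E. h e * z e) = 0"
  shows "\<exists>c. \<forall>e\<in>E. z e = (\<Sum>i\<in>I. c i * f i e)"
  using I z
proof (induction I arbitrary: z rule: finite_induct)
  case empty
  have "z e = 0" if "e \<in> E" for e
    using empty[of "\<lambda>x. of_bool (x = e)"] that E by simp
  then show ?case by auto
next
  case (insert i I)
  show ?case
  proof (cases "\<forall>h. (\<forall>j\<in>I. (\<Sum>e\<in>E. h e * f j e) = 0) \<longrightarrow> (\<Sum>e\<in>E. h e * f i e) = 0")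
    case True
    have "\<exists>c. \<forall>e\<in>E. z e = (\<Sum>i\<in>I. c i * f i e)"
      by (rule insert.IH) (use True insert.prems in auto)
    then obtain c where c: "\<forall>e\<in>E. z e = (\<Sum>i\<in>I. c i * f i e)" by auto
    have "(\<Sum>j\<in>insert i I. (c(i := 0)) j * f j e) = (\<Sum>j\<in>I. c j * f j e)" for e
      using insert.hyps by (simp, intro sum.cong) auto
    then show ?thesis using c by metis
  next
    case False
    then obtain h0 where h0: "\<forall>j\<in>I. (\<Sum>e\<in>E. h0 e * f j e) = 0" "(\<Sum>e\<in>E. h0 e * f i e) \<noteq> 0" by auto
    define s where "s = (\<Sum>e\<in>E. h0 e * f i e)"
    \<comment> \<open>A functional that kills the other generators and reads off the coefficient of
      \<open>f i\<close>; subtracting multiples of it makes any functional kill \<open>f i\<close>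
      as well.\<close>
    define h1 where "h1 e = h0 e / s" for e
    have h1: "\<forall>j\<in>I. (\<Sum>e\<in>E. h1 e * f j e) = 0" "(\<Sum>e\<in>E. h1 e * f i e) = 1"
      using h0 by (auto simp: h1_def s_def sum_divide_distrib[symmetric])
    define r where "r = (\<Sum>e\<in>E. h1 e * z e)"
    have "\<exists>c. \<forall>e\<in>E. z e - r * f i e = (\<Sum>j\<in>I. c j * f j e)"
    proof (rule insert.IH)
      fix h assume h: "\<And>j. j \<in> I \<Longrightarrow> (\<Sum>e\<in>E. h e * f j e) = 0"
      define q where "q = (\<Sum>e\<in>E. h e * f i e)"
      have lin: "(\<Sum>e\<in>E. (h e - q * h1 e) * g e) = (\<Sum>e\<in>E. h e * g e) - q * (\<Sum>e\<in>E. h1 e * g e)" for g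
        by (simp add: algebra_simps sum_subtractf sum_distrib_left)
      have "(\<Sum>e\<in>E. (h e - q * h1 e) * z e) = 0"
        
      proof (rule insert.prems)
        fix j assume "j \<in> insert i I"
        then show "(\<Sum>e\<in>E. (h e - q * h1 e) * f j e) = 0"
          unfolding lin using h h1 by (cases "j = i") (auto simp: q_def)
      qed
      then have "(\<Sum>e\<in>E. h e * z e) = q * r" by (simp add: lin r_def)
      then show "(\<Sum>e\<in>E. h e * (z e - r * f i e)) = 0"
        by (simp add: algebra_simps sum_subtractf q_def sum_distrib_left sum_distrib_right)
    qed
    then obtain c where c: "\<forall>e\<in>E. z e - r * f i e = (\<Sum>j\<in>I. c j * f j e)" by auto
    have "(\<Sum>j\<in>insert i I. (c(i := r)) j * f j e) = r * f i e + (\<Sum>j\<in>I. c j * f j e)" for e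
      using insert.hyps by (simp, intro sum.cong) auto
    then have "\<forall>e\<in>E. z e = (\<Sum>j\<in>insert i I. (c(i := r)) j * f j e)"
      using c by (auto simp: algebra_simps)
    then show ?thesis by blast
  qed
qed

lemma common_denominator:
  fixes h :: "'e \<Rightarrow> rat"
  assumes "finite E" shows "\<exists>N m. N > 0 \<and> (\<forall>e\<in>E. of_int N * h e = of_int (m e))"
  using assms
proof induction
  case (insert x E)
  then obtain N m where Nm: "N > 0" "\<forall>e\<in>E. of_int N * h e = of_int (m e)" by auto
  obtain p q where pq: "h x = of_int p / of_int q" "q > 0"
    by (metis quotient_of_div quotient_of_denom_pos prod.exhaust)
  have "q * N > 0" "\<forall>e\<in>insert x E. of_int (q * N) * h e = of_int (if e = x then N * p else q * m e)"
    using Nm pq insert.hyps by (auto simp: mult.assoc)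
  then show ?case by (intro exI[of _ "q * N"] exI[of _ "\<lambda>e. if e = x then N * p else q * m e"]) simp
qed (auto intro: exI[of _ 1])

text \<open>All rotations of each oriented triangle belong to \<open>D\<close>. The last assumption, vanishing first
cohomology, is what makes the closed surface a sphere.\<close>
locale sphere_tri =
  fixes D :: "('v \<times> 'v \<times> 'v) set"
  assumes fin: "finite D" and ne: "D \<noteq> {}"
    and rot: "(x, y, z) \<in> D \<Longrightarrow> (y, z, x) \<in> D"
    and dist: "(x, y, z) \<in> D \<Longrightarrow> x \<noteq> y"
    and uniq: "(x, y, z) \<in> D \<Longrightarrow> (x, y, w) \<in> D \<Longrightarrow> z = w"
    and rev: "(x, y, z) \<in> D \<Longrightarrow> \<exists>w. (y, x, w) \<in> D"
    and conn: "A \<subseteq> D \<Longrightarrow> A \<noteq> {} \<Longrightarrow> (\<And>x y z. (x, y, z) \<in> A \<Longrightarrow> (y, z, x) \<in> A) \<Longrightarrow>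
       (\<And>x y z w. (x, y, z) \<in> A \<Longrightarrow> (y, x, w) \<in> D \<Longrightarrow> (y, x, w) \<in> A) \<Longrightarrow> A = D"
    and coh: "\<And>h :: 'v \<Rightarrow> 'v \<Rightarrow> int. (\<And>x y z. (x, y, z) \<in> D \<Longrightarrow> h x y + h y z + h z x = 0) \<Longrightarrow>
       (\<And>x y z. (x, y, z) \<in> D \<Longrightarrow> h y x = - h x y) \<Longrightarrow>
       \<exists>\<theta> :: 'v \<Rightarrow> real. \<forall>x y z. (x, y, z) \<in> D \<longrightarrow> of_int (h x y) = \<theta> x - \<theta> y"
begin

definition verts :: "'v set" where "verts = fst ` D"

definition adj :: "'v \<Rightarrow> 'v \<Rightarrow> bool" where "adj x y \<longleftrightarrow> (\<exists>z. (x, y, z) \<in> D)"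

lemma rot2: "(x, y, z) \<in> D \<Longrightarrow> (z, x, y) \<in> D"
  by (blast dest: rot)

lemma dist3: "(x, y, z) \<in> D \<Longrightarrow> x \<noteq> y \<and> y \<noteq> z \<and> x \<noteq> z"
  using dist rot by metis

lemma adj_sym: "adj x y \<Longrightarrow> adj y x"
  unfolding adj_def using rev by blast

lemma adj_irrefl: "adj x y \<Longrightarrow> x \<noteq> y"
  unfolding adj_def using dist by blast

lemma adj_verts: "adj x y \<Longrightarrow> x \<in> verts" "adj x y \<Longrightarrow> y \<in> verts"
  unfolding adj_def verts_def by (force, metis fst_conv image_eqI rot)

lemma adj_tri: "(x, y, z) \<in> D \<Longrightarrow> adj x y \<and> adj y z \<and> adj z x \<and> adj y x \<and> adj z y \<and> adj x z"
  using adj_sym rot rot2 by (metis adj_def)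

lemma fin_verts: "finite verts"
  using fin by (simp add: verts_def)

text \<open>The link of a vertex is a single cycle: otherwise splitting the vertex gives a cocycle
  whose potential separates the surface.\<close>
lemma link_connected:
  assumes N: "N \<noteq> {}" "\<And>y. y \<in> N \<Longrightarrow> adj a y"
    and pred: "\<And>y z. (a, y, z) \<in> D \<Longrightarrow> z \<in> N \<Longrightarrow> y \<in> N"
    and y: "adj a y"
  shows "y \<in> N"
proof -
  have finN: "finite N" using N(2) adj_verts(2) fin_verts by (meson finite_subset subsetI)
  define pr where "pr z = (SOME y. (a, y, z) \<in> D)" for z
  have pr: "(a, pr z, z) \<in> D" if "z \<in> N" for z
  proof -
    have "adj z a" using N(2) that adj_sym by blast
    then obtain y where "(z, a, y) \<in> D" by (auto simp: adj_def)
    then have "(a, y, z) \<in> D" by (rule rot)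
    then show ?thesis unfolding pr_def by (rule someI)
  qed
  \<comment> \<open>An injective self-map of a finite set is onto, so closure under predecessors
    gives closure under successors.\<close>
  have "inj_on pr N" by (rule inj_onI) (metis pr uniq)
  moreover have "pr ` N \<subseteq> N" using pr pred by auto
  ultimately have surj: "pr ` N = N" using finN by (simp add: endo_inj_surj)
  have succ: "z \<in> N" if ayz: "(a, y, z) \<in> D" and yN: "y \<in> N" for y z
  proof -
    obtain t where "t \<in> N" "y = pr t" using surj yN by auto
    then show ?thesis using pr uniq ayz by metis
  qed
  have aN: "a \<notin> N" using N(2) adj_irrefl by blast
  define h :: "'v \<Rightarrow> 'v \<Rightarrow> int" where
    "h x y = (if x = a \<and> y \<in> N then 1 else if y = a \<and> x \<in> N then -1 else 0)" for x y
  have ha: "h x y + h y z + h z x = 0" if "(x, y, z) \<in> D" "x = a" for x y z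
    using that pred succ dist3[OF that(1)] aN by (auto simp: h_def)
  have "h x y + h y z + h z x = 0" if t: "(x, y, z) \<in> D" for x y z
  proof -
    consider "x = a" | "y = a" | "z = a" | "x \<noteq> a" "y \<noteq> a" "z \<noteq> a" by blast
    then show ?thesis
      using ha[OF t] ha[OF rot[OF t]] ha[OF rot2[OF t]] by cases (auto simp: h_def)
  qed
  moreover have "h y x = - h x y" if "(x, y, z) \<in> D" for x y z
    using aN by (auto simp: h_def)
  ultimately obtain \<theta> :: "'v \<Rightarrow> real" where
    th: "\<And>x y z. (x, y, z) \<in> D \<Longrightarrow> of_int (h x y) = \<theta> x - \<theta> y" using coh by metis
  \<comment> \<open>Away from \<open>a\<close> the potential is constant along edges, and every edge
    has an end other than \<open>a\<close>. So the sheet at height \<open>\<theta> a - 1\<close> is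
    never left by crossing an edge, and connectedness makes it everything.\<close>
  define A where "A = {(x, y, z) \<in> D. \<forall>w\<in>{x, y, z} - {a}. \<theta> w = \<theta> a - 1}"
  have thN: "\<theta> y = \<theta> a - 1" if "y \<in> N" for y
  proof -
    obtain z where "(a, y, z) \<in> D" using N(2) \<open>y \<in> N\<close> by (auto simp: adj_def)
    then show ?thesis using th[of a y z] that by (simp add: h_def)
  qed
  have eq: "\<theta> x = \<theta> y" if "adj x y" "x \<noteq> a" "y \<noteq> a" for x y
    using that th by (force simp: adj_def h_def)
  have "A = D"
  proof (rule conn)
    show "A \<subseteq> D" by (auto simp: A_def)
    obtain y z where "y \<in> N" "(a, y, z) \<in> D" using N by (force simp: adj_def)
    then have "(a, y, z) \<in> A" using succ thN by (auto simp: A_def)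
    then show "A \<noteq> {}" by blast
    show "(y, z, x) \<in> A" if "(x, y, z) \<in> A" for x y z
      using that rot by (auto simp: A_def)
    show "(y, x, w) \<in> A" if t: "(x, y, z) \<in> A" and d: "(y, x, w) \<in> D" for x y z w
    proof -
      obtain u where u: "u \<in> {x, y}" "u \<noteq> a" using dist[OF d] by auto
      have "\<theta> u = \<theta> a - 1" using t u by (auto simp: A_def)
      moreover have "\<theta> v = \<theta> u" if "v \<in> {y, x, w}" "v \<noteq> a" for v
        using adj_tri[OF d] that u eq by (metis insertE singletonD)
      ultimately show ?thesis using d by (auto simp: A_def)
    qed
  qed
  obtain z where z: "(a, y, z) \<in> D" using y by (auto simp: adj_def)
  then have "(a, y, z) \<in> A" using \<open>A = D\<close> by simp
  then have "\<theta> y = \<theta> a - 1" using dist[OF z] by (auto simp: A_def)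
  then have "of_int (h a y) = (1::real)" using th[OF z] by simp
  then show ?thesis using dist[OF z] by (simp add: h_def split: if_splits)
qed

section \<open>Discrete Jordan curves: regions bounded by 3-cycles\<close>

definition rotclosed :: "('v \<times> 'v \<times> 'v) set \<Rightarrow> bool" where
  "rotclosed B \<longleftrightarrow> B \<subseteq> D \<and> (\<forall>x y z. (x, y, z) \<in> B \<longrightarrow> (y, z, x) \<in> B)"

definition left :: "('v \<times> 'v \<times> 'v) set \<Rightarrow> 'v \<Rightarrow> 'v \<Rightarrow> bool" where
  "left B x y \<longleftrightarrow> (\<exists>z. (x, y, z) \<in> B)"

definition bdry :: "('v \<times> 'v \<times> 'v) set \<Rightarrow> 'v \<Rightarrow> 'v \<Rightarrow> int" where
  "bdry B x y = of_bool (left B x y) - of_bool (left B y x)"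

definition cyc :: "'v \<Rightarrow> 'v \<Rightarrow> 'v \<Rightarrow> 'v \<Rightarrow> 'v \<Rightarrow> int" where
  "cyc u v w x y = of_bool ((x, y) \<in> {(u, v), (v, w), (w, u)}) - of_bool ((y, x) \<in> {(u, v), (v, w), (w, u)})"

text \<open>The side of the closed path \<open>u v w\<close> singled out by the orientation,
  described by equality of boundary chains; \<open>cyc\<close> is the antisymmetric 1-chain of the
  path.\<close>

definition region :: "('v \<times> 'v \<times> 'v) set \<Rightarrow> 'v \<Rightarrow> 'v \<Rightarrow> 'v \<Rightarrow> bool" where
  "region B u v w \<longleftrightarrow> rotclosed B \<and> (\<forall>x y. bdry B x y = cyc u v w x y)"

lemma rotclosed_rot2: "rotclosed B \<Longrightarrow> (x, y, z) \<in> B \<Longrightarrow> (z, x, y) \<in> B"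
  unfolding rotclosed_def by blast

lemma left_adj: "rotclosed B \<Longrightarrow> left B x y \<Longrightarrow> adj x y"
  by (auto simp: left_def adj_def rotclosed_def)

lemma leftD: "rotclosed B \<Longrightarrow> left B x y \<Longrightarrow> (x, y, z) \<in> D \<Longrightarrow> (x, y, z) \<in> B"
  unfolding left_def rotclosed_def using uniq by blast

text \<open>The boundary of a boundary vanishes: sending an edge out of \<open>x\<close> that
  belongs to a face of \<open>B\<close> to the third vertex of that face matches outgoing with
  incoming edges.\<close>

lemma bdry_sum:
  assumes B: "rotclosed B"
  shows "(\<Sum>y\<in>verts. bdry B x y) = 0"
proof -
  define S where "S = {y \<in> verts. left B x y}"
  define T where "T = {y \<in> verts. left B y x}"
  have "bij_betw (\<lambda>y. SOME z. (x, y, z) \<in> B) S T"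
  proof -
    define g where "g y = (SOME z. (x, y, z) \<in> B)" for y
    have g: "(x, y, g y) \<in> B" if "y \<in> S" for y
      unfolding g_def using that by (auto simp: S_def left_def intro: someI_ex)
    have gD: "(x, y, g y) \<in> D" if "y \<in> S" for y using g[OF that] B by (auto simp: rotclosed_def)
    have "inj_on g S"
    proof (rule inj_onI)
      fix y y' assume y: "y \<in> S" "y' \<in> S" "g y = g y'"
      have "(g y, x, y) \<in> D" "(g y', x, y') \<in> D" using gD y rot2 by blast+
      then show "y = y'" using y(3) uniq by metis
    qed
    moreover have "g ` S = T"
    proof
      show "g ` S \<subseteq> T"
      proof
        fix t assume "t \<in> g ` S"
        then obtain y where y: "y \<in> S" "t = g y" by auto
        then have "(t, x, y) \<in> B" using g rotclosed_rot2[OF B] by blast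
        then have l: "left B t x" by (auto simp: left_def)
        then show "t \<in> T" using adj_verts(1)[OF left_adj[OF B l]] by (auto simp: T_def)
      qed
      show "T \<subseteq> g ` S"
      proof
        fix t assume "t \<in> T"
        then obtain y where y: "(t, x, y) \<in> B" by (auto simp: T_def left_def)
        then have xyt: "(x, y, t) \<in> B" using B by (auto simp: rotclosed_def)
        then have l: "left B x y" by (auto simp: left_def)
        then have "y \<in> S" using adj_verts(2)[OF left_adj[OF B l]] by (auto simp: S_def)
        moreover have "g y = t" using gD[OF \<open>y \<in> S\<close>] xyt B uniq by (auto simp: rotclosed_def)
        ultimately show "t \<in> g ` S" by blast
      qed
    qed
    ultimately show ?thesis by (simp add: bij_betw_def g_def[abs_def])
  qed
  then have "card S = card T" by (rule bij_betw_same_card)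
  then show ?thesis
    using fin_verts by (simp add: bdry_def sum_subtractf sum.If_cases of_bool_def S_def T_def Int_def)
qed

text \<open>At each vertex of the path only two edges can carry \<open>J\<close>, so what flows in
  must flow out: a circulation supported on the path is a multiple of it.\<close>

lemma circulation_on_triangle:
  fixes J :: "'v \<Rightarrow> 'v \<Rightarrow> int"
  assumes d: "u \<noteq> v" "v \<noteq> w" "u \<noteq> w" and V: "{u, v, w} \<subseteq> verts"
    and anti: "\<And>x y. J y x = - J x y" and div: "\<And>x. (\<Sum>y\<in>verts. J x y) = 0"
    and supp: "\<And>x y. cyc u v w x y = 0 \<Longrightarrow> J x y = 0"
  shows "J u v = J v w" "J v w = J w u"
proof -
  have "J v u + J v w = 0"
  proof -
    have "(\<Sum>y\<in>verts. J v y) = (\<Sum>y\<in>{u, w}. J v y)"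
      by (rule sum.mono_neutral_right) (use V fin_verts d supp in \<open>auto simp: cyc_def\<close>)
    then show ?thesis using div[of v] d by simp
  qed
  then show "J u v = J v w" using anti[of u v] by simp
  have "J w v + J w u = 0"
  proof -
    have "(\<Sum>y\<in>verts. J w y) = (\<Sum>y\<in>{u, v}. J w y)"
      by (rule sum.mono_neutral_right) (use V fin_verts d supp in \<open>auto simp: cyc_def\<close>)
    then show ?thesis using div[of w] d by simp
  qed
  then show "J v w = J w u" using anti[of v w] by simp
qed

lemma cyc_anti: "cyc u v w y x = - cyc u v w x y"
  unfolding cyc_def by (simp only: minus_diff_eq)

lemma cyc_reverse: "cyc u w v x y = - cyc u v w x y"
proof -
  have "(x, y) \<in> {(u, w), (w, v), (v, u)} \<longleftrightarrow> (y, x) \<in> {(u, v), (v, w), (w, u)}" for x y by auto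
  then show ?thesis unfolding cyc_def by (simp only: minus_diff_eq)
qed

lemma cyc_sum:
  assumes d: "u \<noteq> v" "v \<noteq> w" "u \<noteq> w" and V: "{u, v, w} \<subseteq> verts"
  shows "(\<Sum>y\<in>verts. cyc u v w x y) = 0"
proof -
  have "(\<Sum>y\<in>verts. cyc u v w x y) = (\<Sum>y\<in>{u, v, w}. cyc u v w x y)"
    by (rule sum.mono_neutral_right) (use V fin_verts in \<open>auto simp: cyc_def\<close>)
  then show ?thesis using d by (auto simp: cyc_def)
qed

end

context sphere_tri begin

lemma adj_faces: "adj x y \<Longrightarrow> \<exists>z t. (x, y, z) \<in> D \<and> (y, x, t) \<in> D"
  unfolding adj_def using rev by blast

lemma bdry_eq_0: "bdry B x y = 0 \<longleftrightarrow> (left B x y \<longleftrightarrow> left B y x)"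
  and bdry_eq_1: "bdry B x y = 1 \<longleftrightarrow> left B x y \<and> \<not> left B y x"
  by (cases "left B x y"; cases "left B y x"; simp add: bdry_def)+

text \<open>A rational 2-chain with boundary \<open>u v w\<close> exists by duality, since vanishing
  cohomology makes every cocycle sum to zero along the path. The faces on which its density \<beta>
  is largest form the region: their boundary can only run along the path and in its direction, and
  it is not zero because \<beta> jumps by one across \<open>u v\<close>.\<close>

lemma region_exists:
  assumes uvw: "adj u v" "adj v w" "adj w u"
  obtains B where "region B u v w"
proof -
  note ne3 = adj_irrefl[OF uvw(1)] adj_irrefl[OF uvw(2)] adj_irrefl[OF uvw(3)]
  have V: "{u, v, w} \<subseteq> verts" using uvw adj_verts by auto
  define E where "E = (\<lambda>(x, y, z). (x, y)) ` D"
  have E: "(x, y) \<in> E \<longleftrightarrow> adj x y" for x y by (force simp: E_def adj_def)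
  have finE: "finite E" using fin by (simp add: E_def)
  define ind where "ind x y e = (of_bool (e = (x, y)) - of_bool (e = (y, x)) :: rat)" for x y :: 'v and e
  define dd where "dd t e = (case t of (x, y, z) \<Rightarrow> ind x y e + ind y z e + ind z x e)" for t :: "'v \<times> 'v \<times> 'v" and e
  have sum_ind: "(\<Sum>e\<in>E. h e * ind x y e) = h (x, y) - h (y, x)" if "adj x y" for h x y
    using that adj_sym[OF that] finE by (simp add: ind_def algebra_simps sum_subtractf E)
  have "\<exists>c. \<forall>e\<in>E. (ind u v e + ind v w e + ind w u e) = (\<Sum>t\<in>D. c t * dd t e)"
  proof (rule span_duality[OF fin finE])
    fix h assume h: "\<And>t. t \<in> D \<Longrightarrow> (\<Sum>e\<in>E. h e * dd t e) = 0"
    obtain N m where N: "N > 0" and m: "\<And>e. e \<in> E \<Longrightarrow> of_int N * h e = of_int (m e)"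
      using common_denominator[OF finE] by metis
    define k where "k x y = m (x, y) - m (y, x)" for x y
    have k: "of_int (k x y) = of_int N * (h (x, y) - h (y, x))" if "adj x y" for x y
      using m[of "(x, y)"] m[of "(y, x)"] that adj_sym[OF that] by (simp add: k_def E algebra_simps)
    have "k x y + k y z + k z x = 0" if t: "(x, y, z) \<in> D" for x y z
    proof -
      note a = adj_tri[OF t]
      have "0 = (\<Sum>e\<in>E. h e * dd (x, y, z) e)" using h[OF t] by simp
      also have "\<dots> = (h (x, y) - h (y, x)) + (h (y, z) - h (z, y)) + (h (z, x) - h (x, z))"
        using a by (simp add: dd_def distrib_left sum.distrib sum_ind)
      finally have "of_int (k x y + k y z + k z x) = (0 :: rat)"
        using a by (simp add: k flip: distrib_left)
      then show ?thesis by linarith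
    qed
    moreover have "k y x = - k x y" for x y by (simp add: k_def)
    ultimately obtain \<theta> :: "'v \<Rightarrow> real" where th: "\<And>x y z. (x, y, z) \<in> D \<Longrightarrow> of_int (k x y) = \<theta> x - \<theta> y"
      using coh by metis
    have th': "of_int (k x y) = \<theta> x - \<theta> y" if "adj x y" for x y using that th by (auto simp: adj_def)
    have "of_int (k u v + k v w + k w u) = (0 :: real)" using uvw by (simp add: th')
    then have "k u v + k v w + k w u = 0" by linarith
    then have "of_int (k u v + k v w + k w u) = (0 :: rat)" by (simp only: of_int_0)
    then have "of_int N * ((h (u, v) - h (v, u)) + (h (v, w) - h (w, v)) + (h (w, u) - h (u, w))) = (0 :: rat)"
      using uvw by (simp only: of_int_add k distrib_left)
    then have "(h (u, v) - h (v, u)) + (h (v, w) - h (w, v)) + (h (w, u) - h (u, w)) = 0"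
      using N by (metis mult_eq_0_iff of_int_eq_0_iff less_irrefl)
    then show "(\<Sum>e\<in>E. h e * (ind u v e + ind v w e + ind w u e)) = 0"
      using uvw by (simp only: distrib_left sum.distrib sum_ind)
  qed
  then obtain c where c: "\<And>e. e \<in> E \<Longrightarrow> ind u v e + ind v w e + ind w u e = (\<Sum>t\<in>D. c t * dd t e)" by auto
  have cyc_ind: "of_int (cyc u v w x y) = ind u v (x, y) + ind v w (x, y) + ind w u (x, y)" for x y
    using ne3 by (auto simp: cyc_def ind_def)
  \<comment> \<open>\<open>D\<close> contains each face in three rotations; the sum of their
    coefficients depends on the face only.\<close>
  define \<beta> where "\<beta> t = (case t of (x, y, z) \<Rightarrow> c (x, y, z) + c (y, z, x) + c (z, x, y))" for t
  have \<beta>_rot: "\<beta> (y, z, x) = \<beta> (x, y, z)" for x y z by (simp add: \<beta>_def)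
  have jump: "\<beta> (x, y, z) - \<beta> (y, x, t) = of_int (cyc u v w x y)" if d: "(x, y, z) \<in> D" "(y, x, t) \<in> D" for x y z t
  proof -
    define F where "F x y z = (\<Sum>t\<in>D. c t * (case t of (p, q, r) \<Rightarrow>
        of_bool ((p, q) = (x, y)) + of_bool ((q, r) = (x, y)) + of_bool ((r, p) = (x, y))))" for x y z :: 'v
    have F: "F x y z = \<beta> (x, y, z)" if d: "(x, y, z) \<in> D" for x y z
    proof -
      have "(case s of (p, q, r) \<Rightarrow> of_bool ((p, q) = (x, y)) + of_bool ((q, r) = (x, y)) + of_bool ((r, p) = (x, y)))
          = (of_bool (s = (x, y, z)) + of_bool (s = (z, x, y)) + of_bool (s = (y, z, x)) :: rat)"
        if "s \<in> D" for s
      proof -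
        obtain p q r where s: "s = (p, q, r)" by (cases s) auto
        have "(p, q) = (x, y) \<longleftrightarrow> s = (x, y, z)" using uniq[of x y z r] that d s by auto
        moreover have "(q, r) = (x, y) \<longleftrightarrow> s = (z, x, y)"
          using uniq[of x y z p] rot[of p q r] that d s by auto
        moreover have "(r, p) = (x, y) \<longleftrightarrow> s = (y, z, x)"
          using uniq[of x y z q] rot2[of p q r] that d s by auto
        ultimately show ?thesis by (simp add: s del: prod.inject)
      qed
      then have "F x y z = (\<Sum>s\<in>D. c s * (of_bool (s = (x, y, z)) + of_bool (s = (z, x, y)) + of_bool (s = (y, z, x))))"
        unfolding F_def by (intro sum.cong) auto
      then show ?thesis using d rot[OF d] rot2[OF d] fin by (simp add: distrib_left sum.distrib \<beta>_def)
    qed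
    have "of_int (cyc u v w x y) = (\<Sum>s\<in>D. c s * dd s (x, y))"
      using c[of "(x, y)"] d E by (auto simp: cyc_ind adj_def)
    also have "\<dots> = F x y z - F y x t"
      unfolding F_def sum_subtractf[symmetric]
    proof (intro sum.cong refl)
      fix s assume "s \<in> D"
      obtain p q r where s: "s = (p, q, r)" by (cases s) auto
      have sw: "ind p q (x, y) = of_bool ((p, q) = (x, y)) - of_bool ((p, q) = (y, x))" for p q
      proof -
        have "(x, y) = (p, q) \<longleftrightarrow> (p, q) = (x, y)" "(x, y) = (q, p) \<longleftrightarrow> (p, q) = (y, x)" by auto
        then show ?thesis unfolding ind_def by (simp only:)
      qed
      have alg: "k * (A - A' + (B - B') + (C - C')) = k * (A + B + C) - k * (A' + B' + C')"
        for k A A' B B' C C' :: rat by algebra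
      show "c s * dd s (x, y) = c s * (case s of (p, q, r) \<Rightarrow> of_bool ((p, q) = (x, y)) + of_bool ((q, r) = (x, y)) +
          of_bool ((r, p) = (x, y))) - c s * (case s of (p, q, r) \<Rightarrow> of_bool ((p, q) = (y, x)) +
          of_bool ((q, r) = (y, x)) + of_bool ((r, p) = (y, x)))"
        unfolding s dd_def prod.case sw by (rule alg)
    qed
    finally show ?thesis using F d by simp
  qed
  define M where "M = Max (\<beta> ` D)"
  define B where "B = {t \<in> D. \<beta> t = M}"
  have Mge: "\<beta> t \<le> M" if "t \<in> D" for t using that fin by (simp add: M_def)
  have "M \<in> \<beta> ` D" unfolding M_def using fin ne by (intro Max_in) auto
  then have Bne: "B \<noteq> {}" by (auto simp: B_def)
  have rc: "rotclosed B" using rot \<beta>_rot by (auto simp: rotclosed_def B_def)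
  have left: "left B x y \<longleftrightarrow> \<beta> (x, y, z) = M" if "(x, y, z) \<in> D" for x y z
    using that uniq by (auto simp: left_def B_def)
  have b0: "bdry B x y = 0" if "cyc u v w x y = 0" for x y
  proof (cases "adj x y")
    case True
    then obtain z t where zt: "(x, y, z) \<in> D" "(y, x, t) \<in> D" using adj_faces by blast
    then show ?thesis using jump[OF zt] that left by (simp add: bdry_def)
  next
    case False
    then show ?thesis using left_adj[OF rc] adj_sym by (auto simp: bdry_def)
  qed
  have b1: "bdry B x y \<in> {0, 1}" if cy: "cyc u v w x y = 1" and a: "adj x y" for x y
  proof -
    obtain z t where zt: "(x, y, z) \<in> D" "(y, x, t) \<in> D" using adj_faces[OF a] by blast
    then have "\<beta> (y, x, t) \<noteq> M" using jump[OF zt] Mge[OF zt(1)] cy by simp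
    then show ?thesis using left zt by (simp add: bdry_def)
  qed
  have cyc1: "cyc u v w u v = 1" "cyc u v w v w = 1" "cyc u v w w u = 1"
    using ne3 by (auto simp: cyc_def)
  have anti: "bdry B y x = - bdry B x y" for x y by (simp add: bdry_def)
  note eqs = circulation_on_triangle[of u v w "bdry B", OF ne3(1,2) ne3(3)[symmetric] V anti bdry_sum[OF rc] b0]
  have "bdry B u v = 1"
  proof (rule ccontr)
    assume "\<not> ?thesis"
    then have z3: "bdry B u v = 0" "bdry B v w = 0" "bdry B w u = 0"
      using b1[OF cyc1(1) uvw(1)] eqs by auto
    have z: "bdry B x y = 0" for x y
    proof (cases "cyc u v w x y = 0")
      case False
      then have "(x, y) \<in> {(u, v), (v, w), (w, u)} \<or> (y, x) \<in> {(u, v), (v, w), (w, u)}"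
        by (auto simp: cyc_def)
      then show ?thesis using z3 anti[of x y] by auto
    qed (use b0 in auto)
    have "B = D"
    proof (rule conn)
      show "B \<subseteq> D" by (auto simp: B_def)
      show "(y, z, x) \<in> B" if "(x, y, z) \<in> B" for x y z using that rc by (auto simp: rotclosed_def)
      show "(y, x, t) \<in> B" if "(x, y, z) \<in> B" "(y, x, t) \<in> D" for x y z t
      proof -
        have "left B x y" using that by (auto simp: left_def)
        then have "left B y x" using z[of x y] by (simp add: bdry_eq_0)
        then show ?thesis using leftD[OF rc] that by blast
      qed
    qed (use Bne in auto)
    moreover obtain z t where zt: "(u, v, z) \<in> D" "(v, u, t) \<in> D" using adj_faces[OF uvw(1)] by blast
    ultimately have "\<beta> (u, v, z) = M" "\<beta> (v, u, t) = M" by (auto simp: B_def)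
    then show False using jump[OF zt] cyc1 by simp
  qed
  then have one: "bdry B u v = 1" "bdry B v w = 1" "bdry B w u = 1" using eqs by auto
  have "bdry B x y = cyc u v w x y" for x y
  proof (cases "cyc u v w x y = 0")
    case False
    then have "(x, y) \<in> {(u, v), (v, w), (w, u)} \<or> (y, x) \<in> {(u, v), (v, w), (w, u)}"
      by (auto simp: cyc_def)
    then show ?thesis using one cyc1 anti[of x y] cyc_anti[of u v w x y] by auto
  qed (use b0 in auto)
  then show thesis using that rc by (auto simp: region_def)
qed

text \<open>No boundary edge of \<open>B\<close> ends at \<open>a\<close>, so the faces of
  \<open>B\<close> around \<open>a\<close> are closed under turning around \<open>a\<close>, and the
  link of \<open>a\<close> is a single cycle.\<close>

lemma star_inside:
  assumes rc: "rotclosed B" and a: "\<And>y. bdry B a y = 0" and l: "left B a t" and y: "adj a y"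
  shows "left B a y" "left B y a"
proof -
  have sym: "left B a x \<longleftrightarrow> left B x a" for x using a[of x] by (simp add: bdry_eq_0)
  have "y \<in> {y. left B a y}"
  proof (rule link_connected[where a = a])
    show "{y. left B a y} \<noteq> {}" using l by auto
    show "adj a x" if "x \<in> {y. left B a y}" for x using that left_adj[OF rc] by auto
    show "x \<in> {y. left B a y}" if d: "(a, x, z) \<in> D" and z: "z \<in> {y. left B a y}" for x z
    proof -
      have "left B z a" using z sym by auto
      then have "(z, a, x) \<in> B" using leftD[OF rc _ rot2[OF d]] by auto
      then have "(a, x, z) \<in> B" using rc by (auto simp: rotclosed_def)
      then show ?thesis by (auto simp: left_def)
    qed
  qed (rule y)
  then show "left B a y" "left B y a" using sym by auto
qed

lemma rotclosed_Int: "rotclosed B \<Longrightarrow> rotclosed C \<Longrightarrow> rotclosed (B \<inter> C)"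
  and rotclosed_Diff: "rotclosed B \<Longrightarrow> rotclosed C \<Longrightarrow> rotclosed (B - C)"
  unfolding rotclosed_def using rot by blast+

lemma left_Int: "rotclosed B \<Longrightarrow> rotclosed C \<Longrightarrow> left (B \<inter> C) x y \<longleftrightarrow> left B x y \<and> left C x y"
  unfolding left_def rotclosed_def using uniq by blast

lemma left_Diff: "rotclosed B \<Longrightarrow> rotclosed C \<Longrightarrow> left (B - C) x y \<longleftrightarrow> left B x y \<and> \<not> left C x y"
  unfolding left_def rotclosed_def using uniq by blast

text \<open>A 3-cycle of edges that bounds no face in either orientation. Such cycles are the
  obstruction to contracting \<open>u v\<close>: \<open>w\<close> is then a common neighbour other
  than the apexes of the two faces at \<open>u v\<close>.\<close>

definition bad :: "'v \<Rightarrow> 'v \<Rightarrow> 'v \<Rightarrow> bool" where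
  "bad u v w \<longleftrightarrow> adj u v \<and> adj v w \<and> adj w u \<and> (u, v, w) \<notin> D \<and> (v, u, w) \<notin> D"

text \<open>The face \<open>u v a\<close> puts \<open>a\<close> strictly inside \<open>B\<close>.
  For a region \<open>C\<close> of \<open>u a y\<close>, the chain \<open>J\<close> below is
  supported on the path \<open>u v w\<close>, hence 0 or 1 times that path. In the first case
  \<open>B \<inter> C\<close> is bounded by \<open>u a y\<close>, in the second \<open>B - C\<close>
  by the reversed path. Either one loses the face \<open>u v a\<close>.\<close>

lemma smaller_bad_region:
  assumes b: "bad u v w" and B: "region B u v w" and uva: "(u, v, a) \<in> B" and bd: "bad u a y"
  shows "\<exists>C u' v' w'. bad u' v' w' \<and> region C u' v' w' \<and> card C < card B"
proof -
  have rB: "rotclosed B" and jB: "\<And>x y. bdry B x y = cyc u v w x y" using B by (auto simp: region_def)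
  have uvw: "adj u v" "adj v w" "adj w u" using b by (auto simp: bad_def)
  have uay: "adj u a" "adj a y" "adj y u" using bd by (auto simp: bad_def)
  have aD: "(u, v, a) \<in> D" using uva rB by (auto simp: rotclosed_def)
  have d: "u \<noteq> v" "v \<noteq> w" "u \<noteq> w" "a \<noteq> u" "a \<noteq> v" "a \<noteq> w" "y \<noteq> u" "y \<noteq> a" "y \<noteq> v"
    using adj_irrefl uvw uay dist3[OF aD] aD b rot2[OF aD] bd by (auto simp: bad_def)
  have V: "{u, v, w} \<subseteq> verts" "{u, a, y} \<subseteq> verts" using uvw uay adj_verts by auto
  obtain C where C: "region C u a y" using region_exists[OF uay] .
  have rC: "rotclosed C" and jC: "\<And>x z. bdry C x z = cyc u a y x z" using C by (auto simp: region_def)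
  have fB: "finite B" using rB fin by (auto simp: rotclosed_def intro: finite_subset)
  have "left B a u" using uva rotclosed_rot2[OF rB] by (auto simp: left_def)
  then have sa: "left B a x" "left B x a" if "adj a x" for x
    using star_inside[OF rB _ _ that] jB d by (auto simp: cyc_def)
  have sy: "left B y x" "left B x y" if "adj y x" "y \<noteq> w" for x
    using star_inside[OF rB _ _ that(1), where t = a] jB d that sa(2)[of y] sa(1)[of y] uay(2) adj_sym
    by (auto simp: cyc_def)
  have lB: "left B u v" "left B v w" "left B w u" "\<not> left B v u" "\<not> left B w v" "\<not> left B u w"
    using jB[of u v] jB[of v w] jB[of w u] d bdry_eq_1[of B u v] bdry_eq_1[of B v w] bdry_eq_1[of B w u]
    by (simp_all add: cyc_def)
  define J where "J x z = bdry (B \<inter> C) x z - cyc u a y x z" for x z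
  have jBC: "bdry (B \<inter> C) x z = of_bool (left B x z \<and> left C x z) - of_bool (left B z x \<and> left C z x)" for x z
    by (simp add: bdry_def left_Int rB rC)
  have anti: "J z x = - J x z" for x z
    by (simp add: J_def cyc_anti[of u a y z x] jBC)
  have div: "(\<Sum>z\<in>verts. J x z) = 0" for x
    using bdry_sum[OF rotclosed_Int[OF rB rC]] cyc_sum[of u a y] d V(2)
    by (simp add: J_def sum_subtractf)
  have sameB: "left B x z \<longleftrightarrow> left B z x" if "cyc u v w x z = 0" for x z
    using jB[of x z] that by (simp add: bdry_eq_0)
  have Ccyc: "bdry C x z = of_bool (left C x z) - of_bool (left C z x)" for x z by (simp add: bdry_def)
  \<comment> \<open>An edge of \<open>u a y\<close> that is not on \<open>u v w\<close> ends at
    \<open>a\<close>, or at some \<open>y\<close> different from \<open>w\<close>. Such an end is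
    strictly inside, so \<open>B\<close> lies on both sides of the edge.\<close>
  have inB: "left B x z" if ne0: "cyc u a y x z \<noteq> 0" and nB: "cyc u v w x z = 0" for x z
  proof -
    have e: "(x, z) \<in> {(u, a), (a, y), (y, u)} \<or> (z, x) \<in> {(u, a), (a, y), (y, u)}"
      using ne0 by (auto simp: cyc_def)
    show ?thesis
    proof (cases "x = a \<or> z = a")
      case True
      then show ?thesis using e sa uay adj_sym d by auto
    next
      case False
      then have "(x, z) = (y, u) \<or> (z, x) = (y, u)" using e by auto
      moreover from this have "y \<noteq> w" using nB d by (auto simp: cyc_def)
      ultimately show ?thesis using sy uay by auto
    qed
  qed
  have supp: "J x z = 0" if "cyc u v w x z = 0" for x z
  proof (cases "left B x z")
    case True
    then show ?thesis using sameB[OF that] jC[of x z] by (simp add: J_def jBC Ccyc)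
  next
    case False
    then have "cyc u a y x z = 0" using inB that by blast
    then show ?thesis using False sameB[OF that] by (simp add: J_def jBC)
  qed
  note eqs = circulation_on_triangle[of u v w J, OF d(1,2,3) V(1) anti div supp]
  have Juv: "J u v = of_bool (left C u v)"
    using lB d by (simp add: J_def jBC cyc_def)
  have J3: "J x z = J u v * cyc u v w x z" for x z
  proof (cases "cyc u v w x z = 0")
    case False
    then have "(x, z) \<in> {(u, v), (v, w), (w, u)} \<or> (z, x) \<in> {(u, v), (v, w), (w, u)}"
      by (auto simp: cyc_def)
    moreover have "cyc u v w u v = 1" "cyc u v w v w = 1" "cyc u v w w u = 1"
      using d by (auto simp: cyc_def)
    ultimately show ?thesis using eqs anti[of x z] cyc_anti[of u v w x z] by auto
  qed (use supp in auto)
  show ?thesis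
  proof (cases "left C u v")
    case False
    then have "J x z = 0" for x z using J3 Juv by simp
    then have "bdry (B \<inter> C) x z = cyc u a y x z" for x z by (simp add: J_def)
    then have r: "region (B \<inter> C) u a y" using rotclosed_Int[OF rB rC] by (auto simp: region_def)
    have "B \<inter> C \<noteq> B" using False lB left_Int[OF rB rC] by metis
    then have "card (B \<inter> C) < card B" using fB by (intro psubset_card_mono) auto
    then show ?thesis using r bd by blast
  next
    case True
    have "bdry (B - C) x z = bdry B x z - bdry (B \<inter> C) x z" for x z
      by (auto simp: bdry_def left_Int left_Diff rB rC)
    then have "bdry (B - C) x z = cyc u y a x z" for x z
      using J3[of x z] Juv True jB[of x z] by (simp add: J_def cyc_reverse[of u y a])
    then have r: "region (B - C) u y a" using rotclosed_Diff[OF rB rC] by (auto simp: region_def)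
    have "B - C \<noteq> B" using True lB left_Diff[OF rB rC] by metis
    then have "card (B - C) < card B" using fB by (intro psubset_card_mono) auto
    moreover have "bad u y a" 
      using bd adj_sym[OF uay(1)] adj_sym[OF uay(2)] adj_sym[OF uay(3)] rot2[of u y a] rot[of y u a]
      by (auto simp: bad_def)
    ultimately show ?thesis using r by blast
  qed
qed

text \<open>An innermost non-facial triangle \<open>u v w\<close> has an edge \<open>u a\<close> strictly inside, and a third common
  neighbour of \<open>u\<close> and \<open>a\<close> would give a non-facial triangle further inside.\<close>
lemma contractible_edge_exists:
  obtains u v a b where "(u, v, a) \<in> D" "(v, u, b) \<in> D"
    "\<And>w. adj u w \<Longrightarrow> adj v w \<Longrightarrow> w = a \<or> w = b"
proof -
  note result = that
  have good: thesis if d: "(u, v, a) \<in> D" and nb: "\<And>y. \<not> bad u v y" for u v a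
  proof -
    obtain b where b: "(v, u, b) \<in> D" using rev[OF d] by auto
    have "w = a \<or> w = b" if "adj u w" "adj v w" for w
      using nb[of w] that d b uniq adj_sym[of u w] adj_tri[OF d] by (auto simp: bad_def)
    then show thesis using result d b by blast
  qed
  show thesis
  proof (cases "\<exists>B u v w. bad u v w \<and> region B u v w")
    case False
    obtain u v a where d: "(u, v, a) \<in> D" using ne by auto
    have "\<not> bad u v y" for y
    proof
      assume bd: "bad u v y"
      then obtain B where "region B u v y" using region_exists[of u v y] unfolding bad_def by blast
      with bd False show False by blast
    qed
    then show thesis using good d by blast
  next
    case True
    define Q where "Q n \<longleftrightarrow> (\<exists>B u v w. bad u v w \<and> region B u v w \<and> card B = n)" for n
    have "\<exists>n. Q n" using True by (auto simp: Q_def)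
    then have "Q (LEAST n. Q n)" by (rule LeastI_ex)
    then obtain B u v w where B: "bad u v w" "region B u v w" "card B = (LEAST n. Q n)"
      by (auto simp: Q_def)
    have min: "card B \<le> card C" if "bad u' v' w'" "region C u' v' w'" for C u' v' w'
      unfolding B(3) by (rule Least_le) (use that in \<open>auto simp: Q_def\<close>)
    have rB: "rotclosed B" using B(2) by (simp add: region_def)
    have "u \<noteq> v" "v \<noteq> w" "w \<noteq> u" using B(1) adj_irrefl by (auto simp: bad_def)
    then have "bdry B u v = 1" using B(2) by (auto simp: region_def cyc_def)
    then obtain a where a: "(u, v, a) \<in> B" by (auto simp: bdry_eq_1 left_def)
    have "\<not> bad u a y" for y using smaller_bad_region[OF B(1,2) a] min by (meson not_le)
    moreover have "adj u a" using a rB adj_tri by (auto simp: rotclosed_def)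
    then obtain t where "(u, a, t) \<in> D" by (auto simp: adj_def)
    ultimately show thesis using good by blast
  qed
qed

end

section \<open>Contracting an edge of a triangulated sphere\<close>

context sphere_tri begin

definition contract :: "'v \<Rightarrow> 'v \<Rightarrow> ('v \<times> 'v \<times> 'v) set" where
  "contract u v = (\<lambda>(x, y, z). ((id(v := u)) x, (id(v := u)) y, (id(v := u)) z)) `
     {(x, y, z) \<in> D. \<not> (u \<in> {x, y, z} \<and> v \<in> {x, y, z})}"

end

text \<open>\<open>common\<close> is the link condition for contracting \<open>u v\<close>;
  \<open>simple\<close> excludes two triangles glued along their whole boundary, which contraction
  would degenerate.\<close>

locale contraction = sphere_tri D for D :: "('v \<times> 'v \<times> 'v) set" +
  fixes u v a b :: 'v
  assumes uva: "(u, v, a) \<in> D" and vub: "(v, u, b) \<in> D"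
    and common: "\<And>w. adj u w \<Longrightarrow> adj v w \<Longrightarrow> w = a \<or> w = b"
    and simple: "\<And>x y z. (x, y, z) \<in> D \<Longrightarrow> (y, x, z) \<notin> D"
begin

definition \<pi> :: "'v \<Rightarrow> 'v" where "\<pi> x = (if x = v then u else x)"

definition kept :: "'v \<Rightarrow> 'v \<Rightarrow> 'v \<Rightarrow> bool" where
  "kept x y z \<longleftrightarrow> \<not> (u \<in> {x, y, z} \<and> v \<in> {x, y, z})"

abbreviation "D' \<equiv> contract u v"

lemma D'_def: "D' = (\<lambda>(x, y, z). (\<pi> x, \<pi> y, \<pi> z)) ` {(x, y, z) \<in> D. kept x y z}"
proof -
  have "id(v := u) = \<pi>" by (auto simp: \<pi>_def fun_eq_iff)
  then show ?thesis by (simp add: contract_def kept_def)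
qed

lemma D'I: "(x, y, z) \<in> D \<Longrightarrow> kept x y z \<Longrightarrow> (\<pi> x, \<pi> y, \<pi> z) \<in> D'"
  unfolding D'_def by force

lemma D'E:
  assumes "(x, y, z) \<in> D'"
  obtains x0 y0 z0 where "(x0, y0, z0) \<in> D" "kept x0 y0 z0" "x = \<pi> x0" "y = \<pi> y0" "z = \<pi> z0"
  using assms unfolding D'_def by auto

lemma distinct_uvab: "u \<noteq> v" "u \<noteq> a" "v \<noteq> a" "u \<noteq> b" "v \<noteq> b" "a \<noteq> b"
  using dist3[OF uva] dist3[OF vub] simple[OF uva] vub by auto

lemma kept_rot: "kept x y z \<Longrightarrow> kept y z x"
  by (auto simp: kept_def)

lemma collapsed:
  assumes "(x, y, z) \<in> D" "\<not> kept x y z"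
  shows "(x, y, z) \<in> {(u, v, a), (v, a, u), (a, u, v), (v, u, b), (u, b, v), (b, v, u)}"
proof -
  have d: "x \<noteq> y" "y \<noteq> z" "x \<noteq> z" using dist3[OF assms(1)] by auto
  consider "x = u" "y = v" | "y = u" "z = v" | "z = u" "x = v" | "x = v" "y = u" | "y = v" "z = u" | "z = v" "x = u"
    using assms(2) d dist[OF uva] by (auto simp: kept_def)
  then show ?thesis
  proof cases
    case 1 then show ?thesis using uniq[OF uva] assms(1) by auto
  next
    case 2 then show ?thesis using uniq[OF uva] rot[OF assms(1)] by auto
  next
    case 3 then show ?thesis using uniq[OF uva] rot2[OF assms(1)] uniq[OF rot2[OF vub]] uniq[OF vub] by auto
  next
    case 4 then show ?thesis using uniq[OF vub] assms(1) by auto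
  next
    case 5 then show ?thesis using uniq[OF vub] rot[OF assms(1)] by auto
  next
    case 6 then show ?thesis using uniq[OF uva] rot2[OF assms(1)] uniq[OF vub] by auto
  qed
qed

text \<open>Apexes of the four faces across the edges \<open>v a\<close>, \<open>a u\<close>,
  \<open>b v\<close>, \<open>u b\<close> of the two collapsed faces. After contraction the first two
  become neighbours across \<open>u a\<close>, the last two across \<open>u b\<close>.\<close>

definition "ta = (SOME t. (a, v, t) \<in> D)"
definition "sa = (SOME t. (u, a, t) \<in> D)"
definition "tb = (SOME t. (v, b, t) \<in> D)"
definition "sb = (SOME t. (b, u, t) \<in> D)"

lemma nbr_triangles:
  shows ta: "(a, v, ta) \<in> D" "kept a v ta" and sa: "(u, a, sa) \<in> D" "kept u a sa"
    and tb: "(v, b, tb) \<in> D" "kept v b tb" and sb: "(b, u, sb) \<in> D" "kept b u sb"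
proof -
  show ta: "(a, v, ta) \<in> D" unfolding ta_def using rev[OF rot[OF uva]] by (rule someI_ex)
  show sa: "(u, a, sa) \<in> D" unfolding sa_def using rev[OF rot2[OF uva]] by (rule someI_ex)
  show tb: "(v, b, tb) \<in> D" unfolding tb_def using rev[OF rot2[OF vub]] by (rule someI_ex)
  show sb: "(b, u, sb) \<in> D" unfolding sb_def using rev[OF rot[OF vub]] by (rule someI_ex)
  have "ta \<noteq> u" using simple[OF rot[OF uva]] ta by auto
  then show "kept a v ta" using distinct_uvab by (auto simp: kept_def)
  have "sa \<noteq> v" using simple[OF rot2[OF uva]] sa by auto
  then show "kept u a sa" using distinct_uvab by (auto simp: kept_def)
  have "tb \<noteq> u" using simple[OF rot2[OF vub]] tb by auto
  then show "kept v b tb" using distinct_uvab by (auto simp: kept_def)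
  have "sb \<noteq> v" using simple[OF rot[OF vub]] sb by auto
  then show "kept b u sb" using distinct_uvab by (auto simp: kept_def)
qed

lemma nbr_triangles':
  "(a, u, \<pi> ta) \<in> D'" "(u, a, \<pi> sa) \<in> D'" "(u, b, \<pi> tb) \<in> D'" "(b, u, \<pi> sb) \<in> D'"
  using D'I[OF ta] D'I[OF sa] D'I[OF tb] D'I[OF sb] distinct_uvab by (auto simp: \<pi>_def)

text \<open>The remaining edges of a collapsed face survive because one of the four surrounding
  faces contains their image.\<close>

lemma edge_D':
  assumes d: "(x, y, z) \<in> D" and ne: "{x, y} \<noteq> {u, v}"
  shows "\<exists>w. (\<pi> x, \<pi> y, w) \<in> D'"
proof (cases "kept x y z")
  case True
  then show ?thesis using D'I d by blast
next
  case False
  then have "(x, y, z) \<in> {(u, v, a), (v, a, u), (a, u, v), (v, u, b), (u, b, v), (b, v, u)}"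
    using collapsed d by blast
  then have "(x, y) \<in> {(v, a), (a, u), (u, b), (b, v)}" using ne by auto
  then show ?thesis using nbr_triangles' distinct_uvab by (auto simp: \<pi>_def)
qed

text \<open>The link condition leaves only \<open>a\<close> and \<open>b\<close> as candidates for
  \<open>y\<close>, and there one of the two faces is collapsed. Hence contraction never puts two
  faces on the same side of an edge.\<close>

lemma kept_no_common:
  "(u, y, z) \<in> D \<Longrightarrow> kept u y z \<Longrightarrow> (v, y, w) \<in> D \<Longrightarrow> kept v y w \<Longrightarrow> False"
  "(y, u, z) \<in> D \<Longrightarrow> kept y u z \<Longrightarrow> (y, v, w) \<in> D \<Longrightarrow> kept y v w \<Longrightarrow> False"
proof -
  assume d: "(u, y, z) \<in> D" "kept u y z" "(v, y, w) \<in> D" "kept v y w"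
  then have "y = a \<or> y = b" using common adj_tri by blast
  then show False
    using uniq[OF rot[OF uva], of w] uniq[OF rot[OF vub], of z] d by (auto simp: kept_def)
next
  assume d: "(y, u, z) \<in> D" "kept y u z" "(y, v, w) \<in> D" "kept y v w"
  then have "y = a \<or> y = b" using common adj_tri by blast
  then show False
    using uniq[OF rot2[OF uva], of z] uniq[OF rot2[OF vub], of w] d by (auto simp: kept_def)
qed

lemma uniq_D':
  assumes 1: "(x, y, z) \<in> D'" and 2: "(x, y, w) \<in> D'"
  shows "z = w"
proof -
  obtain x1 y1 z1 where d1: "(x1, y1, z1) \<in> D" "kept x1 y1 z1" "x = \<pi> x1" "y = \<pi> y1" "z = \<pi> z1"
    using D'E[OF 1] .
  obtain x2 y2 z2 where d2: "(x2, y2, z2) \<in> D" "kept x2 y2 z2" "x = \<pi> x2" "y = \<pi> y2" "w = \<pi> z2"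
    using D'E[OF 2] .
  have X: "x1 = x2 \<or> x1 = u \<and> x2 = v \<or> x1 = v \<and> x2 = u" using d1(3) d2(3) by (auto simp: \<pi>_def split: if_splits)
  have Y: "y1 = y2 \<or> y1 = u \<and> y2 = v \<or> y1 = v \<and> y2 = u" using d1(4) d2(4) by (auto simp: \<pi>_def split: if_splits)
  have n: "x1 \<noteq> y1" "x2 \<noteq> y2" using dist d1(1) d2(1) by auto
  have K: "\<not> (x1 \<in> {u, v} \<and> y1 \<in> {u, v})" using d1(2) n by (auto simp: kept_def)
  consider "x1 = x2" "y1 = y2" | "x1 \<noteq> x2" "y1 = y2" | "x1 = x2" "y1 \<noteq> y2"
    using X Y K by auto
  then show ?thesis
  proof cases
    case 1
    then show ?thesis using uniq d1 d2 by metis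
  next
    case 2
    then show ?thesis using X kept_no_common(1) d1(1,2) d2(1,2) by blast
  next
    case 3
    then show ?thesis using Y kept_no_common(2) d1(1,2) d2(1,2) by blast
  qed
qed

lemma rev_D':
  assumes "(x, y, z) \<in> D'" shows "\<exists>w. (y, x, w) \<in> D'"
proof -
  obtain x1 y1 z1 where d1: "(x1, y1, z1) \<in> D" "kept x1 y1 z1" "x = \<pi> x1" "y = \<pi> y1" "z = \<pi> z1"
    using D'E[OF assms] .
  obtain w where "(y1, x1, w) \<in> D" using rev[OF d1(1)] by auto
  moreover have "{y1, x1} \<noteq> {u, v}" using d1(2) by (auto simp: kept_def)
  ultimately show ?thesis using edge_D' d1 by blast
qed

lemma rot_D': "(x, y, z) \<in> D' \<Longrightarrow> (y, z, x) \<in> D'"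
  using D'E D'I rot kept_rot by metis

lemma dist_D':
  assumes "(x, y, z) \<in> D'" shows "x \<noteq> y"
proof -
  obtain x1 y1 z1 where d1: "(x1, y1, z1) \<in> D" "kept x1 y1 z1" "x = \<pi> x1" "y = \<pi> y1" "z = \<pi> z1"
    using D'E[OF assms] .
  then show ?thesis using dist[OF d1(1)] by (auto simp: \<pi>_def kept_def)
qed

definition closed :: "('v \<times> 'v \<times> 'v) set \<Rightarrow> bool" where
  "closed A \<longleftrightarrow> A \<subseteq> D' \<and> (\<forall>x y z. (x, y, z) \<in> A \<longrightarrow> (y, z, x) \<in> A) \<and>
     (\<forall>x y z w. (x, y, z) \<in> A \<longrightarrow> (y, x, w) \<in> D' \<longrightarrow> (y, x, w) \<in> A)"

lemma closedD:
  assumes "closed A"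
  shows closed_sub: "A \<subseteq> D'" and closed_rot: "\<And>x y z. (x, y, z) \<in> A \<Longrightarrow> (y, z, x) \<in> A"
    and closed_adj: "\<And>x y z w. (x, y, z) \<in> A \<Longrightarrow> (y, x, w) \<in> D' \<Longrightarrow> (y, x, w) \<in> A"
  using assms unfolding closed_def by blast+

lemma closed_compl:
  assumes "closed A" shows "closed (D' - A)"
  unfolding closed_def
proof (intro conjI allI impI)
  note A = closedD[OF assms]
  fix x y z
  show "(y, z, x) \<in> D' - A" if "(x, y, z) \<in> D' - A"
    using that rot_D' A(2) by blast
  show "(y, x, w) \<in> D' - A" if "(x, y, z) \<in> D' - A" "(y, x, w) \<in> D'" for w
    using that A(3) by blast
qed auto

text \<open>The collapsed faces are gone, so the way from one side of the gap to the other is the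
  fan of kept faces at \<open>v\<close> between \<open>a\<close> and \<open>b\<close>. Its
  consecutive members stay adjacent, and \<open>link_connected\<close> at \<open>v\<close> makes it
  reach from one end to the other.\<close>

lemma side_imp:
  assumes A: "closed A" and Pa: "(a, u, \<pi> ta) \<in> A"
  shows "(u, b, \<pi> tb) \<in> A"
proof (rule ccontr)
  assume nb: "(u, b, \<pi> tb) \<notin> A"
  define Q where "Q = insert a {y. \<exists>z. (v, y, z) \<in> D \<and> kept v y z \<and> (u, \<pi> y, \<pi> z) \<in> A}"
  have "u \<in> Q"
  proof (rule link_connected[where a = v])
    show "Q \<noteq> {}" by (simp add: Q_def)
    show "adj v y" if "y \<in> Q" for y using that uva adj_tri by (auto simp: Q_def adj_def)
    show "adj v u" using adj_tri[OF uva] by auto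
    show "y \<in> Q" if d: "(v, y, z) \<in> D" and z: "z \<in> Q" for y z
    proof (cases "z = a")
      case True
      then have "y = ta" using rot2[OF d] uniq ta(1) by blast
      moreover have "(u, \<pi> ta, a) \<in> A" using Pa A closed_rot by blast
      moreover have "\<pi> a = a" using distinct_uvab by (simp add: \<pi>_def)
      ultimately show ?thesis using d True ta(2) by (auto simp: Q_def kept_def)
    next
      case False
      then obtain z' where z': "(v, z, z') \<in> D" "kept v z z'" "(u, \<pi> z, \<pi> z') \<in> A" using z by (auto simp: Q_def)
      have "y \<noteq> u"
      proof
        assume "y = u"
        then have "z = b" using d uniq[OF vub] by auto
        then have "z' = tb" using z'(1) uniq tb(1) by blast
        then show False using nb z'(3) \<open>z = b\<close> distinct_uvab by (simp add: \<pi>_def)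
      qed
      moreover have "z \<noteq> u" using z'(2) by (auto simp: kept_def)
      ultimately have k: "kept v y z" using distinct_uvab by (auto simp: kept_def)
      then have "(\<pi> v, \<pi> y, \<pi> z) \<in> D'" using D'I d by blast
      then have "(u, \<pi> y, \<pi> z) \<in> D'" by (simp add: \<pi>_def)
      then have "(\<pi> z, u, \<pi> y) \<in> D'" using rot_D' by blast
      then have "(\<pi> z, u, \<pi> y) \<in> A" using closed_adj[OF A z'(3)] by blast
      then have "(u, \<pi> y, \<pi> z) \<in> A" using closed_rot[OF A] by blast
      then show ?thesis using d k by (auto simp: Q_def)
    qed
  qed
  then show False using distinct_uvab by (auto simp: Q_def kept_def)
qed

lemma side_iff:
  assumes A: "closed A" shows "(a, u, \<pi> ta) \<in> A \<longleftrightarrow> (u, b, \<pi> tb) \<in> A"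
  using side_imp[OF A] side_imp[OF closed_compl[OF A]] nbr_triangles' by blast

text \<open>This lets \<open>conn_D'\<close> lift a closed set to the original sphere: a collapsed
  face receives the status shared by the four faces around the gap.\<close>

lemma across_collapsed:
  assumes A: "closed A" and c: "(y, x, w) \<in> D" "\<not> kept y x w" and d: "(x, y, z) \<in> D" "kept x y z"
  shows "(\<pi> x, \<pi> y, \<pi> z) \<in> A \<longleftrightarrow> (a, u, \<pi> ta) \<in> A"
proof -
  have adj: "(y', x', w') \<in> A \<longleftrightarrow> (x', y', z') \<in> A" if "(y', x', w') \<in> D'" "(x', y', z') \<in> D'" for x' y' z' w'
    using closed_adj[OF A] that by blast
  have "(y, x) \<in> {(v, a), (a, u), (u, b), (b, v)}"
    using collapsed[OF c] d(2) by (auto simp: kept_def)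
  moreover have "(\<pi> x, \<pi> y, \<pi> z) \<in> A \<longleftrightarrow> (a, u, \<pi> ta) \<in> A" if "(y, x) = (v, a)"
  proof -
    have "z = ta" using d(1) ta(1) that uniq by blast
    then show ?thesis using that distinct_uvab by (simp add: \<pi>_def)
  qed
  moreover have "(\<pi> x, \<pi> y, \<pi> z) \<in> A \<longleftrightarrow> (a, u, \<pi> ta) \<in> A" if "(y, x) = (a, u)"
  proof -
    have "z = sa" using d(1) sa(1) that uniq by blast
    then show ?thesis using that distinct_uvab adj[OF nbr_triangles'(2,1)] by (simp add: \<pi>_def)
  qed
  moreover have "(\<pi> x, \<pi> y, \<pi> z) \<in> A \<longleftrightarrow> (u, b, \<pi> tb) \<in> A" if "(y, x) = (b, v)"
  proof -
    have "z = tb" using d(1) tb(1) that uniq by blast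
    then show ?thesis using that distinct_uvab by (simp add: \<pi>_def)
  qed
  moreover have "(\<pi> x, \<pi> y, \<pi> z) \<in> A \<longleftrightarrow> (u, b, \<pi> tb) \<in> A" if "(y, x) = (u, b)"
  proof -
    have "z = sb" using d(1) sb(1) that uniq by blast
    then show ?thesis using that distinct_uvab adj[OF nbr_triangles'(4,3)] by (simp add: \<pi>_def)
  qed
  ultimately show ?thesis using side_iff[OF A] by blast
qed

lemma conn_D':
  assumes A: "closed A" and ne: "A \<noteq> {}"
  shows "A = D'"
proof -
  define B where "B = {(x, y, z) \<in> D. if kept x y z then (\<pi> x, \<pi> y, \<pi> z) \<in> A else (a, u, \<pi> ta) \<in> A}"
  have "B = D"
  proof (rule conn)
    show "B \<subseteq> D" by (auto simp: B_def)
    obtain x y z where t: "(x, y, z) \<in> A" using ne by auto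
    then have "(x, y, z) \<in> D'" using closed_sub[OF A] by auto
    then obtain x0 y0 z0 where "(x0, y0, z0) \<in> D" "kept x0 y0 z0" "x = \<pi> x0" "y = \<pi> y0" "z = \<pi> z0" by (rule D'E)
    then have "(x0, y0, z0) \<in> B" using t by (auto simp: B_def)
    then show "B \<noteq> {}" by blast
    show "(y, z, x) \<in> B" if "(x, y, z) \<in> B" for x y z
    proof -
      have "kept x y z = kept y z x" by (auto simp: kept_def)
      then show ?thesis using that rot closed_rot[OF A] by (auto simp: B_def split: if_splits)
    qed
    show "(y, x, w) \<in> B" if t: "(x, y, z) \<in> B" and d: "(y, x, w) \<in> D" for x y z w
    proof -
      have tD: "(x, y, z) \<in> D" using t by (auto simp: B_def)
      show ?thesis
      proof (cases "kept x y z"; cases "kept y x w")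
        assume k: "kept x y z" "kept y x w"
        then have "(\<pi> x, \<pi> y, \<pi> z) \<in> A" using t by (auto simp: B_def)
        then have "(\<pi> y, \<pi> x, \<pi> w) \<in> A" using closed_adj[OF A] D'I[OF d k(2)] by blast
        then show ?thesis using d k by (auto simp: B_def)
      next
        assume k: "kept x y z" "\<not> kept y x w"
        then show ?thesis using across_collapsed[OF A d k(2) tD k(1)] t d by (auto simp: B_def)
      next
        assume k: "\<not> kept x y z" "kept y x w"
        then show ?thesis using across_collapsed[OF A tD k(1) d k(2)] t d by (auto simp: B_def)
      next
        assume k: "\<not> kept x y z" "\<not> kept y x w"
        then show ?thesis using t d by (auto simp: B_def)
      qed
    qed
  qed
  show ?thesis
  proof
    show "A \<subseteq> D'" by (rule closed_sub[OF A])
    show "D' \<subseteq> A"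
    proof
      fix t assume "t \<in> D'"
      then obtain x y z where "(x, y, z) \<in> D" "kept x y z" "t = (\<pi> x, \<pi> y, \<pi> z)" unfolding D'_def by auto
      moreover from this have "(x, y, z) \<in> B" using \<open>B = D\<close> by simp
      ultimately show "t \<in> A" by (auto simp: B_def)
    qed
  qed
qed

text \<open>The pullback of \<open>h\<close>, set to 0 on the contracted edge, is a cocycle of the
  original sphere. Its potential takes equal values at \<open>u\<close> and \<open>v\<close>, so it
  descends.\<close>

lemma coh_D':
  fixes h :: "'v \<Rightarrow> 'v \<Rightarrow> int"
  assumes h: "\<And>x y z. (x, y, z) \<in> D' \<Longrightarrow> h x y + h y z + h z x = 0"
    and anti: "\<And>x y z. (x, y, z) \<in> D' \<Longrightarrow> h y x = - h x y"
  shows "\<exists>\<theta> :: 'v \<Rightarrow> real. \<forall>x y z. (x, y, z) \<in> D' \<longrightarrow> of_int (h x y) = \<theta> x - \<theta> y"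
proof -
  define k where "k x y = (if \<pi> x = \<pi> y then 0 else h (\<pi> x) (\<pi> y))" for x y
  have k_kept: "k x y = h (\<pi> x) (\<pi> y)" if "(x, y, z) \<in> D" "kept x y z" for x y z
    using dist_D'[OF D'I[OF that]] by (simp add: k_def)
  have k_anti: "k y x = - k x y" if d: "(x, y, z) \<in> D" for x y z
  proof (cases "{x, y} = {u, v}")
    case True
    then have "\<pi> x = \<pi> y" by (auto simp: \<pi>_def doubleton_eq_iff)
    then show ?thesis by (simp add: k_def)
  next
    case False
    then obtain w where "(\<pi> x, \<pi> y, w) \<in> D'" using edge_D'[OF d] by auto
    then show ?thesis using anti by (auto simp: k_def)
  qed
  have au: "h a u = - h u a" and bu: "h b u = - h u b" using anti nbr_triangles' by blast+
  have "k x y + k y z + k z x = 0" if d: "(x, y, z) \<in> D" for x y z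
  proof (cases "kept x y z")
    case True
    then show ?thesis
      using h[OF D'I[OF d True]] k_kept[OF d True] k_kept[OF rot[OF d] kept_rot[OF True]]
        k_kept[OF rot2[OF d] kept_rot[OF kept_rot[OF True]]] by simp
  next
    case False
    show ?thesis using collapsed[OF d False] distinct_uvab au bu by (auto simp: k_def \<pi>_def)
  qed
  then obtain \<theta> :: "'v \<Rightarrow> real" where th: "\<And>x y z. (x, y, z) \<in> D \<Longrightarrow> of_int (k x y) = \<theta> x - \<theta> y"
    using coh[of k] k_anti by metis
  have "\<theta> u = \<theta> v" using th[OF uva] by (simp add: k_def \<pi>_def)
  then have \<pi>: "\<theta> (\<pi> x) = \<theta> x" for x by (simp add: \<pi>_def)
  have "of_int (h x y) = \<theta> x - \<theta> y" if xyz: "(x, y, z) \<in> D'" for x y z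
  proof -
    obtain x0 y0 z0 where "(x0, y0, z0) \<in> D" "kept x0 y0 z0" "x = \<pi> x0" "y = \<pi> y0" "z = \<pi> z0"
      using D'E[OF xyz] .
    then show ?thesis using th k_kept \<pi> by metis
  qed
  then show ?thesis by blast
qed

lemma sphere_tri_contract: "sphere_tri D'"
proof
  show "finite D'" unfolding D'_def by (rule finite_imageI, rule finite_subset[OF _ fin]) auto
  show "D' \<noteq> {}" using nbr_triangles' by auto
  show "A = D'" if "A \<subseteq> D'" "A \<noteq> {}" "\<And>x y z. (x, y, z) \<in> A \<Longrightarrow> (y, z, x) \<in> A"
    "\<And>x y z w. (x, y, z) \<in> A \<Longrightarrow> (y, x, w) \<in> D' \<Longrightarrow> (y, x, w) \<in> A" for A
    by (rule conn_D') (use that in \<open>unfold closed_def, blast+\<close>)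
  show "\<exists>\<theta>. \<forall>x y z. (x, y, z) \<in> D' \<longrightarrow> real_of_int (h x y) = \<theta> x - \<theta> y"
    if "\<And>x y z. (x, y, z) \<in> D' \<Longrightarrow> h x y + h y z + h z x = 0"
      "\<And>x y z. (x, y, z) \<in> D' \<Longrightarrow> h y x = - h x y" for h
    using that by (rule coh_D')
qed (fact rot_D' dist_D' uniq_D' rev_D')+

lemma card_contract: "card D' < card D"
proof -
  have "card D' \<le> card {(x, y, z) \<in> D. kept x y z}"
    unfolding D'_def by (rule card_image_le, rule finite_subset[OF _ fin]) auto
  also have "{(x, y, z) \<in> D. kept x y z} \<subset> D" using uva by (auto simp: kept_def)
  then have "card {(x, y, z) \<in> D. kept x y z} < card D" using fin by (intro psubset_card_mono)
  finally show ?thesis .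
qed

end

text \<open>Positions are homogeneous coordinates of points of the plane: for a constant third
  coordinate the row condition also says that the plain row sums vanish. Multiplying
  \<open>z x\<close> by a nonzero factor merely rescales the values of \<open>s\<close>, and this
  freedom later turns the positions into a planar drawing. \<open>V\<close> may exceed the set of
  ends of edges, so it can stay fixed during contraction.\<close>

definition stress_free :: "'v set \<Rightarrow> ('v \<Rightarrow> 'v \<Rightarrow> bool) \<Rightarrow> ('v \<Rightarrow> real^3) \<Rightarrow> bool" where
  "stress_free V E z \<longleftrightarrow> (\<forall>s :: 'v \<Rightarrow> 'v \<Rightarrow> real. (\<forall>x y. s y x = - s x y) \<longrightarrow> (\<forall>x y. s x y \<noteq> 0 \<longrightarrow> E x y) \<longrightarrow>
     (\<forall>x\<in>V. (\<Sum>y\<in>V. s x y *\<^sub>R z y) = 0) \<longrightarrow> (\<forall>x y. s x y = 0))"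

text \<open>The determinant with rows \<open>p\<close>, \<open>q\<close>, \<open>r\<close>.\<close>

definition triple :: "real^3 \<Rightarrow> real^3 \<Rightarrow> real^3 \<Rightarrow> real" where
  "triple p q r = p$1 * (q$2 * r$3 - q$3 * r$2) - p$2 * (q$1 * r$3 - q$3 * r$1) + p$3 * (q$1 * r$2 - q$2 * r$1)"

lemma vec3_eq_iff: "(p :: real^3) = q \<longleftrightarrow> p$1 = q$1 \<and> p$2 = q$2 \<and> p$3 = q$3"
  by (simp add: vec_eq_iff forall_3)

lemma triple_independent:
  assumes "triple p q r \<noteq> 0" and z: "\<alpha> *\<^sub>R p + \<beta> *\<^sub>R q + \<gamma> *\<^sub>R r = 0"
  shows "\<alpha> = 0" "\<beta> = 0" "\<gamma> = 0"
proof -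
  have c: "\<alpha> * p$i + \<beta> * q$i + \<gamma> * r$i = 0" for i
    using arg_cong[OF z, of "\<lambda>v. v $ i"] by simp
  have "\<alpha> * triple p q r = 0" "\<beta> * triple p q r = 0" "\<gamma> * triple p q r = 0"
    using c[of 1] c[of 2] c[of 3] unfolding triple_def by algebra+
  then show "\<alpha> = 0" "\<beta> = 0" "\<gamma> = 0" using assms by auto
qed

text \<open>A trivial kernel is an open condition. By duality each value of \<open>s\<close> is a
  fixed combination of the defining equations at \<open>z\<close>. A solution at \<open>z'\<close>
  violates only the row equations among them, by at most a multiple of \<epsilon> times the largest
  value \<open>M\<close> of \<open>s\<close>; for small \<epsilon> this forces
  \<open>M = 0\<close>.\<close>

lemma stress_free_open:
  fixes V :: "'v set"
  assumes V: "finite V" and E: "\<And>x y. E x y \<Longrightarrow> x \<in> V \<and> y \<in> V" and sf: "stress_free V E z"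
  shows "\<exists>\<epsilon>>0. \<forall>z'. (\<forall>v\<in>V. norm (z' v - z v) < \<epsilon>) \<longrightarrow> stress_free V E z'"
proof -
  \<comment> \<open>One index for each equation: the coordinates of the rows, antisymmetry, and
    vanishing off the edges.\<close>
  define I :: "('v \<times> 3 + ('v \<times> 'v) + ('v \<times> 'v)) set" where
    "I = (V \<times> UNIV) <+> ((V \<times> V) <+> (V \<times> V))"
  define f :: "('v \<times> 3 + ('v \<times> 'v) + ('v \<times> 'v)) \<Rightarrow> 'v \<times> 'v \<Rightarrow> real" where
    "f i e = (case i of Inl (x, k) \<Rightarrow> of_bool (fst e = x) * z (snd e) $ k
       | Inr (Inl (x, y)) \<Rightarrow> of_bool (e = (x, y)) + of_bool (e = (y, x))
       | Inr (Inr (x, y)) \<Rightarrow> of_bool (e = (x, y) \<and> \<not> E x y))" for i e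
  have finI: "finite I" using V by (simp add: I_def)
  have sum_row: "(\<Sum>e\<in>V \<times> V. h e * (of_bool (fst e = x) * g (snd e))) = (\<Sum>y\<in>V. h (x, y) * g y)"
    if "x \<in> V" for h :: "'v \<times> 'v \<Rightarrow> real" and g x
  proof -
    have "(\<Sum>e\<in>V \<times> V. h e * (of_bool (fst e = x) * g (snd e))) = (\<Sum>p\<in>V. \<Sum>y\<in>V. h (p, y) * (of_bool (p = x) * g y))"
      by (simp add: sum.cartesian_product split_def)
    also have "\<dots> = (\<Sum>p\<in>V. if p = x then \<Sum>y\<in>V. h (x, y) * g y else 0)"
      by (intro sum.cong) auto
    finally show ?thesis using that V by simp
  qed
  have "\<exists>c. \<forall>e\<in>V \<times> V. of_bool (e = e0) = (\<Sum>i\<in>I. c i * f i e)" if e0: "e0 \<in> V \<times> V" for e0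
  proof (rule span_duality[OF finI])
    show "finite (V \<times> V)" using V by simp
    fix h assume h: "\<And>i. i \<in> I \<Longrightarrow> (\<Sum>e\<in>V \<times> V. h e * f i e) = 0"
    define s where "s x y = (if x \<in> V \<and> y \<in> V then h (x, y) else 0)" for x y
    have "s y x = - s x y" for x y
    proof (cases "x \<in> V \<and> y \<in> V")
      case True
      then have "(\<Sum>e\<in>V \<times> V. h e * f (Inr (Inl (x, y))) e) = 0" by (intro h) (auto simp: I_def)
      then show ?thesis using True V by (simp add: f_def s_def distrib_left sum.distrib)
    qed (auto simp: s_def)
    moreover have "E x y" if "s x y \<noteq> 0" for x y
    proof (rule ccontr)
      assume nE: "\<not> E x y"
      have xy: "x \<in> V" "y \<in> V" using that by (auto simp: s_def split: if_splits)
      then have "(\<Sum>e\<in>V \<times> V. h e * f (Inr (Inr (x, y))) e) = 0" by (intro h) (auto simp: I_def)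
      then show False using xy nE that V by (simp add: f_def s_def)
    qed
    moreover have "(\<Sum>y\<in>V. s x y *\<^sub>R z y) = 0" if x: "x \<in> V" for x
    proof -
      have "(\<Sum>y\<in>V. s x y *\<^sub>R z y) $ k = 0" for k
      proof -
        have "(\<Sum>e\<in>V \<times> V. h e * f (Inl (x, k)) e) = 0" using x by (intro h) (auto simp: I_def)
        then have "(\<Sum>y\<in>V. h (x, y) * z y $ k) = 0"
          using sum_row[OF x, of h "\<lambda>y. z y $ k"] by (simp add: f_def)
        then show ?thesis using x by (simp add: s_def)
      qed
      then show ?thesis by (simp add: vec_eq_iff)
    qed
    ultimately have "\<forall>x y. s x y = 0" using sf unfolding stress_free_def by blast
    then have "h e0 = 0" using e0 by (cases e0) (auto simp: s_def split: if_splits)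
    then show "(\<Sum>e\<in>V \<times> V. h e * of_bool (e = e0)) = 0" using e0 V by simp
  qed
  then have ex: "\<forall>e0\<in>V \<times> V. \<exists>c. \<forall>e\<in>V \<times> V. of_bool (e = e0) = (\<Sum>i\<in>I. c i * f i e)" by blast
  obtain c where c: "\<And>e0 e. e0 \<in> V \<times> V \<Longrightarrow> e \<in> V \<times> V \<Longrightarrow> of_bool (e = e0) = (\<Sum>i\<in>I. c e0 i * f i e)"
    using bchoice[OF ex] by blast
  define C where "C = (\<Sum>e0\<in>V \<times> V. \<Sum>x\<in>V. \<Sum>k\<in>UNIV. \<bar>c e0 (Inl (x, k))\<bar>)"
  have C0: "C \<ge> 0" unfolding C_def by (intro sum_nonneg) auto
  \<comment> \<open>Chosen for \<open>C * card V * \<epsilon> < 1\<close>; the summands 1 keep the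
    denominator positive and the inequality strict even when \<open>C\<close> is 0.\<close>
  define \<epsilon> where "\<epsilon> = 1 / (1 + C * (1 + card V))"
  have \<epsilon>: "\<epsilon> > 0" unfolding \<epsilon>_def using C0 by (intro divide_pos_pos) (auto intro: add_pos_nonneg)
  have "stress_free V E z'" if z': "\<And>v. v \<in> V \<Longrightarrow> norm (z' v - z v) < \<epsilon>" for z'
    unfolding stress_free_def
  proof (intro allI impI)
    fix s :: "'v \<Rightarrow> 'v \<Rightarrow> real" and x0 y0
    assume anti: "\<forall>x y. s y x = - s x y" and sE: "\<forall>x y. s x y \<noteq> 0 \<longrightarrow> E x y"
      and row: "\<forall>x\<in>V. (\<Sum>y\<in>V. s x y *\<^sub>R z' y) = 0"
    define M where "M = Max (insert 0 ((\<lambda>(x, y). \<bar>s x y\<bar>) ` (V \<times> V)))"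
    have M: "\<bar>s x y\<bar> \<le> M" if "x \<in> V" "y \<in> V" for x y
      unfolding M_def using V that by (intro Max_ge) auto
    have M0: "M \<ge> 0" unfolding M_def using V by (intro Max_ge) auto
    have bound: "\<bar>s x y\<bar> \<le> C * (card V * (M * \<epsilon>))" if xy: "x \<in> V" "y \<in> V" for x y
    proof -
      define e0 where "e0 = (x, y)"
      have e0: "e0 \<in> V \<times> V" using xy by (simp add: e0_def)
      let ?s = "\<lambda>e. s (fst e) (snd e)"
      have "s x y = (\<Sum>e\<in>V \<times> V. ?s e * of_bool (e = e0))" using e0 V by (simp add: e0_def)
      also have "\<dots> = (\<Sum>e\<in>V \<times> V. ?s e * (\<Sum>i\<in>I. c e0 i * f i e))"
        using c[OF e0] by (intro sum.cong) auto
      also have "\<dots> = (\<Sum>e\<in>V \<times> V. \<Sum>i\<in>I. c e0 i * (?s e * f i e))"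
        by (simp add: sum_distrib_left mult.left_commute)
      also have "\<dots> = (\<Sum>i\<in>I. c e0 i * (\<Sum>e\<in>V \<times> V. ?s e * f i e))"
        by (subst sum.swap) (simp add: sum_distrib_left)
      also have "\<dots> = (\<Sum>i\<in>Inl ` (V \<times> UNIV). c e0 i * (\<Sum>e\<in>V \<times> V. ?s e * f i e))"
      proof (rule sum.mono_neutral_right[OF finI])
        show "Inl ` (V \<times> UNIV) \<subseteq> I" by (auto simp: I_def)
        show "\<forall>i\<in>I - Inl ` (V \<times> UNIV). c e0 i * (\<Sum>e\<in>V \<times> V. ?s e * f i e) = 0"
        proof
          fix i assume i: "i \<in> I - Inl ` (V \<times> UNIV)"
          consider p q where "i = Inr (Inl (p, q))" "p \<in> V" "q \<in> V" | p q where "i = Inr (Inr (p, q))" "p \<in> V" "q \<in> V"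
            using i by (auto simp: I_def)
          then have "(\<Sum>e\<in>V \<times> V. ?s e * f i e) = 0"
          proof cases
            case 1
            then show ?thesis using V anti[rule_format, of q p] by (simp add: f_def distrib_left sum.distrib)
          next
            case 2
            have "?s e * f i e = 0" for e using 2 sE by (auto simp: f_def)
            then show ?thesis by (intro sum.neutral) blast
          qed
          then show "c e0 i * (\<Sum>e\<in>V \<times> V. ?s e * f i e) = 0" by simp
        qed
      qed
      also have "\<dots> = (\<Sum>(x, k)\<in>V \<times> UNIV. c e0 (Inl (x, k)) * (\<Sum>y\<in>V. s x y * z y $ k))"
      proof (subst sum.reindex, simp, rule sum.cong)
        fix xk assume "xk \<in> V \<times> (UNIV :: 3 set)"
        then obtain x k where xk: "xk = (x, k)" "x \<in> V" by auto
        show "((\<lambda>i. c e0 i * (\<Sum>e\<in>V \<times> V. ?s e * f i e)) \<circ> Inl) xk =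
          (case xk of (x, k) \<Rightarrow> c e0 (Inl (x, k)) * (\<Sum>y\<in>V. s x y * z y $ k))"
          using sum_row[OF xk(2), of ?s "\<lambda>y. z y $ k"] by (simp add: f_def xk(1))
      qed simp
      also have "\<dots> = (\<Sum>(x, k)\<in>V \<times> UNIV. c e0 (Inl (x, k)) * (\<Sum>y\<in>V. s x y * (z y - z' y) $ k))"
      proof (rule sum.cong)
        fix xk assume "xk \<in> V \<times> (UNIV :: 3 set)"
        then obtain x k where xk: "xk = (x, k)" "x \<in> V" by auto
        have "(\<Sum>y\<in>V. s x y * z' y $ k) = 0"
          using arg_cong[OF row[rule_format, OF xk(2)], of "\<lambda>v. v $ k"] by simp
        then show "(case xk of (x, k) \<Rightarrow> c e0 (Inl (x, k)) * (\<Sum>y\<in>V. s x y * z y $ k)) =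
          (case xk of (x, k) \<Rightarrow> c e0 (Inl (x, k)) * (\<Sum>y\<in>V. s x y * (z y - z' y) $ k))"
          by (simp add: xk algebra_simps sum_subtractf)
      qed simp
      finally have "\<bar>s x y\<bar> = \<bar>\<Sum>(x, k)\<in>V \<times> UNIV. c e0 (Inl (x, k)) * (\<Sum>y\<in>V. s x y * (z y - z' y) $ k)\<bar>" by simp
      also have "\<dots> \<le> (\<Sum>(x, k)\<in>V \<times> UNIV. \<bar>c e0 (Inl (x, k))\<bar> * (card V * (M * \<epsilon>)))"
      proof (rule order.trans[OF sum_abs sum_mono])
        fix xk assume "xk \<in> V \<times> (UNIV :: 3 set)"
        then obtain x k where xk: "xk = (x, k)" "x \<in> V" by auto
        have "\<bar>\<Sum>y\<in>V. s x y * (z y - z' y) $ k\<bar> \<le> (\<Sum>y\<in>V. M * \<epsilon>)"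
        proof (rule order.trans[OF sum_abs sum_mono])
          fix y assume y: "y \<in> V"
          have "\<bar>(z y - z' y) $ k\<bar> \<le> \<epsilon>"
            using component_le_norm_cart[of "z y - z' y" k] z'[OF y] by (simp add: norm_minus_commute)
          then show "\<bar>s x y * (z y - z' y) $ k\<bar> \<le> M * \<epsilon>"
            unfolding abs_mult using M[OF xk(2) y] M0 by (intro mult_mono) auto
        qed
        then show "\<bar>case xk of (x, k) \<Rightarrow> c e0 (Inl (x, k)) * (\<Sum>y\<in>V. s x y * (z y - z' y) $ k)\<bar>
           \<le> (case xk of (x, k) \<Rightarrow> \<bar>c e0 (Inl (x, k))\<bar> * (card V * (M * \<epsilon>)))"
          by (simp add: xk abs_mult mult_left_mono)
      qed
      also have "\<dots> = (\<Sum>x\<in>V. \<Sum>k\<in>UNIV. \<bar>c e0 (Inl (x, k))\<bar>) * (card V * (M * \<epsilon>))"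
        by (simp only: sum.cartesian_product sum_distrib_right split_def)
      also have "\<dots> \<le> C * (card V * (M * \<epsilon>))"
      proof (rule mult_right_mono)
        show "(\<Sum>x\<in>V. \<Sum>k\<in>UNIV. \<bar>c e0 (Inl (x, k))\<bar>) \<le> C"
          unfolding C_def using V e0 by (intro member_le_sum) (auto intro: sum_nonneg)
        show "0 \<le> real (card V) * (M * \<epsilon>)" using M0 \<epsilon> by simp
      qed
      finally show ?thesis .
    qed
    have "M \<le> C * (card V * (M * \<epsilon>))"
      unfolding M_def[symmetric]
    proof -
      have "M \<in> insert 0 ((\<lambda>(x, y). \<bar>s x y\<bar>) ` (V \<times> V))" unfolding M_def using V by (intro Max_in) auto
      then show ?thesis using bound M0 \<epsilon> C0 by (auto intro!: mult_nonneg_nonneg)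
    qed
    also have "\<dots> = M * (C * card V * \<epsilon>)" by simp
    finally have le: "M \<le> M * (C * card V * \<epsilon>)" .
    have "C * card V * \<epsilon> < 1"
    proof -
      have "C * card V < 1 + C * (1 + card V)" using C0 by (simp add: algebra_simps)
      moreover have "0 < 1 + C * (1 + card V)" using C0 by (auto intro: add_pos_nonneg)
      ultimately show ?thesis by (simp add: \<epsilon>_def divide_less_eq)
    qed
    then have "M = 0" using le M0 by (metis mult.right_neutral mult_le_cancel_left_pos not_le order_le_less)
    show "s x0 y0 = 0"
    proof (rule ccontr)
      assume n: "s x0 y0 \<noteq> 0"
      then have "x0 \<in> V" "y0 \<in> V" using sE E by blast+
      then show False using M \<open>M = 0\<close> n by fastforce
    qed
  qed
  then show ?thesis using \<epsilon> by blast
qed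

text \<open>Vertices are shifted along distinct points of the moment curve. Each determinant becomes
  a cubic polynomial in the size \<open>t\<close> of the shift with a Vandermonde determinant as
  leading coefficient, so only finitely many \<open>t\<close> are bad.\<close>

lemma stress_free_generic:
  fixes V :: "'v set"
  assumes V: "finite V" and E: "\<And>x y. E x y \<Longrightarrow> x \<in> V \<and> y \<in> V" and sf: "stress_free V E z"
  obtains z' where "stress_free V E z'"
    "\<And>a b c. a \<in> V \<Longrightarrow> b \<in> V \<Longrightarrow> c \<in> V \<Longrightarrow> distinct [a, b, c] \<Longrightarrow> triple (z' a) (z' b) (z' c) \<noteq> 0"
proof -
  obtain \<epsilon> where \<epsilon>: "\<epsilon> > 0" "\<And>z'. (\<And>v. v \<in> V \<Longrightarrow> norm (z' v - z v) < \<epsilon>) \<Longrightarrow> stress_free V E z'"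
    using stress_free_open[OF assms] by metis
  obtain h :: "'v \<Rightarrow> nat" where h: "inj_on h V" using V finite_imp_inj_to_nat_seg by metis
  define m :: "'v \<Rightarrow> real^3" where "m v = vector [1, real (h v), (real (h v))\<^sup>2]" for v
  define N where "N = 1 + (\<Sum>v\<in>V. norm (m v))"
  have mN: "norm (m v) < N" if "v \<in> V" for v
    using member_le_sum[OF that, of "\<lambda>v. norm (m v)"] V by (simp add: N_def)
  have N0: "N > 0" unfolding N_def by (intro add_pos_nonneg sum_nonneg) auto
  have tm: "triple (m a) (m b) (m c) \<noteq> 0" if "a \<in> V" "b \<in> V" "c \<in> V" "distinct [a, b, c]" for a b c
  proof -
    have "triple (m a) (m b) (m c) = (real (h b) - real (h a)) * (real (h c) - real (h a)) * (real (h c) - real (h b))"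
      by (simp add: triple_def m_def power2_eq_square algebra_simps)
    then show ?thesis using inj_onD[OF h] that by auto
  qed
  define bad where "bad = (\<lambda>(a, b, c). {t. triple (z a + t *\<^sub>R m a) (z b + t *\<^sub>R m b) (z c + t *\<^sub>R m c) = 0})"
  define T where "T = {(a, b, c). a \<in> V \<and> b \<in> V \<and> c \<in> V \<and> distinct [a, b, c]}"
  have "finite (V \<times> V \<times> V)" using V by simp
  then have finT: "finite T" by (rule rev_finite_subset) (auto simp: T_def)
  have "finite (bad t)" if tT: "t \<in> T" for t
  proof -
    obtain a b c where t: "t = (a, b, c)" "a \<in> V" "b \<in> V" "c \<in> V" "distinct [a, b, c]" using tT by (auto simp: T_def)
    define p where "p = [: triple (z a) (z b) (z c),
      triple (m a) (z b) (z c) + triple (z a) (m b) (z c) + triple (z a) (z b) (m c),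
      triple (m a) (m b) (z c) + triple (m a) (z b) (m c) + triple (z a) (m b) (m c),
      triple (m a) (m b) (m c) :]"
    have "p \<noteq> 0" using tm t by (auto simp: p_def)
    moreover have "triple (z a + t *\<^sub>R m a) (z b + t *\<^sub>R m b) (z c + t *\<^sub>R m c) = poly p t" for t
      by (simp add: p_def triple_def algebra_simps)
    ultimately show ?thesis using poly_roots_finite[of p] by (simp add: bad_def t)
  qed
  then have "finite (\<Union>t\<in>T. bad t)" using finT by blast
  moreover have "infinite {0<..<\<epsilon> / N}" using \<epsilon>(1) N0 by (simp add: infinite_Ioo)
  ultimately obtain t where t: "t \<in> {0<..<\<epsilon> / N}" "t \<notin> (\<Union>t\<in>T. bad t)"
    by (meson finite_subset subsetI)
  define z' where "z' v = z v + t *\<^sub>R m v" for v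
  have "stress_free V E z'"
  proof (rule \<epsilon>(2))
    fix v assume v: "v \<in> V"
    have "t * norm (m v) < \<epsilon>"
    proof -
      have "t * norm (m v) \<le> t * N" using t(1) mN[OF v] by (intro mult_left_mono) auto
      also have "\<dots> < \<epsilon>" using t(1) N0 by (simp add: pos_less_divide_eq)
      finally show ?thesis .
    qed
    then show "norm (z' v - z v) < \<epsilon>" using t(1) by (simp add: z'_def)
  qed
  moreover have "triple (z' a) (z' b) (z' c) \<noteq> 0" if "a \<in> V" "b \<in> V" "c \<in> V" "distinct [a, b, c]" for a b c
    using t(2) that by (auto simp: T_def bad_def z'_def)
  ultimately show thesis using that by blast
qed

context contraction begin

text \<open>The vertex \<open>v\<close> is split off on top of \<open>u\<close>. Adding the rows and
  columns of \<open>u\<close> and \<open>v\<close> turns a stress into one of the contracted sphere,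
  which vanishes. So the values at \<open>u\<close> and \<open>v\<close> are opposite, apart from
  \<open>u v\<close> they live on the common neighbours \<open>a\<close> and \<open>b\<close>, and
  row \<open>u\<close> is a relation between the independent vectors \<open>z u\<close>,
  \<open>z a\<close>, \<open>z b\<close>.\<close>

lemma stress_free_lift:
  assumes V: "finite V" "verts \<subseteq> V" and sf: "stress_free V (sphere_tri.adj D') z"
    and gen: "triple (z u) (z a) (z b) \<noteq> 0"
  shows "stress_free V adj (z(v := z u))"
  unfolding stress_free_def
proof (intro allI impI)
  interpret D': sphere_tri D' by (rule sphere_tri_contract)
  define Z where "Z = z(v := z u)"
  fix s :: "'v \<Rightarrow> 'v \<Rightarrow> real" and x0 y0
  assume anti: "\<forall>x y. s y x = - s x y" and sE: "\<forall>x y. s x y \<noteq> 0 \<longrightarrow> adj x y"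
    and row0: "\<forall>x\<in>V. (\<Sum>y\<in>V. s x y *\<^sub>R (z(v := z u)) y) = 0"
  have row: "\<And>x. x \<in> V \<Longrightarrow> (\<Sum>y\<in>V. s x y *\<^sub>R Z y) = 0" unfolding Z_def by (rule bspec[OF row0])
  have s0: "s x x = 0" for x using anti[rule_format, of x x] by simp
  have uV: "u \<in> V" "v \<in> V" "a \<in> V" "b \<in> V" using V(2) uva vub adj_tri adj_verts by blast+
  define W where "W = V - {u, v}"
  have W: "V = insert u (insert v W)" "u \<notin> W" "v \<notin> W" "finite W" using uV V by (auto simp: W_def)
  have rowW: "(\<Sum>y\<in>W. s x y *\<^sub>R z y) + (s x u + s x v) *\<^sub>R z u = 0" if "x \<in> V" for x
  proof -
    have "(\<Sum>y\<in>V. s x y *\<^sub>R Z y) = s x u *\<^sub>R Z u + (s x v *\<^sub>R Z v + (\<Sum>y\<in>W. s x y *\<^sub>R Z y))"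
      unfolding W(1) using W distinct_uvab by simp
    also have "(\<Sum>y\<in>W. s x y *\<^sub>R Z y) = (\<Sum>y\<in>W. s x y *\<^sub>R z y)"
      using W by (intro sum.cong) (auto simp: Z_def)
    finally show ?thesis using row[OF that] by (simp add: Z_def algebra_simps)
  qed
  define s' where "s' x y = (if x = v \<or> y = v \<or> x = y then 0 else if x = u then s u y + s v y
    else if y = u then s x u + s x v else s x y)" for x y
  have "\<forall>x y. s' x y = 0"
  proof (rule sf[unfolded stress_free_def, THEN spec, THEN mp, THEN mp, THEN mp]; (intro allI ballI impI)?)
    fix x y
    show "s' y x = - s' x y"
      using anti[rule_format, of x y] anti[rule_format, of x u] anti[rule_format, of x v]
        anti[rule_format, of y u] anti[rule_format, of y v] s0 by (auto simp: s'_def)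
    have edge: "D'.adj (\<pi> x) (\<pi> y)" if sxy: "s x y \<noteq> 0" and nuv: "{x, y} \<noteq> {u, v}" for x y
    proof -
      have "adj x y" using sE sxy by blast
      then obtain w where "(x, y, w) \<in> D" by (auto simp: adj_def)
      then show ?thesis using edge_D' nuv by (auto simp: D'.adj_def)
    qed
    show "D'.adj x y" if n: "s' x y \<noteq> 0"
    proof -
      have nv: "x \<noteq> v" "y \<noteq> v" "x \<noteq> y" using n by (auto simp: s'_def)
      then consider "x = u" "s u y \<noteq> 0 \<or> s v y \<noteq> 0" | "x \<noteq> u" "y = u" "s x u \<noteq> 0 \<or> s x v \<noteq> 0" | "x \<noteq> u" "y \<noteq> u" "s x y \<noteq> 0"
        using n by (auto simp: s'_def split: if_splits)
      then show ?thesis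
      proof cases
        case 1
        then show ?thesis using edge[of u y] edge[of v y] nv by (auto simp: \<pi>_def doubleton_eq_iff)
      next
        case 2
        then show ?thesis using edge[of x u] edge[of x v] nv by (auto simp: \<pi>_def doubleton_eq_iff)
      next
        case 3
        then show ?thesis using edge[of x y] nv by (auto simp: \<pi>_def doubleton_eq_iff)
      qed
    qed
    show "(\<Sum>y\<in>V. s' x y *\<^sub>R z y) = 0" if x: "x \<in> V"
    proof -
      have split: "(\<Sum>y\<in>V. s' x y *\<^sub>R z y) = s' x u *\<^sub>R z u + (\<Sum>y\<in>W. s' x y *\<^sub>R z y)"
        unfolding W(1) using W distinct_uvab by (simp add: s'_def)
      consider "x = v" | "x = u" | "x \<in> W" using x W by auto
      then show ?thesis
      proof cases
        case 1
        then show ?thesis by (simp add: s'_def)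
      next
        case 2
        have "(\<Sum>y\<in>W. s' u y *\<^sub>R z y) = (\<Sum>y\<in>W. (s u y + s v y) *\<^sub>R z y)"
          using W distinct_uvab by (intro sum.cong) (auto simp: s'_def)
        also have "\<dots> = (\<Sum>y\<in>W. s u y *\<^sub>R z y) + (\<Sum>y\<in>W. s v y *\<^sub>R z y)"
          by (simp add: scaleR_left_distrib sum.distrib)
        also have "\<dots> = - ((s u u + s u v) *\<^sub>R z u) - ((s v u + s v v) *\<^sub>R z u)"
          using rowW[OF uV(1)] rowW[OF uV(2)] by (simp add: algebra_simps eq_neg_iff_add_eq_0)
        also have "\<dots> = 0" using s0 anti[rule_format, of u v] by (simp add: algebra_simps)
        finally show ?thesis using 2 split by (simp add: s'_def)
      next
        case 3
        then have nx: "x \<noteq> u" "x \<noteq> v" using W by auto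
        have "(\<Sum>y\<in>W. s' x y *\<^sub>R z y) = (\<Sum>y\<in>W. s x y *\<^sub>R z y)"
          using W nx s0 by (intro sum.cong) (auto simp: s'_def)
        then show ?thesis using split rowW[OF x] nx distinct_uvab by (simp add: s'_def add.commute)
      qed
    qed
  qed
  then have s': "s' x y = 0" for x y by blast
  have in0: "s x y = 0" if "x \<notin> {u, v}" "y \<notin> {u, v}" for x y
    using s'[of x y] that s0 by (auto simp: s'_def split: if_splits)
  have opp: "s v y = - s u y" if "y \<notin> {u, v}" for y
    using s'[of u y] that distinct_uvab by (auto simp: s'_def split: if_splits)
  have far: "s u y = 0" if "y \<notin> {u, v, a, b}" for y
  proof (rule ccontr)
    assume n: "s u y \<noteq> 0"
    then have "s v y \<noteq> 0" using opp[of y] that by auto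
    then show False using common sE n that by blast
  qed
  have ab0: "s u a = 0 \<and> s u b = 0 \<and> s u v = 0"
  proof -
    have abW: "{a, b} \<subseteq> W" using uV distinct_uvab by (auto simp: W_def)
    have "(\<Sum>y\<in>W. s u y *\<^sub>R z y) = (\<Sum>y\<in>{a, b}. s u y *\<^sub>R z y)"
    proof (rule sum.mono_neutral_right[OF W(4) abW], rule ballI)
      fix y assume "y \<in> W - {a, b}"
      then have "y \<notin> {u, v, a, b}" using W by auto
      then show "s u y *\<^sub>R z y = 0" using far[of y] by simp
    qed
    then have "(s u v) *\<^sub>R z u + s u a *\<^sub>R z a + s u b *\<^sub>R z b = 0"
      using rowW[OF uV(1)] distinct_uvab s0 by (simp add: algebra_simps)
    then show ?thesis using triple_independent[OF gen] by blast
  qed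
  have u0: "s u y = 0" for y using ab0 far[of y] s0 by auto
  have v0: "s v y = 0" for y
    using opp[of y] u0 s0 anti[rule_format, of u v] by (cases "y \<in> {u, v}") auto
  have "s x0 u = 0" "s x0 v = 0" using u0[of x0] v0[of x0] anti[rule_format, of u x0] anti[rule_format, of v x0] by auto
  then show "s x0 y0 = 0"
    using in0[of x0 y0] u0[of y0] v0[of y0] by (cases "x0 \<in> {u, v}"; cases "y0 \<in> {u, v}") auto
qed

end

text \<open>Two opposite faces exhaust the sphere; its three vertices go on the coordinate
  axes.\<close>

lemma (in sphere_tri) stress_free_two_triangles:
  assumes t: "(p, q, r) \<in> D" "(q, p, r) \<in> D" and V: "finite V" "verts \<subseteq> V"
  shows "\<exists>z. stress_free V adj z"
proof -
  define A where "A = {(p, q, r), (q, r, p), (r, p, q), (q, p, r), (p, r, q), (r, q, p)}"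
  have AD: "A \<subseteq> D" 
    using t rot[OF t(1)] rot2[OF t(1)] rot[OF t(2)] rot2[OF t(2)] by (auto simp: A_def)
  have "A = D"
  proof (rule conn[OF AD])
    show "(y, x, w) \<in> A" if "(x, y, z) \<in> A" "(y, x, w) \<in> D" for x y z w
    proof -
      have "\<exists>w'. (y, x, w') \<in> A" using that(1) by (auto simp: A_def)
      then show ?thesis using AD that(2) uniq by blast
    qed
  qed (auto simp: A_def)
  have d: "p \<noteq> q" "q \<noteq> r" "p \<noteq> r" using dist3[OF t(1)] by auto
  have pqr: "p \<in> V" "q \<in> V" "r \<in> V" using adj_tri[OF t(1)] adj_verts V(2) by blast+
  have adj_iff: "adj x y \<longleftrightarrow> x \<in> {p, q, r} \<and> y \<in> {p, q, r} \<and> x \<noteq> y" for x y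
  proof -
    have "adj x y \<longleftrightarrow> (\<exists>z. (x, y, z) \<in> A)" by (simp add: adj_def \<open>A = D\<close>)
    then show ?thesis using d by (auto simp: A_def)
  qed
  define z :: "'v \<Rightarrow> real^3" where "z x = (if x = p then axis 1 1 else if x = q then axis 2 1 else axis 3 1)" for x
  have z: "triple (z p) (z q) (z r) \<noteq> 0" using d by (simp add: z_def triple_def axis_def)
  have "stress_free V adj z"
    unfolding stress_free_def
  proof (intro allI impI)
    fix s :: "'v \<Rightarrow> 'v \<Rightarrow> real" and x0 y0
    assume anti: "\<forall>x y. s y x = - s x y" and sE: "\<forall>x y. s x y \<noteq> 0 \<longrightarrow> adj x y"
      and row: "\<forall>x\<in>V. (\<Sum>y\<in>V. s x y *\<^sub>R z y) = 0"
    have "s x p = 0 \<and> s x q = 0 \<and> s x r = 0" if "x \<in> V" for x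
    proof -
      have "(\<Sum>y\<in>V. s x y *\<^sub>R z y) = (\<Sum>y\<in>{p, q, r}. s x y *\<^sub>R z y)"
        by (rule sum.mono_neutral_right) (use V pqr sE adj_iff in auto)
      then have "s x p *\<^sub>R z p + s x q *\<^sub>R z q + s x r *\<^sub>R z r = 0"
        using row that d by (simp add: algebra_simps)
      then show ?thesis using triple_independent[OF z] by blast
    qed
    then show "s x0 y0 = 0" using sE[rule_format, of x0 y0] adj_iff[of x0 y0] pqr by auto
  qed
  then show ?thesis by blast
qed

text \<open>Induction on the number of faces. The perturbation between two steps supplies the
  independence of the three positions that splitting requires.\<close>

theorem stress_free_exists:
  assumes "sphere_tri D" "finite V" "fst ` D \<subseteq> V"
  shows "\<exists>z. stress_free V (sphere_tri.adj D) z"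
  using assms
proof (induction "card D" arbitrary: D rule: less_induct)
  case less
  interpret sphere_tri D by (rule less.prems)
  have V: "verts \<subseteq> V" using less.prems(3) by (simp add: verts_def)
  show ?case
  proof (cases "\<exists>p q r. (p, q, r) \<in> D \<and> (q, p, r) \<in> D")
    case True
    then show ?thesis using stress_free_two_triangles less.prems(2) V by blast
  next
    case False
    obtain u v a b where uv: "(u, v, a) \<in> D" "(v, u, b) \<in> D" "\<And>w. adj u w \<Longrightarrow> adj v w \<Longrightarrow> w = a \<or> w = b"
      using contractible_edge_exists by blast
    interpret contraction D u v a b by unfold_locales (use uv False in auto)
    interpret D': sphere_tri D' by (rule sphere_tri_contract)
    have V': "fst ` D' \<subseteq> V"
    proof
      fix x assume "x \<in> fst ` D'"
      then obtain y z where "(x, y, z) \<in> D'" by auto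
      then obtain x0 y0 z0 where "(x0, y0, z0) \<in> D" "x = \<pi> x0" by (rule D'E)
      then have "x0 \<in> verts" "u \<in> verts" using uva by (force simp: verts_def)+
      then show "x \<in> V" using V \<open>x = \<pi> x0\<close> by (auto simp: \<pi>_def)
    qed
    obtain z where "stress_free V D'.adj z"
      using less.hyps[OF card_contract sphere_tri_contract less.prems(2) V'] by blast
    moreover have "x \<in> V \<and> y \<in> V" if "D'.adj x y" for x y
      using D'.adj_verts[OF that] V' by (auto simp: D'.verts_def)
    ultimately obtain z' where z': "stress_free V D'.adj z'"
      "\<And>a b c. a \<in> V \<Longrightarrow> b \<in> V \<Longrightarrow> c \<in> V \<Longrightarrow> distinct [a, b, c] \<Longrightarrow> triple (z' a) (z' b) (z' c) \<noteq> 0"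
      using stress_free_generic[OF less.prems(2)] by metis
    have "u \<in> V" "a \<in> V" "b \<in> V" using V uva vub adj_tri adj_verts by blast+
    then have "triple (z' u) (z' a) (z' b) \<noteq> 0" using z'(2) distinct_uvab by simp
    then show ?thesis using stress_free_lift[OF less.prems(2) V z'(1)] by blast
  qed
qed

section \<open>Integer polynomials as functions\<close>

text \<open>The target ring is arbitrary, since both real values and univariate polynomials
  (\<open>upoly\<close>) are needed. The product runs over all variables, not only those occurring
  in \<open>m\<close>, which makes it multiplicative in the exponent vector.\<close>

definition ev :: "('n::finite \<Rightarrow> 'b::comm_ring_1) \<Rightarrow> 'n int_mpoly \<Rightarrow> 'b" where
  "ev \<phi> F = (\<Sum>m\<in>Poly_Mapping.keys F. of_int (Poly_Mapping.lookup F m) * (\<Prod>i\<in>UNIV. \<phi> i ^ Poly_Mapping.lookup m i))"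

lemma mpoly_eval_ev: "mpoly_eval F a = ev a F"
  unfolding mpoly_eval_def ev_def
  by (intro sum.cong refl arg_cong2[where f = "(*)"] prod.mono_neutral_left) (auto simp: in_keys_iff)

lemma ev_superset:
  assumes "finite S" "Poly_Mapping.keys F \<subseteq> S"
  shows "ev \<phi> F = (\<Sum>m\<in>S. of_int (Poly_Mapping.lookup F m) * (\<Prod>i\<in>UNIV. \<phi> i ^ Poly_Mapping.lookup m i))"
  unfolding ev_def by (rule sum.mono_neutral_left) (use assms in \<open>auto simp: in_keys_iff\<close>)

lemma ev_add: "ev \<phi> (F + G) = ev \<phi> F + ev \<phi> G"
proof -
  let ?S = "Poly_Mapping.keys F \<union> Poly_Mapping.keys G"
  have "Poly_Mapping.keys (F + G) \<subseteq> ?S" by (rule Poly_Mapping.keys_add)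
  then show ?thesis
    by (simp add: ev_superset[of ?S] lookup_add distrib_right sum.distrib)
qed

lemma ev_0 [simp]: "ev \<phi> 0 = 0"
  by (simp add: ev_def)

lemma ev_uminus: "ev \<phi> (- F) = - ev \<phi> F"
  using ev_add[of \<phi> F "- F"] by (simp add: eq_neg_iff_add_eq_0 add.commute)

lemma ev_diff: "ev \<phi> (F - G) = ev \<phi> F - ev \<phi> G"
  using ev_add[of \<phi> F "- G"] by (simp add: ev_uminus)

lemma ev_sum: "ev \<phi> (sum f A) = (\<Sum>x\<in>A. ev \<phi> (f x))"
  by (induction A rule: infinite_finite_induct) (auto simp: ev_add)

lemma ev_single: "ev \<phi> (Poly_Mapping.single m c) = of_int c * (\<Prod>i\<in>UNIV. \<phi> i ^ Poly_Mapping.lookup m i)"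
  by (cases "c = 0") (auto simp: ev_def)

lemma ev_1 [simp]: "ev \<phi> 1 = 1"
  by (simp add: ev_single flip: single_one)

lemma mpoly_monomials: "(F :: 'n int_mpoly) = (\<Sum>m\<in>Poly_Mapping.keys F. Poly_Mapping.single m (Poly_Mapping.lookup F m))"
  by (rule poly_mapping_eqI) (simp add: lookup_sum lookup_single when_def in_keys_iff)

lemma ev_mult:
  fixes \<phi> :: "'n::finite \<Rightarrow> 'b::comm_ring_1"
  shows "ev \<phi> (F * G) = ev \<phi> F * ev \<phi> G"
proof -
  have 1: "ev \<phi> (Poly_Mapping.single m c * Poly_Mapping.single n d) = ev \<phi> (Poly_Mapping.single m c) * ev \<phi> (Poly_Mapping.single n d)"
    for m n :: "'n \<Rightarrow>\<^sub>0 nat" and c d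
    by (simp add: mult_single ev_single lookup_add power_add prod.distrib)
  have "ev \<phi> ((\<Sum>m\<in>A. Poly_Mapping.single m (f m)) * (\<Sum>n\<in>B. Poly_Mapping.single n (g n))) =
      ev \<phi> (\<Sum>m\<in>A. Poly_Mapping.single m (f m)) * ev \<phi> (\<Sum>n\<in>B. Poly_Mapping.single n (g n))" for A B :: "('n \<Rightarrow>\<^sub>0 nat) set" and f g
    by (simp add: sum_product ev_sum 1)
  from this[where A = "Poly_Mapping.keys F" and B = "Poly_Mapping.keys G"
      and f = "Poly_Mapping.lookup F" and g = "Poly_Mapping.lookup G"]
  show ?thesis by (simp only: mpoly_monomials[symmetric])
qed

lemma ev_power: "ev \<phi> (F ^ n) = ev \<phi> F ^ n"
  by (induction n) (auto simp: ev_mult)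

definition mvar :: "'n \<Rightarrow> 'n int_mpoly" where
  "mvar i = Poly_Mapping.single (Poly_Mapping.single i 1) 1"

lemma mvar_power: "mvar i ^ k = Poly_Mapping.single (Poly_Mapping.single i k) 1"
proof (induction k)
  case (Suc k)
  then show ?case by (simp add: mvar_def mult_single flip: single_add)
qed (simp add: single_one)

lemma ev_mvar [simp]: "ev \<phi> (mvar i) = \<phi> i"
proof -
  have "(\<Prod>j\<in>UNIV. \<phi> j ^ Poly_Mapping.lookup (Poly_Mapping.single i 1) j) = (\<Prod>j\<in>UNIV. if j = i then \<phi> i else 1)"
    by (intro prod.cong) (auto simp: lookup_single)
  then show ?thesis by (simp add: mvar_def ev_single)
qed

lemma ev_hom:
  fixes \<phi> :: "'n::finite \<Rightarrow> 'b::comm_ring_1" and g :: "'b \<Rightarrow> 'c::comm_ring_1"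
  assumes add: "\<And>x y. g (x + y) = g x + g y" and mult: "\<And>x y. g (x * y) = g x * g y" and one: "g 1 = 1"
  shows "g (ev \<phi> F) = ev (\<lambda>i. g (\<phi> i)) F"
proof -
  have 0: "g 0 = 0" using add[of 0 0] by simp
  have uminus: "g (- x) = - g x" for x using add[of x "- x"] 0 by (simp add: eq_neg_iff_add_eq_0 add.commute)
  have nat: "g (of_nat n) = of_nat n" for n by (induction n) (auto simp: 0 one add)
  have int: "g (of_int n) = of_int n" for n
    by (cases n rule: int_cases2) (auto simp: nat uminus)
  have pow: "g (x ^ n) = g x ^ n" for x n by (induction n) (auto simp: one mult)
  have prod: "g (prod f A) = (\<Prod>x\<in>A. g (f x))" for f :: "'n \<Rightarrow> 'b" and A
    by (induction A rule: infinite_finite_induct) (auto simp: one mult)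
  have sum: "g (sum f A) = (\<Sum>x\<in>A. g (f x))" for f :: "('n \<Rightarrow>\<^sub>0 nat) \<Rightarrow> 'b" and A
    by (induction A rule: infinite_finite_induct) (auto simp: 0 add)
  show ?thesis unfolding ev_def by (simp add: sum mult int prod pow)
qed

lemma ev_in_subring:
  assumes "subring_set B" "\<And>i. \<phi> i \<in> B" shows "ev \<phi> F \<in> B"
  unfolding ev_def using assms
  by (intro subring_sum subring_mult subring_prod subring_power subring_of_int) auto

definition varsin :: "'n set \<Rightarrow> 'n int_mpoly \<Rightarrow> bool" where
  "varsin J F \<longleftrightarrow> (\<forall>m\<in>Poly_Mapping.keys F. Poly_Mapping.keys m \<subseteq> J)"

lemma varsin_mono: "varsin J F \<Longrightarrow> J \<subseteq> K \<Longrightarrow> varsin K F"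
  by (auto simp: varsin_def)

lemma varsin_add: "varsin J F \<Longrightarrow> varsin J G \<Longrightarrow> varsin J (F + G)"
  using Poly_Mapping.keys_add[of F G] by (auto simp: varsin_def)

lemma varsin_diff: "varsin J F \<Longrightarrow> varsin J G \<Longrightarrow> varsin J (F - G)"
  using keys_diff[of F G] by (auto simp: varsin_def)

lemma varsin_mult: "varsin J F \<Longrightarrow> varsin J G \<Longrightarrow> varsin J (F * G)"
  unfolding varsin_def
proof
  fix m assume F: "\<forall>m\<in>Poly_Mapping.keys F. Poly_Mapping.keys m \<subseteq> J" and G: "\<forall>m\<in>Poly_Mapping.keys G. Poly_Mapping.keys m \<subseteq> J"
    and "m \<in> Poly_Mapping.keys (F * G)"
  then obtain x y where xy: "m = x + y" "x \<in> Poly_Mapping.keys F" "y \<in> Poly_Mapping.keys G"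
    using keys_mult[of F G] by blast
  have "Poly_Mapping.keys x \<subseteq> J" "Poly_Mapping.keys y \<subseteq> J" using F G xy(2,3) by blast+
  then show "Poly_Mapping.keys m \<subseteq> J" using Poly_Mapping.keys_add[of x y] unfolding xy(1) by blast
qed

lemma varsin_0 [simp]: "varsin J 0" and varsin_1 [simp]: "varsin J 1"
  by (auto simp: varsin_def)

lemma varsin_sum: "(\<And>x. x \<in> A \<Longrightarrow> varsin J (f x)) \<Longrightarrow> varsin J (sum f A)"
  by (induction A rule: infinite_finite_induct) (auto intro: varsin_add)

lemma varsin_mvar: "i \<in> J \<Longrightarrow> varsin J (mvar i)"
  by (auto simp: varsin_def mvar_def)

lemma varsin_UNIV: "varsin UNIV F"
  by (auto simp: varsin_def)

lemma ev_cong: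
  assumes "varsin J F" "\<And>i. i \<in> J \<Longrightarrow> \<phi> i = \<psi> i" shows "ev \<phi> F = ev \<psi> F"
proof -
  have "\<phi> i ^ Poly_Mapping.lookup m i = \<psi> i ^ Poly_Mapping.lookup m i" if "m \<in> Poly_Mapping.keys F" for i m
  proof (cases "i \<in> Poly_Mapping.keys m")
    case True
    then have "i \<in> J" using assms(1) that unfolding varsin_def by blast
    then show ?thesis using assms(2) by simp
  qed (simp add: in_keys_iff)
  then show ?thesis unfolding ev_def by (intro sum.cong refl arg_cong2[where f = "(*)"] prod.cong) auto
qed

definition gen_ring :: "('n::finite \<Rightarrow> 'b::comm_ring_1) \<Rightarrow> 'n set \<Rightarrow> 'b set" where
  "gen_ring a J = ev a ` {F. varsin J F}"

lemma subring_gen_ring: "subring_set (gen_ring a J)"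
  unfolding subring_set_def gen_ring_def
  by (auto simp flip: ev_diff ev_mult intro: varsin_diff varsin_mult intro!: imageI image_eqI[where x = 1])

lemma gen_ring_cong: "(\<And>i. i \<in> J \<Longrightarrow> a i = b i) \<Longrightarrow> gen_ring a J = gen_ring b J"
  unfolding gen_ring_def using ev_cong[of J _ a b] by (intro image_cong) auto

lemma gen_ring_mem: "i \<in> J \<Longrightarrow> a i \<in> gen_ring a J"
  unfolding gen_ring_def by (rule image_eqI[where x = "mvar i"]) (auto intro: varsin_mvar)

text \<open>The coefficient of the \<open>k\<close>-th power of variable \<open>j\<close>. The
  truncated subtraction of exponents is exact, as the chosen monomials have exponent
  \<open>k\<close> at \<open>j\<close>.\<close>

definition slice :: "'n \<Rightarrow> nat \<Rightarrow> 'n int_mpoly \<Rightarrow> 'n int_mpoly" where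
  "slice j k F = (\<Sum>m\<in>{m \<in> Poly_Mapping.keys F. Poly_Mapping.lookup m j = k}.
     Poly_Mapping.single (m - Poly_Mapping.single j k) (Poly_Mapping.lookup F m))"

lemma varsin_slice:
  assumes "varsin (insert j J) F" shows "varsin (J - {j}) (slice j k F)"
  unfolding slice_def
proof (rule varsin_sum)
  fix m assume m: "m \<in> {m \<in> Poly_Mapping.keys F. Poly_Mapping.lookup m j = k}"
  have "Poly_Mapping.keys (m - Poly_Mapping.single j k) \<subseteq> J - {j}"
  proof
    fix i assume "i \<in> Poly_Mapping.keys (m - Poly_Mapping.single j k)"
    then have "Poly_Mapping.lookup m i \<noteq> 0" "i \<noteq> j"
      using m by (auto simp: in_keys_iff lookup_minus lookup_single when_def split: if_splits)
    moreover have "m \<in> Poly_Mapping.keys F" using m by blast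
    ultimately show "i \<in> J - {j}" using assms unfolding varsin_def in_keys_iff[symmetric] by blast
  qed
  then show "varsin (J - {j}) (Poly_Mapping.single (m - Poly_Mapping.single j k) (Poly_Mapping.lookup F m))"
    by (auto simp: varsin_def)
qed

lemma slice_sum:
  obtains N where "F = (\<Sum>k\<le>N. slice j k F * mvar j ^ k)"
proof -
  define N where "N = (\<Sum>m\<in>Poly_Mapping.keys F. Poly_Mapping.lookup m j)"
  have N: "Poly_Mapping.lookup m j \<le> N" if "m \<in> Poly_Mapping.keys F" for m
    unfolding N_def using that by (intro member_le_sum) auto
  have "slice j k F * mvar j ^ k = (\<Sum>m\<in>{m \<in> Poly_Mapping.keys F. Poly_Mapping.lookup m j = k}.
     Poly_Mapping.single m (Poly_Mapping.lookup F m))" for k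
  proof -
    have "m - Poly_Mapping.single j k + Poly_Mapping.single j k = m" if "Poly_Mapping.lookup m j = k" for m
      using that by (intro poly_mapping_eqI) (auto simp: lookup_add lookup_minus lookup_single when_def)
    then show ?thesis
      unfolding slice_def sum_distrib_right mvar_power mult_single by (intro sum.cong) auto
  qed
  then have "(\<Sum>k\<le>N. slice j k F * mvar j ^ k) =
      (\<Sum>k\<in>{..N}. \<Sum>m\<in>{m \<in> Poly_Mapping.keys F. Poly_Mapping.lookup m j = k}. Poly_Mapping.single m (Poly_Mapping.lookup F m))"
    by simp
  also have "\<dots> = (\<Sum>m\<in>Poly_Mapping.keys F. Poly_Mapping.single m (Poly_Mapping.lookup F m))"
    by (rule sum.group) (use N in auto)
  finally show thesis using that mpoly_monomials by metis
qed

lemma gen_ring_insert: "gen_ring a (insert j J) = adjoin (gen_ring a (J - {j})) (a j)"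
proof
  show "gen_ring a (insert j J) \<subseteq> adjoin (gen_ring a (J - {j})) (a j)"
  proof
    fix y assume "y \<in> gen_ring a (insert j J)"
    then obtain F where F: "varsin (insert j J) F" "y = ev a F" by (auto simp: gen_ring_def)
    obtain N where N: "F = (\<Sum>k\<le>N. slice j k F * mvar j ^ k)" using slice_sum .
    define f where "f = (\<Sum>k\<le>N. monom (ev a (slice j k F)) k)"
    have "f \<in> polys_over (gen_ring a (J - {j}))"
      unfolding f_def using varsin_slice[OF F(1)]
      by (intro subring_sum subring_polys_over polys_over_monom subring_gen_ring) (auto simp: gen_ring_def)
    moreover have "ev a F = poly f (a j)"
      by (subst N) (simp add: f_def poly_sum poly_monom ev_sum ev_mult ev_power)
    ultimately show "y \<in> adjoin (gen_ring a (J - {j})) (a j)"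
      unfolding adjoin_def F(2) by (auto intro: rev_image_eqI)
  qed
  show "adjoin (gen_ring a (J - {j})) (a j) \<subseteq> gen_ring a (insert j J)"
  proof -
    have "poly f (a j) \<in> gen_ring a (insert j J)" if "f \<in> polys_over (gen_ring a (J - {j}))" for f
    proof (rule poly_polys_over[OF subring_gen_ring])
      have "gen_ring a (J - {j}) \<subseteq> gen_ring a (insert j J)"
        unfolding gen_ring_def by (intro image_mono) (auto intro: varsin_mono)
      then show "f \<in> polys_over (gen_ring a (insert j J))" using that polys_over_mono by blast
    qed (simp add: gen_ring_mem)
    then show ?thesis by (auto simp: adjoin_def)
  qed
qed

text \<open>Complete integral closedness, unlike integral closedness, passes to polynomial rings by a
  mere descent on leading coefficients.\<close>
definition comp_int_closed :: "'k::field set \<Rightarrow> bool" where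
  "comp_int_closed R \<longleftrightarrow> (\<forall>y c. c \<in> R \<longrightarrow> c \<noteq> 0 \<longrightarrow> (\<forall>k. c * y ^ k \<in> R) \<longrightarrow> y \<in> R)"

text \<open>All powers of the reduced denominator of \<open>y\<close> divide the fixed nonzero
  integer \<open>c\<close>, so the denominator is 1.\<close>

lemma comp_int_closed_Ints: "comp_int_closed (\<int> :: real set)"
  unfolding comp_int_closed_def
proof (intro allI impI)
  fix y c :: real assume c: "c \<in> \<int>" "c \<noteq> 0" and k: "\<forall>k. c * y ^ k \<in> \<int>"
  obtain m where m: "c = of_int m" using c Ints_cases by blast
  obtain e where e: "c * y = of_int e" using k[rule_format, of 1] Ints_cases by auto
  have "y = of_int e / of_int m" using e m c by (simp add: field_simps)
  then have "y \<in> \<rat>" by simp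
  then obtain p q :: int where pq: "q > 0" "coprime p q" "y = of_int p / of_int q" by (rule Rats_cases')
  have dv: "q ^ k dvd m" for k
  proof -
    obtain t where "c * y ^ k = of_int t" using k Ints_cases by blast
    then have "of_int (m * p ^ k) = (of_int (t * q ^ k) :: real)"
      using pq by (simp add: m field_simps)
    then have "m * p ^ k = t * q ^ k" by linarith
    then have "q ^ k dvd m * p ^ k" by simp
    moreover have "coprime (q ^ k) (p ^ k)" using pq(2) by (simp add: coprime_commute)
    ultimately show ?thesis using coprime_dvd_mult_left_iff by blast
  qed
  have "q = 1"
  proof (rule ccontr)
    assume "q \<noteq> 1"
    then have q2: "q \<ge> 2" using pq(1) by simp
    define n where "n = nat \<bar>m\<bar>"
    have "int n < 2 ^ n" by (metis of_nat_less_two_power)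
    also have "(2::int) ^ n \<le> q ^ n" using q2 by (intro power_mono) auto
    also have "q ^ n \<le> \<bar>m\<bar>" using dv[of n] m c by (intro zdvd_imp_le) auto
    finally show False by (simp add: n_def)
  qed
  then show "y \<in> \<int>" using pq by simp
qed

text \<open>For \<open>y = g / h\<close>, transcendence of \<open>x\<close> turns the hypothesis
  into polynomial identities \<open>h * g ^ k = u k * h ^ k\<close>. Their leading coefficients show
  that the quotient \<tau> of those of \<open>g\<close> and \<open>h\<close> satisfies the
  hypothesis over \<open>R\<close>, so it lies in \<open>R\<close>; subtracting the matching
  multiple of \<open>h\<close> from \<open>g\<close> lowers the degree.\<close>

lemma comp_int_closed_adjoin:
  fixes x :: "'k::field"
  assumes R: "subring_set R" and cic: "comp_int_closed R"
    and tr: "\<And>f. f \<in> polys_over R \<Longrightarrow> poly f x = 0 \<Longrightarrow> f = 0"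
  shows "comp_int_closed (adjoin R x)"
proof -
  note P = subring_polys_over[OF R] and A = subring_adjoin[OF R, of x]
  have main: "\<exists>t\<in>polys_over R. poly g x = poly t x * poly h x"
    if h: "h \<in> polys_over R" "h \<noteq> 0" and "g \<in> polys_over R"
      and "\<And>k. poly h x * (poly g x / poly h x) ^ k \<in> adjoin R x" for g h
    using that(3,4)
  proof (induction "degree g" arbitrary: g rule: less_induct)
    case less
    have hx: "poly h x \<noteq> 0" using h tr by blast
    show ?case
    proof (cases "g = 0")
      case True
      then show ?thesis using subring_0[OF P] by (intro bexI[of _ 0]) auto
    next
      case g0: False
      have "\<exists>u\<in>polys_over R. h * g ^ k = u * h ^ k" for k
      proof -
        obtain u where u: "u \<in> polys_over R" "poly h x * (poly g x / poly h x) ^ k = poly u x"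
          using less.prems(2)[of k] by (auto simp: adjoin_def)
        then have "poly (h * g ^ k - u * h ^ k) x = 0" using hx by (simp add: field_simps)
        moreover have "h * g ^ k - u * h ^ k \<in> polys_over R"
          using h u less.prems(1) by (intro subring_diff[OF P] subring_mult[OF P] subring_power[OF P])
        ultimately have "h * g ^ k - u * h ^ k = 0" using tr by blast
        then show ?thesis using u by auto
      qed
      then obtain u where u: "\<And>k. u k \<in> polys_over R" "\<And>k. h * g ^ k = u k * h ^ k" by metis
      define \<tau> where "\<tau> = lead_coeff g / lead_coeff h"
      have lch: "lead_coeff h \<noteq> 0" using h by simp
      have "lead_coeff h * \<tau> ^ k \<in> R" for k
      proof -
        have "lead_coeff (h * g ^ k) = lead_coeff (u k * h ^ k)" by (simp add: u(2))
        then have "lead_coeff h * lead_coeff g ^ k = lead_coeff (u k) * lead_coeff h ^ k"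
          by (simp add: lead_coeff_mult lead_coeff_power)
        then have "lead_coeff h * \<tau> ^ k = lead_coeff (u k)" using lch by (simp add: \<tau>_def field_simps)
        then show ?thesis using u(1) polys_overD by metis
      qed
      then have \<tau>: "\<tau> \<in> R" using cic lch polys_overD[OF h(1)] unfolding comp_int_closed_def by blast
      have \<tau>0: "\<tau> \<noteq> 0" using g0 lch by (simp add: \<tau>_def)
      have deg: "degree h \<le> degree g"
      proof (rule ccontr)
        assume lt: "\<not> degree h \<le> degree g"
        \<comment> \<open>If \<open>degree g < degree h\<close>, comparing degrees in the identity
          for \<open>k\<close> gives \<open>k \<le> degree h\<close>; this exponent is just too
          large.\<close>
        define k where "k = Suc (degree h)"
        have "u k \<noteq> 0" using u(2)[of k] h g0 by auto
        then have "degree h + k * degree g = degree (u k) + k * degree h"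
          using arg_cong[OF u(2)[of k], of degree] h g0 by (simp add: degree_mult_eq degree_power_eq)
        then have "k * degree h \<le> degree h + k * degree g" by simp
        moreover have "k * Suc (degree g) \<le> k * degree h" using lt by (intro mult_left_mono) auto
        ultimately show False by (simp add: k_def)
      qed
      define m where "m = monom \<tau> (degree g - degree h)"
      have mP: "m \<in> polys_over R" using \<tau> R by (simp add: m_def polys_over_monom)
      have m0: "m \<noteq> 0" using \<tau>0 by (simp add: m_def)
      define g' where "g' = g - m * h"
      have g'P: "g' \<in> polys_over R" unfolding g'_def
        using mP h less.prems(1) by (intro subring_diff[OF P] subring_mult[OF P])
      have dmh: "degree (m * h) = degree g" using m0 h deg \<tau>0 by (simp add: degree_mult_eq m_def degree_monom_eq)
      have "coeff (m * h) (degree g) = lead_coeff g"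
      proof -
        have "coeff (m * h) (degree g) = lead_coeff m * lead_coeff h" using dmh lead_coeff_mult by metis
        then show ?thesis using lch \<tau>0 by (simp add: m_def degree_monom_eq \<tau>_def)
      qed
      then have "coeff g' (degree g) = 0" by (simp add: g'_def)
      moreover have "degree g' \<le> degree g" unfolding g'_def using dmh by (intro degree_diff_le) auto
      ultimately have g': "g' = 0 \<or> degree g' < degree g" by (rule eq_zero_or_degree_less[rotated])
      show ?thesis
      proof (cases "g' = 0")
        case True
        then show ?thesis using mP by (intro bexI[of _ m]) (auto simp: g'_def)
      next
        case False
        have "poly h x * (poly g' x / poly h x) ^ k \<in> adjoin R x" for k
        proof -
          have eq: "poly g' x / poly h x = poly g x / poly h x + (- poly m x)"
            using hx by (simp add: g'_def field_simps)
          \<comment> \<open>The quotient for \<open>g'\<close> differs from that for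
            \<open>g\<close> by an element of the ring, so the binomial expansion carries the
            hypothesis over.\<close>
          have "poly h x * (poly g' x / poly h x) ^ k =
            (\<Sum>i\<le>k. of_nat (k choose i) * (poly h x * (poly g x / poly h x) ^ i) * (- poly m x) ^ (k - i))"
            by (simp only: eq binomial_ring sum_distrib_left mult_ac)
          also have "\<dots> \<in> adjoin R x"
          proof (rule subring_sum[OF A])
            fix i
            have "poly m x \<in> adjoin R x" using mP by (auto simp: adjoin_def)
            then show "of_nat (k choose i) * (poly h x * (poly g x / poly h x) ^ i) * (- poly m x) ^ (k - i) \<in> adjoin R x"
              by (intro subring_mult[OF A subring_mult[OF A subring_of_nat[OF A] less.prems(2)]]
                  subring_power[OF A] subring_uminus[OF A])
          qed
          finally show ?thesis .
        qed
        then obtain t where t: "t \<in> polys_over R" "poly g' x = poly t x * poly h x"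
          using less.hyps[of g'] g' False g'P by blast
        then have "poly g x = poly (t + m) x * poly h x" by (simp add: g'_def algebra_simps)
        then show ?thesis using subring_add[OF P t(1) mP] by blast
      qed
    qed
  qed
  show ?thesis unfolding comp_int_closed_def
  proof (intro allI impI)
    fix y c assume c: "c \<in> adjoin R x" "c \<noteq> 0" and k: "\<forall>k. c * y ^ k \<in> adjoin R x"
    obtain h where h: "h \<in> polys_over R" "c = poly h x" using c by (auto simp: adjoin_def)
    have h0: "h \<noteq> 0" using c h by auto
    obtain g where g: "g \<in> polys_over R" "c * y = poly g x" using k[rule_format, of 1] by (auto simp: adjoin_def)
    have y: "y = poly g x / poly h x" using g h c by (simp add: field_simps)
    obtain t where "t \<in> polys_over R" "poly g x = poly t x * poly h x"
      using main[OF h(1) h0 g(1)] k h(2) y by metis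
    then show "y \<in> adjoin R x" using y h(2) c(2) by (auto simp: adjoin_def)
  qed
qed

section \<open>Algebraically independent reals in a prescribed box\<close>

lemma countable_polys_over:
  assumes "countable R" shows "countable (polys_over R)"
proof -
  have "polys_over R \<subseteq> Poly ` lists R"
  proof
    fix f assume f: "f \<in> polys_over R"
    have "coeffs f \<in> lists R"
      using f by (auto simp: in_set_conv_nth coeffs_nth polys_over_def in_lists_conv_set coeffs_def)
    then show "f \<in> Poly ` lists R" by (intro image_eqI[where x = "coeffs f"]) auto
  qed
  then show ?thesis using countable_lists[OF assms] by (meson countable_image countable_subset)
qed

lemma transcendental_in_interval:
  fixes R :: "real set"
  assumes "countable R" "l < u"
  obtains x where "l < x" "x < u" "\<And>f. f \<in> polys_over R \<Longrightarrow> poly f x = 0 \<Longrightarrow> f = 0"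
proof -
  define Z where "Z = (\<Union>f\<in>polys_over R - {0}. {x. poly f x = 0})"
  have "countable Z" unfolding Z_def
    using countable_polys_over[OF assms(1)] by (intro countable_UN) (auto intro: countable_finite poly_roots_finite)
  moreover have "uncountable {l<..<u}" using assms(2) by (simp add: uncountable_open_interval)
  ultimately obtain x where "x \<in> {l<..<u}" "x \<notin> Z" by (meson countable_subset subsetI)
  then show thesis using that by (auto simp: Z_def)
qed

definition alg_indep :: "('n::finite \<Rightarrow> real) \<Rightarrow> 'n set \<Rightarrow> bool" where
  "alg_indep a J \<longleftrightarrow> (\<forall>F. varsin J F \<longrightarrow> ev a F = 0 \<longrightarrow> F = 0)"

lemma gen_ring_empty: "gen_ring a {} = (\<int> :: real set)"
proof
  show "gen_ring a {} \<subseteq> (\<int> :: real set)"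
  proof -
    have "ev a F \<in> \<int>" if "varsin {} F" for F
    proof -
      have "ev a F = ev (\<lambda>_. 0) F" by (rule ev_cong[OF that]) auto
      moreover have "subring_set (\<int> :: real set)" by (auto simp: subring_set_def)
      ultimately show ?thesis using ev_in_subring[of "\<int> :: real set" "\<lambda>_. 0" F] by simp
    qed
    then show ?thesis by (auto simp: gen_ring_def)
  qed
  show "(\<int> :: real set) \<subseteq> gen_ring a {}"
    using subring_of_int[OF subring_gen_ring[of a "{}"]] by (auto elim!: Ints_cases)
qed

text \<open>The coordinates in \<open>J\<close> are chosen one after another, each transcendental
  over the ring of the previous ones. Countability of that ring leaves room in every interval, and
  transcendence preserves complete integral closedness.\<close>

lemma alg_indep_point:
  fixes l u :: "'n::finite \<Rightarrow> real"
  assumes lu: "\<And>j. l j < u j"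
  shows "\<exists>a. (\<forall>j. l j < a j \<and> a j < u j) \<and> alg_indep a J \<and> comp_int_closed (gen_ring a J) \<and> countable (gen_ring a J)"
proof -
  have "finite J" by simp
  then show ?thesis
  proof induction
    case empty
    define a where "a j = (l j + u j) / 2" for j
    have "l j < a j \<and> a j < u j" for j using lu[of j] by (simp add: a_def)
    moreover have "alg_indep a {}"
      unfolding alg_indep_def
    proof (intro allI impI)
      fix F assume F: "varsin {} F" "ev a F = 0"
      have "Poly_Mapping.keys F \<subseteq> {0}" using F(1) by (auto simp: varsin_def)
      then have "ev a F = of_int (Poly_Mapping.lookup F 0)" by (subst ev_superset[of "{0}"]) auto
      then have "Poly_Mapping.lookup F 0 = 0" using F(2) by simp
      then show "F = 0" using \<open>Poly_Mapping.keys F \<subseteq> {0}\<close>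
        by (metis in_keys_iff keys_eq_empty subset_singletonD singletonI)
    qed
    ultimately show ?case
      using comp_int_closed_Ints countable_int by (auto simp: gen_ring_empty Ints_def intro!: exI[of _ a])
  next
    case (insert j J)
    then obtain a where a: "\<And>j. l j < a j \<and> a j < u j" "alg_indep a J"
      "comp_int_closed (gen_ring a J)" "countable (gen_ring a J)" by blast
    obtain x where x: "l j < x" "x < u j" and tr: "\<And>f. f \<in> polys_over (gen_ring a J) \<Longrightarrow> poly f x = 0 \<Longrightarrow> f = 0"
      using transcendental_in_interval[OF a(4) lu] by metis
    define b where "b = a(j := x)"
    have ab: "i \<in> J \<Longrightarrow> b i = a i" for i using insert.hyps by (auto simp: b_def)
    have R: "gen_ring b J = gen_ring a J" by (rule gen_ring_cong) (rule ab)
    have Jj: "J - {j} = J" using insert.hyps by simp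
    have Rj: "gen_ring b (insert j J) = adjoin (gen_ring a J) x"
      by (simp add: gen_ring_insert Jj R) (simp add: b_def)
    have "alg_indep b (insert j J)"
      unfolding alg_indep_def
    proof (intro allI impI)
      fix F assume F: "varsin (insert j J) F" "ev b F = 0"
      obtain N where N: "F = (\<Sum>k\<le>N. slice j k F * mvar j ^ k)" using slice_sum .
      have v: "varsin J (slice j k F)" for k using varsin_slice[OF F(1)] Jj by simp
      define f where "f = (\<Sum>k\<le>N. monom (ev b (slice j k F)) k)"
      have "f \<in> polys_over (gen_ring b J)"
        unfolding f_def using v
        by (intro subring_sum subring_polys_over polys_over_monom subring_gen_ring) (auto simp: gen_ring_def)
      moreover have "ev b F = poly f x"
        by (subst N) (simp add: f_def poly_sum poly_monom ev_sum ev_mult ev_power b_def)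
      ultimately have "f = 0" using tr F(2) R by simp
      have "slice j k F = 0" if "k \<le> N" for k
      proof -
        have "coeff f k = ev b (slice j k F)" using that by (simp add: f_def coeff_sum)
        then have "ev a (slice j k F) = 0" using \<open>f = 0\<close> ev_cong[OF v, of b a] ab by simp
        then show ?thesis using a(2) v by (auto simp: alg_indep_def)
      qed
      then show "F = 0" by (subst N) simp
    qed
    moreover have "comp_int_closed (gen_ring b (insert j J))"
      unfolding Rj using subring_gen_ring a(3) tr by (rule comp_int_closed_adjoin)
    moreover have "countable (gen_ring b (insert j J))"
      unfolding Rj adjoin_def using countable_polys_over[OF a(4)] by simp
    moreover have "l i < b i \<and> b i < u i" for i using a(1) x by (simp add: b_def)
    ultimately show ?case by blast
  qed
qed

section \<open>Polynomials in one distinguished variable\<close>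

definition upoly :: "('n::finite \<Rightarrow> 'b::comm_ring_1) \<Rightarrow> 'n \<Rightarrow> 'n int_mpoly \<Rightarrow> 'b poly" where
  "upoly a j F = ev (\<lambda>i. if i = j then [:0, 1:] else [:a i:]) F"

lemma upoly_const:
  assumes "varsin (UNIV - {j}) G" shows "upoly a j G = [:ev a G:]"
proof -
  have "upoly a j G = ev (\<lambda>i. [:a i:]) G" unfolding upoly_def by (rule ev_cong[OF assms]) auto
  also have "\<dots> = [:ev a G:]" by (rule ev_hom[symmetric]) (auto simp: one_pCons)
  finally show ?thesis .
qed

lemma upoly_mvar_power: "upoly a j (mvar j ^ k) = monom 1 k"
  by (simp add: upoly_def ev_power monom_altdef)

lemma upoly_expand:
  assumes "\<And>k. k \<le> N \<Longrightarrow> varsin (UNIV - {j}) (G k)"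
  shows "upoly a j (\<Sum>k\<le>N. G k * mvar j ^ k) = (\<Sum>k\<le>N. monom (ev a (G k)) k)"
proof -
  have "upoly a j (\<Sum>k\<le>N. G k * mvar j ^ k) = (\<Sum>k\<le>N. upoly a j (G k) * upoly a j (mvar j ^ k))"
    by (simp add: upoly_def ev_sum ev_mult)
  also have "\<dots> = (\<Sum>k\<le>N. monom (ev a (G k)) k)"
    by (intro sum.cong refl) (simp add: upoly_const assms upoly_mvar_power smult_monom)
  finally show ?thesis .
qed

lemma upoly_mult: "upoly a j (F * G) = upoly a j F * upoly a j G"
  and upoly_diff: "upoly a j (F - G) = upoly a j F - upoly a j G"
  and upoly_1: "upoly a j 1 = 1"
  by (simp_all add: upoly_def ev_mult ev_diff)

lemma poly_upoly: "poly (upoly a j F) (a j) = ev a F"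
proof -
  have "poly (upoly a j F) (a j) = ev (\<lambda>i. poly (if i = j then [:0, 1:] else [:a i:]) (a j)) F"
    unfolding upoly_def by (rule ev_hom) auto
  also have "(\<lambda>i. poly (if i = j then [:0, 1:] else [:a i:]) (a j)) = a" by auto
  finally show ?thesis .
qed

lemma upoly_in:
  fixes a :: "'n::finite \<Rightarrow> 'b::comm_ring_1"
  shows "upoly a j F \<in> polys_over (gen_ring a (UNIV - {j}))"
  unfolding upoly_def
proof (rule ev_in_subring[OF subring_polys_over[OF subring_gen_ring]])
  fix i
  have "[:0, 1:] = monom (1 :: 'b) 1" by (simp add: monom_altdef)
  then have "[:0, 1:] \<in> polys_over (gen_ring a (UNIV - {j}))"
    using polys_over_monom[OF subring_gen_ring subring_1[OF subring_gen_ring]] by metis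
  moreover have "[:a i:] \<in> polys_over (gen_ring a (UNIV - {j}))" if "i \<noteq> j"
    using that by (intro polys_over_const subring_gen_ring gen_ring_mem) auto
  ultimately show "(if i = j then [:0, 1:] else [:a i:]) \<in> polys_over (gen_ring a (UNIV - {j}))" by simp
qed

lemma upoly_surj:
  assumes "f \<in> polys_over (gen_ring a (UNIV - {j}))" shows "\<exists>F. upoly a j F = f"
proof -
  have "\<exists>G. varsin (UNIV - {j}) G \<and> ev a G = coeff f k" for k
    using polys_overD[OF assms, of k] by (auto simp: gen_ring_def)
  then obtain G where G: "\<And>k. varsin (UNIV - {j}) (G k)" "\<And>k. ev a (G k) = coeff f k" by metis
  have "upoly a j (\<Sum>k\<le>degree f. G k * mvar j ^ k) = (\<Sum>k\<le>degree f. monom (coeff f k) k)"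
    using upoly_expand[of "degree f" j G a] G by simp
  then have "upoly a j (\<Sum>k\<le>degree f. G k * mvar j ^ k) = f" by (simp only: poly_as_sum_of_monoms)
  then show ?thesis by blast
qed

text \<open>Together with \<open>upoly_mult\<close>, \<open>upoly_in\<close> and
  \<open>upoly_surj\<close> this identifies the integer polynomials with the univariate polynomials
  over \<open>gen_ring a (UNIV - {j})\<close>, so divisibility can be settled in one
  variable.\<close>

lemma upoly_inj:
  assumes "alg_indep a (UNIV - {j})" "upoly a j F = 0" shows "F = 0"
proof -
  obtain N where N: "F = (\<Sum>k\<le>N. slice j k F * mvar j ^ k)" using slice_sum .
  have v: "varsin (UNIV - {j}) (slice j k F)" for k
    by (rule varsin_slice) (simp add: varsin_UNIV)
  have "upoly a j F = (\<Sum>k\<le>N. monom (ev a (slice j k F)) k)"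
    using upoly_expand[of N j "\<lambda>k. slice j k F" a] v N[symmetric] by simp
  then have z: "(\<Sum>k\<le>N. monom (ev a (slice j k F)) k) = 0" using assms(2) by simp
  have "slice j k F = 0" if "k \<le> N" for k
  proof -
    have "ev a (slice j k F) = coeff (\<Sum>k\<le>N. monom (ev a (slice j k F)) k) k" using that by (simp add: coeff_sum)
    then show ?thesis using assms(1) v z by (auto simp: alg_indep_def)
  qed
  then show ?thesis by (subst N) simp
qed

section \<open>Gauss's lemma for valuation rings\<close>

text \<open>The maximal ideal of a valuation ring. Zero is listed separately because
  \<open>inverse 0 = 0\<close> lies in \<open>V\<close>.\<close>

definition nonunits :: "'k::field set \<Rightarrow> 'k set" where
  "nonunits V = {x \<in> V. x = 0 \<or> inverse x \<notin> V}"

lemma nonunits_0: "valuation_ring V \<Longrightarrow> 0 \<in> nonunits V"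
  by (auto simp: nonunits_def valuation_ring_def subring_0)

lemma valuation_subring: "valuation_ring V \<Longrightarrow> subring_set V"
  by (simp add: valuation_ring_def)

lemma nonunits_mult:
  assumes V: "valuation_ring V" and x: "x \<in> nonunits V" and y: "y \<in> V" shows "x * y \<in> nonunits V"
proof (cases "x * y = 0")
  case True
  show ?thesis unfolding True by (rule nonunits_0[OF V])
next
  case False
  note S = valuation_subring[OF V]
  have "inverse (x * y) \<notin> V"
  proof
    assume "inverse (x * y) \<in> V"
    then have "y * inverse (x * y) \<in> V" using subring_mult[OF S y] by blast
    moreover have "y * inverse (x * y) = inverse x" using False by (simp add: field_simps)
    ultimately have "inverse x \<in> V" by (simp only:)
    then show False using x False by (auto simp: nonunits_def)
  qed
  then show ?thesis using x y subring_mult[OF S] by (auto simp: nonunits_def)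
qed

lemma nonunits_add:
  assumes V: "valuation_ring V" and x: "x \<in> nonunits V" and y: "y \<in> nonunits V" shows "x + y \<in> nonunits V"
proof -
  note S = valuation_subring[OF V]
  have *: "x + y \<in> nonunits V" if "x \<in> nonunits V" "y \<in> nonunits V" "y \<noteq> 0" "x / y \<in> V" for x y
  proof -
    have "y * (1 + x / y) \<in> nonunits V"
      using that by (intro nonunits_mult[OF V] subring_add[OF S] subring_1[OF S])
    moreover have "y * (1 + x / y) = x + y" using that by (simp add: field_simps)
    ultimately show ?thesis by simp
  qed
  show ?thesis
  proof (cases "x = 0 \<or> y = 0")
    case False
    have "x / y \<in> V \<or> inverse (x / y) \<in> V" using V by (auto simp: valuation_ring_def)
    then have "x / y \<in> V \<or> y / x \<in> V" by simp
    then show ?thesis using *[of x y] *[of y x] x y False by (auto simp: add.commute)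
  qed (use x y in auto)
qed

lemma nonunits_sum: "valuation_ring V \<Longrightarrow> (\<And>i. i \<in> A \<Longrightarrow> f i \<in> nonunits V) \<Longrightarrow> sum f A \<in> nonunits V"
  by (induction A rule: infinite_finite_induct) (auto intro: nonunits_0 nonunits_add)

lemma nonunits_1: "valuation_ring V \<Longrightarrow> 1 \<notin> nonunits V"
  by (auto simp: nonunits_def valuation_ring_def subring_1)

text \<open>The first index at which the coefficients attain their largest size. There is no value
  group at hand, so sizes are compared through quotients lying in \<open>V\<close>.\<close>

lemma dominating_coeff:
  assumes V: "valuation_ring V" and f: "f \<noteq> 0"
  obtains i where "coeff f i \<noteq> 0" "\<And>k. coeff f k / coeff f i \<in> V"
    "\<And>k. k < i \<Longrightarrow> coeff f k / coeff f i \<in> nonunits V"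
proof -
  note S = valuation_subring[OF V]
  have max: "\<exists>\<alpha>\<in>A. \<forall>x\<in>A. x / \<alpha> \<in> V" if "finite A" "A \<noteq> {}" "0 \<notin> A" for A
    using that
  proof (induction A rule: finite_ne_induct)
    case (singleton x)
    then show ?case using subring_1[OF S] by simp
  next
    case (insert x A)
    then obtain \<alpha> where \<alpha>: "\<alpha> \<in> A" "\<forall>x\<in>A. x / \<alpha> \<in> V" by auto
    have "x / \<alpha> \<in> V \<or> inverse (x / \<alpha>) \<in> V" using V by (auto simp: valuation_ring_def)
    then show ?case
    proof
      assume "x / \<alpha> \<in> V" then show ?thesis using \<alpha> by auto
    next
      assume "inverse (x / \<alpha>) \<in> V"
      then have ax: "\<alpha> / x \<in> V" by simp
      have "y / x \<in> V" if "y \<in> A" for y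
      proof -
        have "y / \<alpha> * (\<alpha> / x) \<in> V" using \<alpha> that ax by (intro subring_mult[OF S]) auto
        moreover have "\<alpha> \<noteq> 0" using \<alpha>(1) insert.prems by auto
        ultimately show ?thesis by simp
      qed
      then show ?thesis using subring_1[OF S] insert.prems by (intro bexI[of _ x]) auto
    qed
  qed
  define P where "P i \<longleftrightarrow> coeff f i \<noteq> 0 \<and> (\<forall>k. coeff f k / coeff f i \<in> V)" for i
  define A where "A = coeff f ` {..degree f} - {0}"
  have "A \<noteq> {}" "finite A" "0 \<notin> A" using f by (auto simp: A_def)
  then obtain \<alpha> where \<alpha>: "\<alpha> \<in> A" "\<forall>x\<in>A. x / \<alpha> \<in> V" using max by blast
  then obtain i where "\<alpha> = coeff f i" by (auto simp: A_def)
  moreover have "coeff f k / \<alpha> \<in> V" for k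
    using \<alpha>(2) subring_0[OF S] by (cases "coeff f k = 0") (auto simp: A_def le_degree)
  ultimately have "P i" using \<alpha>(1) by (auto simp: P_def A_def)
  define i0 where "i0 = (LEAST i. P i)"
  have P0: "P i0" unfolding i0_def using \<open>P i\<close> by (rule LeastI)
  have "coeff f k / coeff f i0 \<in> nonunits V" if "k < i0" for k
  proof (rule ccontr)
    assume n: "coeff f k / coeff f i0 \<notin> nonunits V"
    then have u: "coeff f k \<noteq> 0" "coeff f i0 / coeff f k \<in> V"
      using P0 subring_0[OF S] by (auto simp: nonunits_def P_def)
    have "coeff f l / coeff f k \<in> V" for l
    proof -
      have "coeff f l / coeff f i0 * (coeff f i0 / coeff f k) \<in> V"
        using P0 u by (intro subring_mult[OF S]) (auto simp: P_def)
      then show ?thesis using P0 by (simp add: P_def)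
    qed
    then have "P k" using u by (simp add: P_def)
    then show False using that not_less_Least by (metis i0_def)
  qed
  then show thesis using that P0 unfolding P_def by blast
qed

text \<open>At the sum of the two dominating indices the term \<open>\<alpha> * \<beta>\<close>
  outweighs all others in the coefficient of the product, so it lies in \<open>V\<close>. As
  \<open>g\<close> is monic, \<open>1 / \<beta>\<close> lies in \<open>V\<close>; hence so does
  \<alpha>, and with it every coefficient of \<open>f\<close>.\<close>

lemma gauss_valuation:
  assumes V: "valuation_ring V" and fg: "f * g \<in> polys_over V" and f: "lead_coeff f = 1" and g: "lead_coeff g = 1"
  shows "f \<in> polys_over V"
proof -
  note S = valuation_subring[OF V]
  have "f \<noteq> 0" "g \<noteq> 0" using f g by auto
  obtain i where i: "coeff f i \<noteq> 0" "\<And>k. coeff f k / coeff f i \<in> V"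
    "\<And>k. k < i \<Longrightarrow> coeff f k / coeff f i \<in> nonunits V" using dominating_coeff[OF V \<open>f \<noteq> 0\<close>] by metis
  obtain j where j: "coeff g j \<noteq> 0" "\<And>k. coeff g k / coeff g j \<in> V"
    "\<And>k. k < j \<Longrightarrow> coeff g k / coeff g j \<in> nonunits V" using dominating_coeff[OF V \<open>g \<noteq> 0\<close>] by metis
  define \<alpha> \<beta> where "\<alpha> = coeff f i" and "\<beta> = coeff g j"
  have ab: "\<alpha> \<noteq> 0" "\<beta> \<noteq> 0" using i j by (auto simp: \<alpha>_def \<beta>_def)
  define s where "s = (\<Sum>k\<in>{..i + j} - {i}. (coeff f k / \<alpha>) * (coeff g (i + j - k) / \<beta>))"
  have "s \<in> nonunits V" unfolding s_def
  proof (rule nonunits_sum[OF V])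
    fix k assume k: "k \<in> {..i + j} - {i}"
    then consider "k < i" | "i + j - k < j" "k \<le> i + j" by fastforce
    then show "coeff f k / \<alpha> * (coeff g (i + j - k) / \<beta>) \<in> nonunits V"
    proof cases
      case 1
      then show ?thesis using i j by (intro nonunits_mult[OF V]) (auto simp: \<alpha>_def \<beta>_def)
    next
      case 2
      then have "coeff g (i + j - k) / \<beta> * (coeff f k / \<alpha>) \<in> nonunits V"
        using i j by (intro nonunits_mult[OF V]) (auto simp: \<alpha>_def \<beta>_def)
      then show ?thesis by (simp add: mult.commute)
    qed
  qed
  have "coeff (f * g) (i + j) = \<alpha> * \<beta> * (1 + s)"
  proof -
    have "coeff (f * g) (i + j) = \<alpha> * \<beta> + (\<Sum>k\<in>{..i + j} - {i}. coeff f k * coeff g (i + j - k))"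
      unfolding coeff_mult by (subst sum.remove[of _ i]) (auto simp: \<alpha>_def \<beta>_def)
    also have "(\<Sum>k\<in>{..i + j} - {i}. coeff f k * coeff g (i + j - k)) = \<alpha> * \<beta> * s"
      unfolding s_def sum_distrib_left using ab by (intro sum.cong) auto
    finally show ?thesis by (simp add: algebra_simps)
  qed
  moreover have sV: "s \<in> V" using \<open>s \<in> nonunits V\<close> by (simp add: nonunits_def)
  have unit: "1 + s \<noteq> 0" "inverse (1 + s) \<in> V"
  proof -
    have "1 + s \<notin> nonunits V"
    proof
      assume n: "1 + s \<in> nonunits V"
      have "s * (- 1) \<in> nonunits V"
        using \<open>s \<in> nonunits V\<close> by (intro nonunits_mult[OF V] subring_uminus[OF S] subring_1[OF S])
      then have "1 + s + s * (- 1) \<in> nonunits V" using nonunits_add[OF V n] by blast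
      then show False using nonunits_1[OF V] by simp
    qed
    moreover have "1 + s \<in> V" using sV by (intro subring_add[OF S] subring_1[OF S])
    ultimately show "1 + s \<noteq> 0" "inverse (1 + s) \<in> V" by (auto simp: nonunits_def)
  qed
  ultimately have "coeff (f * g) (i + j) * inverse (1 + s) = \<alpha> * \<beta>" by simp
  then have "\<alpha> * \<beta> \<in> V" using polys_overD[OF fg] unit(2) subring_mult[OF S] by metis
  moreover have "1 / \<beta> \<in> V" using j(2)[of "degree g"] g by (simp add: \<beta>_def)
  ultimately have "\<alpha> * \<beta> * (1 / \<beta>) \<in> V" using subring_mult[OF S] by blast
  then have "\<alpha> \<in> V" using ab by simp
  show ?thesis
  proof (rule polys_overI)
    fix k
    have "coeff f k / \<alpha> * \<alpha> \<in> V" using i(2) \<open>\<alpha> \<in> V\<close> unfolding \<alpha>_def by (intro subring_mult[OF S])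
    then show "coeff f k \<in> V" using ab by simp
  qed
qed

section \<open>The vanishing ideal\<close>

lemma pseudo_division_over:
  assumes R: "subring_set (R :: 'k::idom set)" and g: "g \<in> polys_over R" "g \<noteq> 0" and f: "f \<in> polys_over R"
  shows "\<exists>k. \<exists>q\<in>polys_over R. \<exists>r\<in>polys_over R. smult (lead_coeff g ^ k) f = g * q + r \<and> (r = 0 \<or> degree r < degree g)"
  using f
proof (induction "degree f" arbitrary: f rule: less_induct)
  case less
  note P = subring_polys_over[OF R]
  show ?case
  proof (cases "f = 0 \<or> degree f < degree g")
    case True
    then show ?thesis using less.prems subring_0[OF P] by (intro exI[of _ 0] bexI[of _ 0] bexI[of _ f]) auto
  next
    case False
    define m where "m = monom (lead_coeff f) (degree f - degree g)"
    define f' where "f' = smult (lead_coeff g) f - m * g"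
    have mP: "m \<in> polys_over R" unfolding m_def using less.prems by (intro polys_over_monom R polys_overD)
    have f'P: "f' \<in> polys_over R" unfolding f'_def
      using mP less.prems g by (intro subring_diff[OF P] subring_mult[OF P] polys_over_smult R polys_overD)
    have m0: "m \<noteq> 0" using False by (simp add: m_def)
    have dm: "degree (m * g) = degree f"
      using m0 g False by (simp add: degree_mult_eq m_def degree_monom_eq)
    have "coeff (m * g) (degree f) = lead_coeff g * lead_coeff f"
    proof -
      have "coeff (m * g) (degree f) = lead_coeff m * lead_coeff g" using dm lead_coeff_mult by metis
      then show ?thesis using False by (simp add: m_def degree_monom_eq)
    qed
    then have "coeff f' (degree f) = 0" by (simp add: f'_def)
    moreover have "degree f' \<le> degree f" unfolding f'_def using dm by (intro degree_diff_le) (auto intro: degree_smult_le)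
    ultimately have f': "f' = 0 \<or> degree f' < degree f" by (rule eq_zero_or_degree_less[rotated])
    have "\<exists>k. \<exists>q\<in>polys_over R. \<exists>r\<in>polys_over R. smult (lead_coeff g ^ k) f' = g * q + r \<and> (r = 0 \<or> degree r < degree g)"
    proof (cases "f' = 0")
      case True
      then show ?thesis using subring_0[OF P] by (intro exI[of _ 0] bexI[of _ 0]) auto
    qed (use f' less.hyps f'P in blast)
    then obtain k q r where kqr: "q \<in> polys_over R" "r \<in> polys_over R"
      "smult (lead_coeff g ^ k) f' = g * q + r" "r = 0 \<or> degree r < degree g" by blast
    have "smult (lead_coeff g ^ Suc k) f = smult (lead_coeff g ^ k) f' + smult (lead_coeff g ^ k) (m * g)"
      by (simp add: f'_def smult_diff_right mult.commute)
    also have "\<dots> = g * (q + smult (lead_coeff g ^ k) m) + r"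
      by (simp add: kqr(3) algebra_simps)
    finally have "smult (lead_coeff g ^ Suc k) f = g * (q + smult (lead_coeff g ^ k) m) + r" .
    moreover have "q + smult (lead_coeff g ^ k) m \<in> polys_over R"
      using kqr mP g by (intro subring_add[OF P] polys_over_smult R subring_power polys_overD)
    ultimately show ?thesis using kqr by blast
  qed
qed

text \<open>The bridge from integrality to complete integral closedness: an equation of degree
  \<open>n\<close> expresses all powers of \<open>y\<close> by the first \<open>n\<close>, for which
  \<open>h ^ n\<close> is a common denominator.\<close>

lemma integral_almost_integral:
  fixes y :: "'k::field"
  assumes R: "subring_set R" and y: "integral_over R y" and h: "h \<in> R" "h \<noteq> 0" "h * y \<in> R"
  shows "\<exists>c\<in>R. c \<noteq> 0 \<and> (\<forall>k. c * y ^ k \<in> R)"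
proof -
  obtain f where f: "f \<in> polys_over R" "lead_coeff f = 1" "poly f y = 0" using y by (auto simp: integral_over_def)
  define n where "n = degree f"
  have yn: "y ^ n = - (\<Sum>i<n. coeff f i * y ^ i)"
  proof -
    have "0 = (\<Sum>i\<le>n. coeff f i * y ^ i)" using f by (simp add: poly_altdef n_def)
    also have "\<dots> = (\<Sum>i<n. coeff f i * y ^ i) + y ^ n"
      using f(2) by (simp add: n_def lessThan_Suc_atMost[symmetric])
    finally show ?thesis by (simp add: eq_neg_iff_add_eq_0 add.commute)
  qed
  have "h ^ n * y ^ k \<in> R" for k
  proof (induction k rule: less_induct)
    case (less k)
    show ?case
    proof (cases "k < n")
      case True
      have "h ^ (n - k) * (h * y) ^ k \<in> R" 
        by (rule subring_mult[OF R subring_power[OF R h(1)] subring_power[OF R h(3)]])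
      also have "h ^ (n - k) * (h * y) ^ k = h ^ n * y ^ k"
        using True by (simp add: power_mult_distrib power_add[symmetric] flip: mult.assoc)
      finally show ?thesis .
    next
      case False
      have "h ^ n * y ^ k = h ^ n * (y ^ (k - n) * y ^ n)" using False by (simp flip: power_add)
      also have "\<dots> = - (\<Sum>i<n. coeff f i * (h ^ n * y ^ (k - n + i)))"
        by (simp add: yn sum_distrib_left power_add mult_ac)
      also have "\<dots> \<in> R"
      proof (rule subring_uminus[OF R], rule subring_sum[OF R])
        fix i assume "i \<in> {..<n}"
        then have "h ^ n * y ^ (k - n + i) \<in> R" using False by (intro less.IH) auto
        then show "coeff f i * (h ^ n * y ^ (k - n + i)) \<in> R" by (rule subring_mult[OF R polys_overD[OF f(1)]])
      qed
      finally show ?thesis .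
    qed
  qed
  then show ?thesis using h subring_power[OF R] by (intro bexI[of _ "h ^ n"]) auto
qed

text \<open>The minimal polynomial \<phi> of \<open>a j\<close> over the fraction field divides a
  monic \<open>Q\<close> over \<open>R\<close>. By Gauss over every valuation ring above
  \<open>R\<close> its coefficients are integral over \<open>R\<close>, and with their common
  denominator \<open>h\<close> this puts them in \<open>R\<close>. So \<phi> lifts to an integer
  polynomial \<Phi> dividing every relation; it divides the irreducible \<open>P\<close>, and hence
  agrees with it up to a unit.\<close>

theorem irreducible_generates_vanishing_ideal:
  fixes a :: "'n::finite \<Rightarrow> real" and j :: 'n
  defines "R \<equiv> gen_ring a (UNIV - {j})"
  assumes indep: "alg_indep a (UNIV - {j})" and cic: "comp_int_closed R"
    and int: "integral_over R (a j)" and irr: "irreducible P" and P: "ev a P = 0" and F: "ev a F = 0"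
  shows "P dvd F"
proof -
  have R: "subring_set R" unfolding R_def by (rule subring_gen_ring)
  note PR = subring_polys_over[OF R]
  obtain Q where Q: "Q \<in> polys_over R" "lead_coeff Q = 1" "poly Q (a j) = 0"
    using int by (auto simp: integral_over_def)
  define D where "D n \<longleftrightarrow> (\<exists>f\<in>polys_over R. f \<noteq> 0 \<and> poly f (a j) = 0 \<and> degree f = n)" for n
  have "D (degree Q)" using Q unfolding D_def by (intro bexI[of _ Q]) auto
  then have "D (LEAST n. D n)" by (rule LeastI)
  then obtain f where f: "f \<in> polys_over R" "f \<noteq> 0" "poly f (a j) = 0" "degree f = (LEAST n. D n)"
    by (auto simp: D_def)
  have min: "r = 0" if "r \<in> polys_over R" "poly r (a j) = 0" "r = 0 \<or> degree r < degree f" for r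
  proof (rule ccontr)
    assume "r \<noteq> 0"
    then have "D (degree r)" "degree r < (LEAST n. D n)" using that f by (auto simp: D_def)
    then show False using not_less_Least by blast
  qed
  define h where "h = lead_coeff f"
  have h: "h \<in> R" "h \<noteq> 0" using f(2) polys_overD[OF f(1)] by (auto simp: h_def)
  define \<phi> where "\<phi> = smult (1 / h) f"
  have \<phi>: "lead_coeff \<phi> = 1" "degree \<phi> = degree f" "poly \<phi> (a j) = 0" using h f by (auto simp: \<phi>_def h_def)
  have degf: "degree f \<noteq> 0"
  proof
    assume "degree f = 0"
    then obtain c where "f = [:c:]" by (metis degree_eq_zeroE)
    then show False using f by auto
  qed
  obtain k q r where kqr: "q \<in> polys_over R" "r \<in> polys_over R" "smult (h ^ k) Q = f * q + r" "r = 0 \<or> degree r < degree f"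
    using pseudo_division_over[OF R f(1,2) Q(1)] unfolding h_def by blast
  have "poly (f * q + r) (a j) = 0" unfolding kqr(3)[symmetric] using Q by simp
  then have "r = 0" using min kqr f by auto
  define \<gamma> where "\<gamma> = smult (h / h ^ k) q"
  have Qfac: "Q = \<phi> * \<gamma>"
  proof -
    have "\<phi> * \<gamma> = smult (1 / h ^ k) (f * q)" using h by (simp add: \<phi>_def \<gamma>_def)
    also have "\<dots> = smult (1 / h ^ k) (smult (h ^ k) Q)" using kqr(3) \<open>r = 0\<close> by simp
    finally show ?thesis using h by simp
  qed
  have \<gamma>: "lead_coeff \<gamma> = 1" using Q(2) \<phi>(1) unfolding Qfac lead_coeff_mult by simp
  have \<phi>R: "\<phi> \<in> polys_over R"
  proof (rule polys_overI)
    fix i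
    have "integral_over R (coeff \<phi> i)"
    proof (rule integral_over_if_in_valuation_rings[OF R])
      fix V :: "real set" assume V: "valuation_ring V" "R \<subseteq> V"
      have "\<phi> * \<gamma> \<in> polys_over V" using Q(1) polys_over_mono[OF V(2)] Qfac by auto
      then have "\<phi> \<in> polys_over V" using gauss_valuation[OF V(1) _ \<phi>(1) \<gamma>] by blast
      then show "coeff \<phi> i \<in> V" by (rule polys_overD)
    qed
    moreover have "h * coeff \<phi> i \<in> R" using h polys_overD[OF f(1)] by (simp add: \<phi>_def)
    ultimately obtain c where "c \<in> R" "c \<noteq> 0" "\<And>k. c * coeff \<phi> i ^ k \<in> R"
      using integral_almost_integral[OF R] h by blast
    then show "coeff \<phi> i \<in> R" using cic unfolding comp_int_closed_def by blast
  qed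
  obtain \<Phi> where \<Phi>: "upoly a j \<Phi> = \<phi>" using upoly_surj \<phi>R unfolding R_def by blast
  have dvd: "\<exists>\<Gamma>. F = \<Phi> * \<Gamma>" if F: "ev a F = 0" for F
  proof -
    have "\<phi> \<noteq> 0" using \<phi>(1) by auto
    then obtain k q r where kqr: "q \<in> polys_over R" "r \<in> polys_over R"
      "smult (lead_coeff \<phi> ^ k) (upoly a j F) = \<phi> * q + r" "r = 0 \<or> degree r < degree \<phi>"
      using pseudo_division_over[OF R \<phi>R, of "upoly a j F"] upoly_in[of a j F] unfolding R_def by blast
    have e: "upoly a j F = \<phi> * q + r" using kqr(3) \<phi>(1) by simp
    have "poly (\<phi> * q + r) (a j) = 0" unfolding e[symmetric] using F by (simp add: poly_upoly)
    then have "r = 0" using min kqr \<phi> by auto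
    obtain \<Gamma> where "upoly a j \<Gamma> = q" using upoly_surj kqr(1) unfolding R_def by blast
    then have "upoly a j (F - \<Phi> * \<Gamma>) = 0" using e \<open>r = 0\<close> \<Phi> by (simp add: upoly_diff upoly_mult)
    then have "F - \<Phi> * \<Gamma> = 0" by (rule upoly_inj[OF indep])
    then show ?thesis by auto
  qed
  obtain \<Gamma> where \<Gamma>: "P = \<Phi> * \<Gamma>" using dvd[OF P] by blast
  have "\<not> \<Phi> dvd 1"
  proof
    assume "\<Phi> dvd 1"
    then obtain \<Psi> where "1 = \<Phi> * \<Psi>" by (auto elim: dvdE)
    then have "1 = \<phi> * upoly a j \<Psi>" using \<Phi> by (metis upoly_1 upoly_mult)
    then have "\<phi> dvd 1" by (metis dvd_triv_left)
    then have "degree \<phi> = 0" using dvd_imp_degree_le[of \<phi> 1] by simp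
    then show False using degf \<phi> by simp
  qed
  then have "\<Gamma> dvd 1" using irr \<Gamma> by (auto dest: irreducibleD)
  then obtain \<Psi> where "1 = \<Gamma> * \<Psi>" by (auto elim: dvdE)
  then have "\<Phi> = P * \<Psi>" using \<Gamma> by (metis mult.assoc mult.right_neutral)
  moreover obtain \<Gamma>' where "F = \<Phi> * \<Gamma>'" using dvd[OF F] by blast
  ultimately show ?thesis by (metis dvd_mult2 dvd_triv_left)
qed

text \<open>Integrality gives a multiple \<open>Q\<close> of \<open>P\<close> that is monic in
  variable \<open>i\<close>. Setting the other variables to 0 leaves of the homogeneous
  \<open>P\<close> only its pure power, whose coefficient then divides the leading coefficient
  1.\<close>

theorem pure_power_coeff:
  fixes a :: "'n::finite \<Rightarrow> real"
  assumes P: "homogeneous P" and dvd: "\<And>F. ev a F = 0 \<Longrightarrow> P dvd F"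
    and int: "integral_over (gen_ring a (UNIV - {i})) (a i)"
  shows "Poly_Mapping.lookup P (Poly_Mapping.single i (total_degree P)) \<in> {1, -1}"
proof -
  define d where "d = total_degree P"
  obtain f where f: "f \<in> polys_over (gen_ring a (UNIV - {i}))" "lead_coeff f = 1" "poly f (a i) = 0"
    using int by (auto simp: integral_over_def)
  define n where "n = degree f"
  have "\<exists>G. varsin (UNIV - {i}) G \<and> ev a G = coeff f k" for k
    using polys_overD[OF f(1), of k] by (auto simp: gen_ring_def)
  then obtain G where G: "\<And>k. varsin (UNIV - {i}) (G k)" "\<And>k. ev a (G k) = coeff f k" by metis
  \<comment> \<open>The leading coefficient is lifted to the polynomial 1 and not just to some
    polynomial with value 1 at \<open>a\<close>, so that it stays 1 when the variables are set to
    0.\<close>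
  define H where "H = G(n := 1)"
  have H: "varsin (UNIV - {i}) (H k)" "ev a (H k) = coeff f k" for k
    using G f(2) by (auto simp: H_def n_def)
  define Q where "Q = (\<Sum>k\<le>n. H k * mvar i ^ k)"
  have "ev a Q = poly f (a i)" by (simp add: Q_def ev_sum ev_mult ev_power H poly_altdef n_def)
  then have "P dvd Q" using dvd f(3) by simp
  then obtain S where S: "Q = P * S" by (auto elim: dvdE)
  define z :: "'n \<Rightarrow> int" where "z = (\<lambda>_. 0)"
  have uQ: "upoly z i Q = (\<Sum>k\<le>n. monom (ev z (H k)) k)"
    unfolding Q_def using H(1) by (intro upoly_expand)
  have "coeff (upoly z i Q) n = 1" by (simp add: uQ coeff_sum H_def)
  moreover have "degree (upoly z i Q) \<le> n"
    unfolding uQ by (intro degree_sum_le) (auto intro: order.trans[OF degree_monom_le])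
  ultimately have lQ: "lead_coeff (upoly z i Q) = 1"
    by (metis le_antisym le_degree zero_neq_one)
  let ?s = "Poly_Mapping.single i d"
  let ?c = "Poly_Mapping.lookup P ?s"
  have uP: "upoly z i P = monom ?c d"
  proof -
    have tm: "(\<Prod>j\<in>UNIV. (if j = i then [:0, 1:] else [:z j:]) ^ Poly_Mapping.lookup m j) =
        (if m = ?s then monom 1 d else 0 :: int poly)" if m: "m \<in> Poly_Mapping.keys P" for m
    proof (cases "m = ?s")
      case True
      have "(\<Prod>j\<in>UNIV. (if j = i then [:0, 1:] else [:z j:]) ^ Poly_Mapping.lookup ?s j) =
         (\<Prod>j\<in>UNIV. if j = i then monom 1 d else (1 :: int poly))"
        by (intro prod.cong) (auto simp: lookup_single monom_altdef)
      then show ?thesis using True by simp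
    next
      case False
      have "\<exists>j. j \<noteq> i \<and> Poly_Mapping.lookup m j \<noteq> 0"
      proof (rule ccontr)
        assume "\<not> ?thesis"
        then have z: "\<And>j. j \<noteq> i \<Longrightarrow> Poly_Mapping.lookup m j = 0" by blast
        then have e: "m = Poly_Mapping.single i (Poly_Mapping.lookup m i)"
          by (intro poly_mapping_eqI) (auto simp: lookup_single when_def)
        have "monom_degree m = (\<Sum>j\<in>{i}. Poly_Mapping.lookup m j)"
          unfolding monom_degree_def using z by (intro sum.mono_neutral_left) (auto simp: in_keys_iff)
        then have "Poly_Mapping.lookup m i = d" using P m unfolding homogeneous_def d_def by simp
        then show False using False e by simp
      qed
      then obtain j where "j \<noteq> i" "Poly_Mapping.lookup m j \<noteq> 0" by blast
      then have "(if j = i then [:0, 1:] else [:z j:]) ^ Poly_Mapping.lookup m j = (0 :: int poly)"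
        by (simp add: z_def)
      then have "(\<Prod>j\<in>UNIV. (if j = i then [:0, 1:] else [:z j:]) ^ Poly_Mapping.lookup m j) = (0 :: int poly)"
        by (intro prod_zero[OF finite] bexI[of _ j]) (assumption | rule UNIV_I)+
      then show ?thesis using False by simp
    qed
    have "upoly z i P = (\<Sum>m\<in>Poly_Mapping.keys P. if m = ?s then of_int ?c * monom 1 d else 0)"
      unfolding upoly_def ev_def by (intro sum.cong refl) (auto simp: tm)
    also have "\<dots> = of_int ?c * monom 1 d" by (simp add: in_keys_iff)
    also have "\<dots> = monom ?c d" by (simp add: of_int_poly smult_monom)
    finally show ?thesis .
  qed
  have "upoly z i Q = monom ?c d * upoly z i S" by (simp add: S upoly_mult uP)
  then have "lead_coeff (monom ?c d) * lead_coeff (upoly z i S) = 1"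
    using lQ by (metis lead_coeff_mult)
  moreover have "lead_coeff (monom ?c d) = ?c" by (cases "?c = 0") (simp_all add: degree_monom_eq)
  ultimately have "?c dvd 1" by (metis dvd_triv_left)
  then show ?thesis unfolding d_def by (auto simp: zdvd1_eq abs_if split: if_splits)
qed

section \<open>Integrality of the areas\<close>

text \<open>Comparison of absolute values without a value group: \<open>vle V x 1\<close> means
  \<open>x \<in> V\<close>, and since the order is total its negation \<open>vlt\<close> is the
  strict comparison.\<close>

definition vle :: "'k::field set \<Rightarrow> 'k \<Rightarrow> 'k \<Rightarrow> bool" where
  "vle V x y \<longleftrightarrow> (\<exists>c\<in>V. x = c * y)"

abbreviation vlt :: "'k::field set \<Rightarrow> 'k \<Rightarrow> 'k \<Rightarrow> bool" where
  "vlt V x y \<equiv> \<not> vle V y x"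

context
  fixes V :: "'k::field set"
  assumes V: "valuation_ring V"
begin

private lemma S: "subring_set V" using V by (simp add: valuation_ring_def)

lemma vle_refl: "vle V x x"
  using subring_1[OF S] by (auto simp: vle_def)

lemma vle_trans: "vle V x y \<Longrightarrow> vle V y z \<Longrightarrow> vle V x z"
  using subring_mult[OF S] by (fastforce simp: vle_def mult.assoc[symmetric])

lemma vle_total: "vle V x y \<or> vle V y x"
proof (cases "x = 0 \<or> y = 0")
  case True
  then show ?thesis using subring_0[OF S] by (auto simp: vle_def)
next
  case False
  have "x / y \<in> V \<or> inverse (x / y) \<in> V" using V by (auto simp: valuation_ring_def)
  then have "x / y \<in> V \<or> y / x \<in> V" by simp
  then show ?thesis using False by (auto simp: vle_def intro: bexI[where x = "x / y"] bexI[where x = "y / x"])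
qed

lemma vle_mult: "vle V x y \<Longrightarrow> vle V x' y' \<Longrightarrow> vle V (x * x') (y * y')"
proof -
  assume "vle V x y" "vle V x' y'"
  then obtain c c' where c: "c \<in> V" "x = c * y" "c' \<in> V" "x' = c' * y'" by (auto simp: vle_def)
  then have "x * x' = (c * c') * (y * y')" by simp
  then show "vle V (x * x') (y * y')" using subring_mult[OF S] c unfolding vle_def by blast
qed

lemma vle_add: "vle V x z \<Longrightarrow> vle V y z \<Longrightarrow> vle V (x + y) z"
  using subring_add[OF S] by (auto simp: vle_def distrib_right[symmetric])

lemma vlt_add:
  assumes "vlt V x z" "vlt V y z" shows "vlt V (x + y) z"
proof
  assume z: "vle V z (x + y)"
  have "vle V x y \<or> vle V y x" by (rule vle_total)
  then have "vle V (x + y) y \<or> vle V (x + y) x" using vle_add vle_refl by blast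
  then show False using z vle_trans assms by blast
qed

lemma vlt_uminus: "vlt V (- x) y \<longleftrightarrow> vlt V x y"
  using subring_uminus[OF S] by (fastforce simp: vle_def)

lemma vlt_sum: "z \<noteq> 0 \<Longrightarrow> (\<And>i. i \<in> A \<Longrightarrow> vlt V (f i) z) \<Longrightarrow> vlt V (sum f A) z"
proof (induction A rule: infinite_finite_induct)
  case (insert x A)
  then show ?case using vlt_add by auto
qed (auto simp: vle_def)

lemma vlt_imp_vle: "vlt V x y \<Longrightarrow> vle V x y"
  using vle_total by blast

lemma vlt_vle_trans: "vlt V x y \<Longrightarrow> vle V y z \<Longrightarrow> vlt V x z"
  using vle_trans by blast

lemma vlt_nonzero: "vlt V x y \<Longrightarrow> y \<noteq> 0"
  using subring_0[OF S] by (auto simp: vle_def)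

lemma vlt_mult:
  assumes "vlt V x y" "vle V x' y'" "y' \<noteq> 0" shows "vlt V (x * x') (y * y')"
proof
  assume "vle V (y * y') (x * x')"
  moreover have "vle V (x * x') (x * y')" by (rule vle_mult[OF vle_refl assms(2)])
  ultimately have "vle V (y * y') (x * y')" by (rule vle_trans)
  then obtain c where "c \<in> V" "y * y' = c * (x * y')" by (auto simp: vle_def)
  then have "y = c * x" using assms(3) by simp
  then show False using assms(1) \<open>c \<in> V\<close> by (auto simp: vle_def)
qed

lemma vlt_0_1: "vlt V 0 1"
  by (simp add: vle_def)

text \<open>The colouring of the plane from Monsky's theorem. Ties between the coordinates go to
  colour 1, which decides the colour of the corner \<open>(1, 1)\<close> of the unit square.\<close>

definition colour :: "'k \<Rightarrow> 'k \<Rightarrow> nat" where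
  "colour x y = (if vlt V x 1 \<and> vlt V y 1 then 0 else if vle V y x then 1 else 2)"

lemma colour_cases:
  "colour x y = 0 \<Longrightarrow> vlt V x 1 \<and> vlt V y 1"
  "colour x y = 1 \<Longrightarrow> vle V y x \<and> vle V 1 x"
  "colour x y = 2 \<Longrightarrow> vlt V x y \<and> vle V 1 y"
proof -
  show "colour x y = 0 \<Longrightarrow> vlt V x 1 \<and> vlt V y 1" by (simp add: colour_def split: if_splits)
  assume "colour x y = 1"
  then have "vle V y x" "vle V 1 x \<or> vle V 1 y" by (auto simp: colour_def split: if_splits)
  then show "vle V y x \<and> vle V 1 x" using vle_trans by blast
next
  assume "colour x y = 2"
  then have "vlt V x y" "vle V 1 x \<or> vle V 1 y" by (auto simp: colour_def split: if_splits)
  then show "vlt V x y \<and> vle V 1 y" using vle_trans vlt_imp_vle by blast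
qed

text \<open>In the expanded determinant the product \<open>x1 * y2\<close> is at least 1 and
  strictly larger than each of the five other products.\<close>

lemma rainbow_large:
  assumes c0: "colour x0 y0 = 0" and c1: "colour x1 y1 = 1" and c2: "colour x2 y2 = 2"
  shows "vle V 1 ((x1 - x0) * (y2 - y0) - (x2 - x0) * (y1 - y0))"
proof -
  note c = colour_cases(1)[OF c0] colour_cases(2)[OF c1] colour_cases(3)[OF c2]
  have n: "x1 \<noteq> 0" "y2 \<noteq> 0" using c vlt_nonzero vlt_0_1 vle_trans vlt_vle_trans by blast+
  have l: "vlt V x0 x1" "vlt V y0 y2" "vlt V x0 y2" "vlt V y0 x1" "vlt V x2 y2" "vle V y1 x1"
    using c vlt_vle_trans by blast+
  have t1: "vlt V (y0 * x1) (y2 * x1)" using l n vle_refl by (intro vlt_mult) auto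
  have t2: "vlt V (x0 * y2) (x1 * y2)" using l n vle_refl by (intro vlt_mult) auto
  have t3: "vlt V (x2 * y1) (y2 * x1)" using l n by (intro vlt_mult) auto
  have t4: "vlt V (x2 * y0) (y2 * x1)" using l n vlt_imp_vle by (intro vlt_mult) auto
  have t5: "vlt V (x0 * y1) (y2 * x1)" using l n by (intro vlt_mult) auto
  define w where "w = y2 * x1"
  have t: "vlt V (y0 * x1) w" "vlt V (x0 * y2) w" "vlt V (x2 * y1) w" "vlt V (- (x2 * y0)) w" "vlt V (- (x0 * y1)) w"
    using t1 t2 t3 t4 t5 by (auto simp: w_def vlt_uminus mult.commute)
  define N where "N = (x1 - x0) * (y2 - y0) - (x2 - x0) * (y1 - y0)"
  have "vle V w N"
  proof (rule ccontr)
    assume "vlt V N w"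
    then have "vlt V (N + (y0 * x1) + (x0 * y2) + (x2 * y1) + (- (x2 * y0)) + (- (x0 * y1))) w"
      using t by (intro vlt_add)
    moreover have "N + (y0 * x1) + (x0 * y2) + (x2 * y1) + (- (x2 * y0)) + (- (x0 * y1)) = w"
      by (simp add: N_def w_def algebra_simps)
    ultimately show False using vle_refl by simp
  qed
  moreover have "vle V (1 * 1) (y2 * x1)" using c by (intro vle_mult) auto
  ultimately show ?thesis using vle_trans unfolding w_def N_def by simp
qed

end

section \<open>Sperner's lemma and the areas in a parallelogram\<close>

definition tri_sum :: "('a \<Rightarrow> 'a \<Rightarrow> real) \<Rightarrow> 'a \<times> 'a \<times> 'a \<Rightarrow> real" where
  "tri_sum \<kappa> t = (case t of (a, b, c) \<Rightarrow> \<kappa> a b + \<kappa> b c + \<kappa> c a)"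

text \<open>A discrete Stokes formula. It is stated for all antisymmetric \<kappa> because two of
  them are used: half the cross product, for the total area, and a signed count of coloured edges,
  for Sperner's lemma.\<close>

definition chain_boundary :: "('n::finite \<Rightarrow> 'a \<times> 'a \<times> 'a) \<Rightarrow> 'a \<Rightarrow> 'a \<Rightarrow> 'a \<Rightarrow> 'a \<Rightarrow> bool" where
  "chain_boundary ori p q r s \<longleftrightarrow> (\<forall>\<kappa>. (\<forall>x y. \<kappa> y x = - \<kappa> x y) \<longrightarrow>
     (\<Sum>i\<in>UNIV. tri_sum \<kappa> (ori i)) = \<kappa> p q + \<kappa> q r + \<kappa> r s + \<kappa> s p)"

lemma chain_boundary_rotate:
  fixes ori :: "'n::finite \<Rightarrow> 'a \<times> 'a \<times> 'a"
  shows "chain_boundary ori p q r s \<Longrightarrow> chain_boundary ori q r s p"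
  unfolding chain_boundary_def
proof (intro allI impI)
  fix \<kappa> :: "'a \<Rightarrow> 'a \<Rightarrow> real"
  assume cb: "\<forall>\<kappa>. (\<forall>x y. \<kappa> y x = - \<kappa> x y) \<longrightarrow>
     (\<Sum>i\<in>UNIV. tri_sum \<kappa> (ori i)) = \<kappa> p q + \<kappa> q r + \<kappa> r s + \<kappa> s p" and k: "\<forall>x y. \<kappa> y x = - \<kappa> x y"
  show "(\<Sum>i\<in>UNIV. tri_sum \<kappa> (ori i)) = \<kappa> q r + \<kappa> r s + \<kappa> s p + \<kappa> p q"
    using mp[OF spec[OF cb] k] by linarith
qed

definition crs :: "real^2 \<Rightarrow> real^2 \<Rightarrow> real" where
  "crs u v = u$1 * v$2 - u$2 * v$1"

lemma signed_area_tri_sum: "signed_area \<rho> t = tri_sum (\<lambda>x y. crs (\<rho> x) (\<rho> y) / 2) t"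
  by (cases t) (simp add: tri_sum_def crs_def field_simps)

lemma total_area:
  assumes "chain_boundary ori p q r s" "parallelogram_drawing p q r s \<rho>"
  shows "(\<Sum>i\<in>UNIV. signed_area \<rho> (ori i)) = crs (\<rho> q - \<rho> p) (\<rho> s - \<rho> p)"
proof -
  have r: "\<rho> r = \<rho> q + \<rho> s - \<rho> p" using assms(2) by (simp add: parallelogram_drawing_def algebra_simps)
  have "(\<Sum>i\<in>UNIV. signed_area \<rho> (ori i)) = (\<Sum>i\<in>UNIV. tri_sum (\<lambda>x y. crs (\<rho> x) (\<rho> y) / 2) (ori i))"
    by (simp add: signed_area_tri_sum)
  also have "\<dots> = (crs (\<rho> p) (\<rho> q) + crs (\<rho> q) (\<rho> r) + crs (\<rho> r) (\<rho> s) + crs (\<rho> s) (\<rho> p)) / 2"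
    using assms(1) by (subst assms(1)[unfolded chain_boundary_def, rule_format]) (auto simp: crs_def field_simps)
  also have "\<dots> = crs (\<rho> q - \<rho> p) (\<rho> s - \<rho> p)"
    by (simp add: r crs_def field_simps)
  finally show ?thesis .
qed

text \<open>In affine coordinates that make the parallelogram a unit square the corners have colours
  0, 1, 1, 2, and Sperner's count yields a triangle with all three colours. Its area is at least the
  total area, which is at least the area of triangle \<open>i\<close>. So it is triangle
  \<open>i\<close>, and its vertex of colour 0 lies near \<open>p\<close>.\<close>

lemma corner_in_large_triangle:
  fixes \<rho> :: "'a \<Rightarrow> real^2" and ori :: "'n::finite \<Rightarrow> 'a \<times> 'a \<times> 'a"
  defines "A \<equiv> \<lambda>p q s. crs (\<rho> q - \<rho> p) (\<rho> s - \<rho> p)"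
  assumes cb: "chain_boundary ori p q r s" and par: "parallelogram_drawing p q r s \<rho>"
    and V: "valuation_ring V" and i: "signed_area \<rho> (ori i) \<noteq> 0"
    and small: "\<And>j. j \<noteq> i \<Longrightarrow> vlt V (signed_area \<rho> (ori j)) (signed_area \<rho> (ori i))"
    and abc: "ori i = (a, b, c)"
  shows "\<exists>w\<in>{a, b, c}. vlt V (crs (\<rho> w - \<rho> p) (\<rho> s - \<rho> p) / A p q s) 1 \<and> vlt V (crs (\<rho> q - \<rho> p) (\<rho> w - \<rho> p) / A p q s) 1"
proof -
  define ar where "ar j = signed_area \<rho> (ori j)" for j
  define AA where "AA = A p q s"
  have r: "\<rho> r = \<rho> q + \<rho> s - \<rho> p" using par by (simp add: parallelogram_drawing_def algebra_simps)
  have tot: "AA = ar i + (\<Sum>j\<in>UNIV - {i}. ar j)"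
    using total_area[OF cb par] by (simp add: AA_def A_def ar_def sum.remove[of UNIV i])
  \<comment> \<open>A sum cannot be smaller than a term that dominates all the others.\<close>
  have vA: "vle V (ar i) AA"
  proof (rule ccontr)
    assume "vlt V AA (ar i)"
    moreover have "vlt V (- (\<Sum>j\<in>UNIV - {i}. ar j)) (ar i)"
      unfolding vlt_uminus[OF V] using small i by (intro vlt_sum[OF V]) (auto simp: ar_def)
    ultimately have "vlt V (AA + - (\<Sum>j\<in>UNIV - {i}. ar j)) (ar i)" by (rule vlt_add[OF V])
    then show False using tot vle_refl[OF V] by simp
  qed
  have A0: "AA \<noteq> 0" using vA i by (auto simp: vle_def ar_def)
  define X where "X w = crs (\<rho> w - \<rho> p) (\<rho> s - \<rho> p) / AA" for w
  define Y where "Y w = crs (\<rho> q - \<rho> p) (\<rho> w - \<rho> p) / AA" for w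
  define col where "col w = colour V (X w) (Y w)" for w
  \<comment> \<open>Signed count of edges from colour 1 to colour 2. On the boundary only
    \<open>r s\<close> contributes, and a triangle contributes only if it carries all three
    colours.\<close>
  define \<kappa> :: "'a \<Rightarrow> 'a \<Rightarrow> real" where
    "\<kappa> x y = of_bool (col x = 1 \<and> col y = 2) - of_bool (col y = 1 \<and> col x = 2)" for x y
  have z1: "vlt V 0 1" using vlt_0_1[OF V] .
  have o1: "vle V 1 1" using vle_refl[OF V] .
  have z1': "vle V 0 1" using vlt_imp_vle[OF V z1] .
  have XY: "X p = 0" "Y p = 0" "X q = 1" "Y q = 0" "X r = 1" "Y r = 1" "X s = 0" "Y s = 1"
    using A0 unfolding X_def Y_def AA_def A_def r by (simp_all add: crs_def field_simps)
  have col: "col p = 0" "col q = 1" "col r = 1" "col s = 2"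
    using z1 o1 z1' by (simp_all add: col_def XY colour_def V)
  have "(\<Sum>j\<in>UNIV. tri_sum \<kappa> (ori j)) = \<kappa> p q + \<kappa> q r + \<kappa> r s + \<kappa> s p"
    by (rule cb[unfolded chain_boundary_def, rule_format]) (simp add: \<kappa>_def)
  also have "\<dots> = 1" by (simp add: \<kappa>_def col)
  finally have "\<exists>j. tri_sum \<kappa> (ori j) \<noteq> 0" by (metis (mono_tags, lifting) sum.neutral zero_neq_one)
  then obtain j where j: "tri_sum \<kappa> (ori j) \<noteq> 0" by blast
  obtain u v w where uvw: "ori j = (u, v, w)" by (cases "ori j") auto
  have col3: "col x \<in> {0, 1, 2}" for x by (simp add: col_def colour_def V)
  have rainbow: "{col u, col v, col w} = {0, 1, 2}"
    using j col3[of u] col3[of v] col3[of w] by (auto simp: uvw tri_sum_def \<kappa>_def)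
  define N where "N u v w = (X v - X u) * (Y w - Y u) - (X w - X u) * (Y v - Y u)" for u v w
  have N: "2 * ar j = N u v w * AA"
  proof -
    have "N u v w * AA * AA = (X v * AA - X u * AA) * (Y w * AA - Y u * AA) - (X w * AA - X u * AA) * (Y v * AA - Y u * AA)"
      by (simp add: N_def algebra_simps)
    also have "\<dots> = (crs (\<rho> v - \<rho> p) (\<rho> s - \<rho> p) - crs (\<rho> u - \<rho> p) (\<rho> s - \<rho> p)) * (crs (\<rho> q - \<rho> p) (\<rho> w - \<rho> p) - crs (\<rho> q - \<rho> p) (\<rho> u - \<rho> p))
       - (crs (\<rho> w - \<rho> p) (\<rho> s - \<rho> p) - crs (\<rho> u - \<rho> p) (\<rho> s - \<rho> p)) * (crs (\<rho> q - \<rho> p) (\<rho> v - \<rho> p) - crs (\<rho> q - \<rho> p) (\<rho> u - \<rho> p))"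
      using A0 by (simp add: X_def Y_def)
    also have "\<dots> = 2 * ar j * AA"
      by (simp add: ar_def uvw AA_def A_def crs_def) algebra
    finally show ?thesis using A0 by simp
  qed
  have N1: "vle V 1 (N u v w)"
  proof -
    have large: "vle V 1 (N x y z)" if "col x = 0" "col y = 1" "col z = 2" for x y z
      unfolding N_def using that by (intro rainbow_large[OF V]) (auto simp: col_def)
    have neg: "vle V 1 (- t)" if t: "vle V 1 t" for t 
    proof -
      obtain k where "k \<in> V" "1 = k * t" using t by (auto simp: vle_def)
      moreover have "subring_set V" using V by (simp add: valuation_ring_def)
      ultimately show ?thesis unfolding vle_def by (intro bexI[of _ "- k"] subring_uminus) auto
    qed
    have perm: "N u v w = N v w u" "N u v w = N w u v" "N u v w = - N u w v" "N u v w = - N v u w" "N u v w = - N w v u"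
      unfolding N_def by algebra+
    have "0 \<in> {col u, col v, col w}" "1 \<in> {col u, col v, col w}" "2 \<in> {col u, col v, col w}"
      unfolding rainbow by simp_all
    then have "(col u, col v, col w) \<in> {(0, 1, 2), (0, 2, 1), (1, 0, 2), (1, 2, 0), (2, 0, 1), (2, 1, 0)}"
      by (elim insertE emptyE) simp_all
    then consider "col u = 0" "col v = 1" "col w = 2" | "col u = 0" "col v = 2" "col w = 1" | "col u = 1" "col v = 0" "col w = 2"
      | "col u = 1" "col v = 2" "col w = 0" | "col u = 2" "col v = 0" "col w = 1" | "col u = 2" "col v = 1" "col w = 0"
      by (elim insertE emptyE) simp_all
    then show ?thesis
    proof cases
      case 1 then show ?thesis using large by blast
    next
      case 2 then show ?thesis using neg[OF large[of u w v]] perm by simp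
    next
      case 3 then show ?thesis using neg[OF large[of v u w]] perm by simp
    next
      case 4 then show ?thesis using large[of w u v] perm by simp
    next
      case 5 then show ?thesis using large[of v w u] perm by simp
    next
      case 6 then show ?thesis using neg[OF large[of w v u]] perm by simp
    qed
  qed
  have "vle V AA (2 * ar j)"
    using vle_mult[OF V N1 vle_refl[OF V, of AA]] N by simp
  \<comment> \<open>The factor between determinant and area is an integer, hence in
    \<open>V\<close>.\<close>
  moreover have "vle V (2 * ar j) (ar j)"
  proof -
    have "subring_set V" using V by (simp add: valuation_ring_def)
    then have "(1 + 1) \<in> V" by (intro subring_add subring_1)
    then show ?thesis unfolding vle_def by (intro bexI[of _ "1 + 1"]) auto
  qed
  ultimately have "vle V (ar i) (ar j)" using vA vle_trans[OF V] by blast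
  then have "j = i" using small[of j] by (auto simp: ar_def)
  then have "{col a, col b, col c} = {0, 1, 2}" using rainbow uvw abc by simp
  then have "0 \<in> {col a, col b, col c}" by simp
  then obtain w where "w \<in> {a, b, c}" "col w = 0" by auto
  then show ?thesis using colour_cases(1)[OF V, of "X w" "Y w"] unfolding col_def X_def Y_def AA_def by blast
qed

text \<open>A triangle dominating all others in a valuation would have a vertex near each of the four corners.\<close>
lemma no_dominating_triangle:
  fixes \<rho> :: "'a \<Rightarrow> real^2" and ori :: "'n::finite \<Rightarrow> 'a \<times> 'a \<times> 'a"
  assumes cb: "chain_boundary ori p q r s" and par: "parallelogram_drawing p q r s \<rho>"
    and V: "valuation_ring V" and i: "signed_area \<rho> (ori i) \<noteq> 0"
    and small: "\<And>j. j \<noteq> i \<Longrightarrow> vlt V (signed_area \<rho> (ori j)) (signed_area \<rho> (ori i))"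
  shows False
proof -
  obtain a b c where abc: "ori i = (a, b, c)" by (cases "ori i") auto
  define A where "A = crs (\<rho> q - \<rho> p) (\<rho> s - \<rho> p)"
  have rr: "\<rho> r = \<rho> q + \<rho> s - \<rho> p" using par by (simp add: parallelogram_drawing_def algebra_simps)
  have par2: "parallelogram_drawing q r s p \<rho>" and par3: "parallelogram_drawing r s p q \<rho>"
    and par4: "parallelogram_drawing s p q r \<rho>"
    using par by (auto simp: parallelogram_drawing_def algebra_simps)
  note cb2 = chain_boundary_rotate[OF cb] note cb3 = chain_boundary_rotate[OF cb2] note cb4 = chain_boundary_rotate[OF cb3]
  define X where "X w = crs (\<rho> w - \<rho> p) (\<rho> s - \<rho> p) / A" for w
  define Y where "Y w = crs (\<rho> q - \<rho> p) (\<rho> w - \<rho> p) / A" for w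
  \<comment> \<open>Otherwise the dominating area would be minus a sum of smaller ones.\<close>
  have A0: "A \<noteq> 0"
  proof
    assume "A = 0"
    then have "(\<Sum>j\<in>UNIV. signed_area \<rho> (ori j)) = 0" using total_area[OF cb par] by (simp add: A_def)
    then have "signed_area \<rho> (ori i) = - (\<Sum>j\<in>UNIV - {i}. signed_area \<rho> (ori j))"
      by (simp add: sum.remove[of UNIV i] eq_neg_iff_add_eq_0)
    moreover have "vlt V (- (\<Sum>j\<in>UNIV - {i}. signed_area \<rho> (ori j))) (signed_area \<rho> (ori i))"
      unfolding vlt_uminus[OF V] using small i by (intro vlt_sum[OF V]) auto
    ultimately show False using vle_refl[OF V] by simp
  qed
  have A_eq: "crs (\<rho> r - \<rho> q) (\<rho> p - \<rho> q) = A" "crs (\<rho> s - \<rho> r) (\<rho> q - \<rho> r) = A" "crs (\<rho> p - \<rho> s) (\<rho> r - \<rho> s) = A"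
    by (simp_all add: A_def rr crs_def algebra_simps)
  \<comment> \<open>Seen from the other corners, the affine coordinates are \<open>X\<close> and
    \<open>Y\<close>, possibly exchanged or replaced by one minus themselves.\<close>
  have c2: "crs (\<rho> w - \<rho> q) (\<rho> p - \<rho> q) / A = Y w" "crs (\<rho> r - \<rho> q) (\<rho> w - \<rho> q) / A = 1 - X w" for w
    using A0 unfolding X_def Y_def by (simp_all add: field_simps) (simp_all add: A_def rr crs_def algebra_simps)
  have c3: "crs (\<rho> w - \<rho> r) (\<rho> q - \<rho> r) / A = 1 - X w" "crs (\<rho> s - \<rho> r) (\<rho> w - \<rho> r) / A = 1 - Y w" for w
    using A0 unfolding X_def Y_def by (simp_all add: field_simps) (simp_all add: A_def rr crs_def algebra_simps)
  have c4: "crs (\<rho> w - \<rho> s) (\<rho> r - \<rho> s) / A = 1 - Y w" "crs (\<rho> p - \<rho> s) (\<rho> w - \<rho> s) / A = X w" for w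
    using A0 unfolding X_def Y_def by (simp_all add: field_simps) (simp_all add: A_def rr crs_def algebra_simps)
  obtain w1 where w1: "w1 \<in> {a, b, c}" "vlt V (X w1) 1" "vlt V (Y w1) 1"
    using corner_in_large_triangle[OF cb par V i small abc] unfolding X_def Y_def A_def by blast
  obtain w2 where w2: "w2 \<in> {a, b, c}" "vlt V (Y w2) 1" "vlt V (1 - X w2) 1"
    using corner_in_large_triangle[OF cb2 par2 V i small abc] unfolding A_eq c2 by blast
  obtain w3 where w3: "w3 \<in> {a, b, c}" "vlt V (1 - X w3) 1" "vlt V (1 - Y w3) 1"
    using corner_in_large_triangle[OF cb3 par3 V i small abc] unfolding A_eq c3 by blast
  obtain w4 where w4: "w4 \<in> {a, b, c}" "vlt V (1 - Y w4) 1" "vlt V (X w4) 1"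
    using corner_in_large_triangle[OF cb4 par4 V i small abc] unfolding A_eq c4 by blast
  \<comment> \<open>\<open>t\<close> and \<open>1 - t\<close> add up to 1, so they are not both
    smaller than 1. Hence the vertices found near the four corners are distinct, one too many for a
    triangle.\<close>
  have no: "\<not> (vlt V t 1 \<and> vlt V (1 - t) 1)" for t
    using vlt_add[OF V, of 1 t "1 - t"] vle_refl[OF V, of 1] by auto
  have "w1 \<noteq> w2" "w1 \<noteq> w3" "w1 \<noteq> w4" "w2 \<noteq> w3" "w2 \<noteq> w4" "w3 \<noteq> w4"
    using w1 w2 w3 w4 no by blast+
  then show False using w1(1) w2(1) w3(1) w4(1) by auto
qed

text \<open>In a valuation ring that contains the other areas but not this one, this area would
  dominate all the others.\<close>

theorem area_integral:
  fixes \<rho> :: "'a \<Rightarrow> real^2" and ori :: "'n::finite \<Rightarrow> 'a \<times> 'a \<times> 'a"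
  assumes cb: "chain_boundary ori p q r s" and par: "parallelogram_drawing p q r s \<rho>"
  defines "ar \<equiv> \<lambda>i. signed_area \<rho> (ori i)"
  shows "integral_over (gen_ring ar (UNIV - {i})) (ar i)"
proof (rule integral_over_if_in_valuation_rings[OF subring_gen_ring])
  fix V :: "real set" assume V: "valuation_ring V" and RV: "gen_ring ar (UNIV - {i}) \<subseteq> V"
  have S: "subring_set V" using V by (simp add: valuation_ring_def)
  show "ar i \<in> V"
  proof (rule ccontr)
    assume n: "ar i \<notin> V"
    have "vlt V (ar j) (ar i)" if "j \<noteq> i" for j
    proof
      assume "vle V (ar i) (ar j)"
      then obtain c where "c \<in> V" "ar i = c * ar j" by (auto simp: vle_def)
      moreover have "ar j \<in> V" using RV gen_ring_mem[of j "UNIV - {i}" ar] that by blast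
      ultimately show False using n subring_mult[OF S] by simp
    qed
    moreover have "ar i \<noteq> 0" using n subring_0[OF S] by auto
    ultimately show False using no_dominating_triangle[OF cb par V] unfolding ar_def by blast
  qed
qed

section \<open>Combinatorics of a triangulated quadrilateral\<close>

lemma face_of_triangleE:
  fixes C :: "'a::euclidean_space set"
  assumes "\<not> affine_dependent C" "F face_of convex hull C"
  obtains w where "w \<subseteq> C" "F = convex hull w"
  using assms face_of_convex_hull_affine_independent by metis

lemma convex_hull_affine_independent_eq:
  fixes C :: "'a::euclidean_space set"
  assumes "\<not> affine_dependent C" "\<not> affine_dependent D" "convex hull C = convex hull D"
  shows "C = D"
  using assms extreme_point_of_convex_hull_affine_independent[of C] extreme_point_of_convex_hull_affine_independent[of D]
  by auto

lemma affine_combination_unique: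
  fixes x y c :: "'a::euclidean_space"
  assumes ind: "\<not> affine_dependent {x, y, c}" and d: "x \<noteq> y" "y \<noteq> c" "x \<noteq> c"
    and z: "\<beta> *\<^sub>R (y - x) + \<gamma> *\<^sub>R (c - x) = 0"
  shows "\<beta> = 0 \<and> \<gamma> = 0"
proof -
  have nc: "\<not> collinear {y, x, c}"
    using ind d collinear_3_eq_affine_dependent[of y x c] by (auto simp: insert_commute)
  have g: "\<gamma> = 0"
  proof (rule ccontr)
    assume g: "\<gamma> \<noteq> 0"
    have "\<gamma> *\<^sub>R (c - x) = - (\<beta> *\<^sub>R (y - x))" using z by (simp add: eq_neg_iff_add_eq_0 add.commute)
    then have "(1 / \<gamma>) *\<^sub>R (\<gamma> *\<^sub>R (c - x)) = (1 / \<gamma>) *\<^sub>R (- (\<beta> *\<^sub>R (y - x)))" by simp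
    then have "c - x = (- \<beta> / \<gamma>) *\<^sub>R (y - x)" using g by simp
    then have "collinear {0, y - x, c - x}" unfolding collinear_lemma by blast
    then show False using nc collinear_3[of y x c] by simp
  qed
  then show ?thesis using z d by simp
qed

section \<open>The triangulated disk: purity, and the triangles at an edge\<close>

locale quad =
  fixes K :: "'a::euclidean_space set set" and p q r s :: 'a
    and \<Delta> :: "'n::finite \<Rightarrow> 'a set" and ori :: "'n \<Rightarrow> 'a \<times> 'a \<times> 'a"
  assumes quad: "quad_triangulation K p q r s"
    and bij: "bij_betw \<Delta> UNIV (complex_triangles K)"
    and ori: "boundary_orientation \<Delta> p q r s ori"
begin

lemma sc: "simplicial_complex K" and dist4: "distinct [p, q, r, s]"
  using quad by (auto simp: quad_triangulation_def)

definition X where "X = \<Union>K"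

definition chart :: "(real^2 \<Rightarrow> 'a) \<times> ('a \<Rightarrow> real^2) \<Rightarrow> bool" where
  "chart h \<longleftrightarrow> homeomorphism (cball 0 1) X (fst h) (snd h) \<and>
     fst h ` sphere 0 1 = closed_segment p q \<union> closed_segment q r \<union> closed_segment r s \<union> closed_segment s p"

definition "fg = (SOME h. chart h)"
definition "f = fst fg"
definition "g = snd fg"

lemma fg: "homeomorphism (cball 0 1) X f g"
    "f ` sphere 0 1 = closed_segment p q \<union> closed_segment q r \<union> closed_segment r s \<union> closed_segment s p"
proof -
  obtain f0 g0 where f0: "homeomorphism (cball (0 :: real^2) 1) X f0 g0"
    "f0 ` sphere 0 1 = closed_segment p q \<union> closed_segment q r \<union> closed_segment r s \<union> closed_segment s p"
  proof -
    from quad have "\<exists>f g. homeomorphism (cball (0 :: real^2) 1) X f g \<and> complex_vertices K \<inter> f ` sphere 0 1 = {p, q, r, s} \<and>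
       f ` sphere 0 1 = closed_segment p q \<union> closed_segment q r \<union> closed_segment r s \<union> closed_segment s p"
      unfolding quad_triangulation_def X_def by (elim conjE)
    then show thesis by (elim exE conjE) (rule that)
  qed
  then have "chart (f0, g0)" by (simp add: chart_def)
  then have "chart fg" unfolding fg_def by (rule someI)
  then show "homeomorphism (cball 0 1) X f g"
    "f ` sphere 0 1 = closed_segment p q \<union> closed_segment q r \<union> closed_segment r s \<union> closed_segment s p"
    by (auto simp: f_def g_def chart_def)
qed

lemma cont_f: "continuous_on (cball 0 1) f" and cont_g: "continuous_on X g"
  and fg_id: "\<And>x. x \<in> X \<Longrightarrow> f (g x) = x" and gf_id: "\<And>y. y \<in> cball 0 1 \<Longrightarrow> g (f y) = y"
  and g_in: "\<And>x. x \<in> X \<Longrightarrow> g x \<in> cball 0 1" and f_in: "\<And>y. y \<in> cball 0 1 \<Longrightarrow> f y \<in> X"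
  using fg(1) unfolding homeomorphism_def by blast+

lemma inj_g: "inj_on g X" and inj_f: "inj_on f (cball 0 1)"
  using fg_id gf_id by (metis inj_on_def)+

lemma finite_K: "finite K" and simplex_K: "S \<in> K \<Longrightarrow> \<exists>n. n simplex S"
  and face_K: "S \<in> K \<Longrightarrow> F face_of S \<Longrightarrow> F \<in> K"
  and Int_K: "S \<in> K \<Longrightarrow> T \<in> K \<Longrightarrow> (S \<inter> T) face_of S"
  using sc unfolding simplicial_complex_def by blast+

lemma K_hull:
  assumes "S \<in> K" obtains C where "finite C" "\<not> affine_dependent C" "S = convex hull C"
  using simplex_K[OF assms] aff_independent_finite by (metis simplex_def)

lemma K_convex: "S \<in> K \<Longrightarrow> convex S" and K_compact: "S \<in> K \<Longrightarrow> compact S"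
  by (metis K_hull convex_convex_hull, metis K_hull finite_imp_compact_convex_hull)

lemma K_closed: "S \<in> K \<Longrightarrow> closed S"
  using K_compact compact_imp_closed by blast

lemma K_sub: "S \<in> K \<Longrightarrow> S \<subseteq> X"
  by (auto simp: X_def)

text \<open>The open star of \<open>e\<close>, written as the complement of finitely many closed
  simplices so that its openness is immediate.\<close>

definition star where "star e = X - \<Union>{S \<in> K. \<not> e \<subseteq> S}"

lemma star_open: "openin (top_of_set X) (star e)"
proof -
  have "closed (\<Union>{S \<in> K. \<not> e \<subseteq> S})" using finite_K K_closed by (intro closed_Union) auto
  then show ?thesis unfolding star_def by (metis Diff_eq openin_open_Int open_Compl)
qed

lemma star_sub: "star e \<subseteq> \<Union>{S \<in> K. e \<subseteq> S}"
  by (auto simp: star_def X_def)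

lemma rel_interior_sub_K:
  assumes "e \<in> K" "S \<in> K" "x \<in> rel_interior e" "x \<in> S" shows "e \<subseteq> S"
proof -
  have "e \<inter> S face_of e" by (rule Int_K[OF assms(1,2)])
  moreover have "(e \<inter> S) \<inter> rel_interior e \<noteq> {}"
    using assms(3,4) rel_interior_subset[of e] by blast
  ultimately have "e \<subseteq> e \<inter> S" using subset_of_face_of order_refl by metis
  then show ?thesis by blast
qed

lemma rel_interior_star: "e \<in> K \<Longrightarrow> x \<in> rel_interior e \<Longrightarrow> x \<in> star e"
proof -
  assume e: "e \<in> K" "x \<in> rel_interior e"
  then have "x \<in> e" using rel_interior_subset[of e] by blast
  then have "x \<in> X" using K_sub[OF e(1)] by blast
  moreover have "x \<notin> S" if "S \<in> K" "\<not> e \<subseteq> S" for S using rel_interior_sub_K[OF e(1) that(1) e(2)] that(2) by blast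
  ultimately show ?thesis unfolding star_def by blast
qed

lemma open_preimage:
  assumes T: "openin (top_of_set X) T" and x: "x \<in> T" "g x \<in> ball 0 1"
  obtains U where "open U" "g x \<in> U" "U \<subseteq> ball 0 1" "f ` U \<subseteq> T"
proof -
  have "openin (top_of_set (cball 0 1)) (cball 0 1 \<inter> f -` T)"
    using cont_f T f_in by (intro continuous_openin_preimage[where T = X]) auto
  then obtain W where W: "open W" "cball 0 1 \<inter> f -` T = cball 0 1 \<inter> W" by (auto simp: openin_open)
  have xX: "x \<in> X" using x T openin_imp_subset by blast
  have "g x \<in> W" using W(2) x xX fg_id g_in by auto
  then show thesis using that[of "W \<inter> ball 0 1"] W x ball_subset_cball by blast
qed

text \<open>Unlike in \<open>open_preimage\<close>, the point may correspond to one on the boundary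
  circle; density of the open disk provides interior points nearby.\<close>

lemma open_preimage_nonempty:
  assumes T: "openin (top_of_set X) T" and x: "x \<in> T"
  obtains U where "open U" "U \<noteq> {}" "U \<subseteq> ball 0 1" "f ` U \<subseteq> T"
proof -
  have "openin (top_of_set (cball 0 1)) (cball 0 1 \<inter> f -` T)"
    using cont_f T f_in by (intro continuous_openin_preimage[where T = X]) auto
  then obtain W where W: "open W" "cball 0 1 \<inter> f -` T = cball 0 1 \<inter> W" by (auto simp: openin_open)
  have xX: "x \<in> X" using x T openin_imp_subset by blast
  then have "g x \<in> W" "g x \<in> closure (ball 0 1)" using W(2) x fg_id g_in by auto
  then have "W \<inter> ball 0 1 \<noteq> {}" using open_Int_closure_eq_empty[OF W(1), of "ball 0 1"] by blast
  moreover have "f ` (W \<inter> ball 0 1) \<subseteq> T" using W(2) ball_subset_cball by blast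
  ultimately show thesis using that[of "W \<inter> ball 0 1"] W by blast
qed

text \<open>The open star of a maximal simplex is contained in it, and through the chart it contains
  an injective image of an open set of the plane; invariance of dimension gives the bound.\<close>

lemma maximal_dim:
  assumes S: "S \<in> K" "S \<noteq> {}" and max: "\<And>T. T \<in> K \<Longrightarrow> S \<subseteq> T \<Longrightarrow> S = T"
  shows "aff_dim S \<ge> 2"
proof -
  obtain x where "x \<in> rel_interior S" using S K_convex[OF S(1)] rel_interior_eq_empty[of S] by blast
  then have "x \<in> star S" by (rule rel_interior_star[OF S(1)])
  then obtain U where U: "open U" "U \<noteq> {}" "U \<subseteq> ball 0 1" "f ` U \<subseteq> star S"
    using open_preimage_nonempty[OF star_open] by metis
  have "star S \<subseteq> S" using star_sub[of S] max by blast
  then have fU: "f ` U \<subseteq> affine hull S" using U(4) \<open>star S \<subseteq> S\<close> hull_subset[of S affine] by (meson order_trans)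
  have "aff_dim (UNIV :: (real^2) set) \<le> aff_dim (affine hull S)"
  proof (rule invariance_of_dimension_affine_sets[where S = U and f = f])
    have "U \<subseteq> cball 0 1" using U(3) ball_subset_cball by blast
    then show "continuous_on U f" "inj_on f U"
      using cont_f continuous_on_subset inj_f inj_on_subset by metis+
  qed (use U fU in auto)
  then show ?thesis by (simp add: aff_dim_affine_hull)
qed

text \<open>Invariance of dimension again, now for the inverse chart on the relative
  interior.\<close>

lemma dim_le_2: assumes S: "S \<in> K" "S \<noteq> {}" shows "aff_dim S \<le> 2"
proof -
  have "aff_dim (affine hull S) \<le> aff_dim (UNIV :: (real^2) set)"
  proof (rule invariance_of_dimension_affine_sets[where S = "rel_interior S" and f = g])
    show "openin (top_of_set (affine hull S)) (rel_interior S)" by (rule openin_rel_interior)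
    have "rel_interior S \<subseteq> X" using K_sub[OF S(1)] rel_interior_subset[of S] by (meson order_trans)
    then show "continuous_on (rel_interior S) g" "inj_on g (rel_interior S)"
      using cont_g continuous_on_subset inj_g inj_on_subset by metis+
    show "rel_interior S \<noteq> {}" using S K_convex[OF S(1)] rel_interior_eq_empty[of S] by blast
  qed auto
  then show ?thesis by (simp add: aff_dim_affine_hull)
qed

lemma pure: assumes S: "S \<in> K" "S \<noteq> {}" shows "\<exists>i. S \<subseteq> \<Delta> i"
proof -
  obtain T where T: "T \<in> K" "S \<subseteq> T" "\<And>T'. T' \<in> K \<Longrightarrow> T \<subseteq> T' \<Longrightarrow> T = T'"
    using finite_has_maximal2[OF finite_K S(1)] by blast
  have ne: "T \<noteq> {}" using T(2) S(2) by blast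
  have "aff_dim T = 2" using maximal_dim[OF T(1) ne T(3)] dim_le_2[OF T(1) ne] by simp
  moreover obtain n where n: "n simplex T" using simplex_K[OF T(1)] by blast
  ultimately have "n = 2" using aff_dim_simplex by metis
  then have "T \<in> complex_triangles K" using n T(1) by (simp add: complex_triangles_def)
  then have "T \<in> range \<Delta>" using bij by (simp add: bij_betw_def)
  then show ?thesis using T(2) by blast
qed

lemma tri_K: "\<Delta> i \<in> K" and tri_dim: "aff_dim (\<Delta> i) = 2"
proof -
  have "\<Delta> i \<in> complex_triangles K" using bij by (auto simp: bij_betw_def)
  then show "\<Delta> i \<in> K" "aff_dim (\<Delta> i) = 2" using aff_dim_simplex by (auto simp: complex_triangles_def)
qed

lemma inj_tri: "\<Delta> i = \<Delta> j \<Longrightarrow> i = j"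
  using bij by (auto simp: bij_betw_def inj_on_def)

lemma X_cover: "x \<in> X \<Longrightarrow> \<exists>i. x \<in> \<Delta> i"
  using pure unfolding X_def by (metis Union_iff empty_iff subsetD)

definition tv :: "'n \<Rightarrow> 'a set" where
  "tv i = (case ori i of (a, b, c) \<Rightarrow> {a, b, c})"

lemma tri_hull: "\<Delta> i = convex hull tv i"
  using ori by (auto simp: boundary_orientation_def tv_def split: prod.splits)

text \<open>A hull of at most three points has dimension 2 only if there are three of them and they
  are affinely independent; so \<open>ori\<close> lists the true vertices.\<close>

lemma tv_card: "card (tv i) = 3" and tv_indep: "\<not> affine_dependent (tv i)"
proof -
  have le: "card (tv i) \<le> 3"
    unfolding tv_def by (cases "ori i") (auto simp: card_insert_if)
  have fin: "finite (tv i)" by (auto simp: tv_def split: prod.splits)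
  have dim: "aff_dim (tv i) = 2" using tri_dim[of i] by (simp add: tri_hull aff_dim_convex_hull)
  moreover have "aff_dim (tv i) \<le> int (card (tv i)) - 1" by (rule aff_dim_le_card[OF fin])
  ultimately show c: "card (tv i) = 3" using le by linarith
  then show "\<not> affine_dependent (tv i)" using dim fin by (simp add: affine_independent_iff_card)
qed

lemma tv_finite: "finite (tv i)"
  by (auto simp: tv_def split: prod.splits)

lemma ori_distinct: "ori i = (a, b, c) \<Longrightarrow> a \<noteq> b \<and> b \<noteq> c \<and> a \<noteq> c"
  using tv_card[of i] by (auto simp: tv_def card_insert_if split: if_splits)

lemma edges_disjoint: "e \<in> directed_edges (ori i) \<Longrightarrow> e \<in> directed_edges (ori j) \<Longrightarrow> i = j"
  using ori unfolding boundary_orientation_def by blast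

lemma boundary_edges: "\<exists>i. (p, q) \<in> directed_edges (ori i)" "\<exists>i. (q, r) \<in> directed_edges (ori i)"
  "\<exists>i. (r, s) \<in> directed_edges (ori i)" "\<exists>i. (s, p) \<in> directed_edges (ori i)"
  using ori unfolding boundary_orientation_def by auto

lemma edge_tv: assumes "(x, y) \<in> directed_edges (ori i)"
  shows "x \<in> tv i" "y \<in> tv i" "x \<noteq> y" "(y, x) \<notin> directed_edges (ori i)"
proof -
  obtain a b c where abc: "ori i = (a, b, c)" by (cases "ori i") auto
  have d: "a \<noteq> b" "b \<noteq> c" "a \<noteq> c" using ori_distinct[OF abc] by auto
  have e: "(x, y) \<in> {(a, b), (b, c), (c, a)}" using assms abc by simp
  show "x \<in> tv i" "y \<in> tv i" "x \<noteq> y" "(y, x) \<notin> directed_edges (ori i)"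
    using e d by (auto simp: abc tv_def)
qed

lemma tv_edge: "x \<in> tv i \<Longrightarrow> y \<in> tv i \<Longrightarrow> x \<noteq> y \<Longrightarrow> (x, y) \<in> directed_edges (ori i) \<or> (y, x) \<in> directed_edges (ori i)"
  by (cases "ori i") (auto simp: tv_def)

lemma sub_tri_face:
  assumes w: "w \<subseteq> tv i" shows "convex hull w face_of \<Delta> i" "convex hull w \<in> K"
proof -
  show "convex hull w face_of \<Delta> i"
    using face_of_convex_hull_affine_independent[OF tv_indep[of i]] w unfolding tri_hull by blast
  then show "convex hull w \<in> K" using face_K tri_K by blast
qed

lemma sub_indep: "w \<subseteq> tv i \<Longrightarrow> \<not> affine_dependent w"
  using affine_dependent_subset tv_indep by blast

lemma hull_in_tri:
  assumes w: "w \<subseteq> tv i" and sub: "convex hull w \<subseteq> \<Delta> j" shows "w \<subseteq> tv j"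
proof -
  have "convex hull w \<inter> \<Delta> j = convex hull w" using sub by blast
  then have "convex hull w face_of \<Delta> j"
    using Int_K[OF tri_K sub_tri_face(2)[OF w], of j] by (simp add: Int_commute)
  then obtain w' where w': "w' \<subseteq> tv j" "convex hull w = convex hull w'"
    unfolding tri_hull using face_of_triangleE[OF tv_indep] by metis
  then have "w = w'" using convex_hull_affine_independent_eq sub_indep w by blast
  then show ?thesis using w' by simp
qed

lemma vertex_in_hull:
  assumes w: "w \<subseteq> tv i" and v: "v \<in> tv i" "v \<in> convex hull w" shows "v \<in> w"
proof (rule ccontr)
  assume "v \<notin> w"
  then have "affine hull w \<subseteq> affine hull (tv i - {v})" using w by (intro hull_mono) blast
  then have "v \<in> affine hull (tv i - {v})" using v(2) convex_hull_subset_affine_hull by blast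
  then show False using v(1) tv_indep unfolding affine_dependent_def by blast
qed

lemma tri_Int:
  obtains w where "w \<subseteq> tv i" "w \<subseteq> tv j" "\<Delta> i \<inter> \<Delta> j = convex hull w"
proof -
  have "\<Delta> i \<inter> \<Delta> j face_of \<Delta> i" by (rule Int_K[OF tri_K tri_K])
  then obtain w where w: "w \<subseteq> tv i" "\<Delta> i \<inter> \<Delta> j = convex hull w"
    unfolding tri_hull[of i] using face_of_triangleE[OF tv_indep] by metis
  then show thesis using hull_in_tri[OF w(1), of j] that by blast
qed

lemma tri_sub: "\<Delta> i \<subseteq> \<Delta> j \<Longrightarrow> i = j"
proof -
  assume sub: "\<Delta> i \<subseteq> \<Delta> j"
  then have "tv i \<subseteq> tv j" using hull_in_tri[of "tv i" i j] by (simp add: tri_hull)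
  then have "tv i = tv j" using tv_card tv_finite by (metis card_subset_eq)
  then show "i = j" using inj_tri tri_hull by metis
qed

lemma edge_segment:
  assumes "(x, y) \<in> directed_edges (ori i)"
  shows "closed_segment x y \<in> K" "closed_segment x y \<subseteq> \<Delta> i"
    "midpoint x y \<in> rel_interior (closed_segment x y)" "midpoint x y \<in> X"
proof -
  note e = edge_tv[OF assms]
  show K: "closed_segment x y \<in> K" using sub_tri_face(2)[of "{x, y}" i] e by (simp add: segment_convex_hull)
  have "convex hull {x, y} \<subseteq> convex hull tv i" using e by (intro hull_mono) auto
  then show "closed_segment x y \<subseteq> \<Delta> i" by (simp add: segment_convex_hull tri_hull)
  have "midpoint x y \<in> open_segment x y" using e by (simp add: midpoint_in_open_segment)
  then show m: "midpoint x y \<in> rel_interior (closed_segment x y)"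
    using e by (simp add: rel_interior_closed_segment)
  then show "midpoint x y \<in> X" using K_sub[OF K] rel_interior_subset[of "closed_segment x y"] by blast
qed

text \<open>Two triangles unfold along a common edge to a neighbourhood of its midpoint in the plane.\<close>
lemma two_pages:
  assumes i: "(x, y) \<in> directed_edges (ori i)" and j: "{x, y} \<subseteq> tv j" and ij: "i \<noteq> j"
  shows "g (midpoint x y) \<in> ball 0 1"
proof -
  note e = edge_tv[OF i]
  have apex: "\<exists>c. tv l = {x, y, c} \<and> c \<noteq> x \<and> c \<noteq> y" if l: "{x, y} \<subseteq> tv l" for l
  proof -
    have "card (tv l - {x, y}) = 1" using l e(3) tv_card[of l] tv_finite[of l] by (subst card_Diff_subset) auto
    then obtain c where "tv l - {x, y} = {c}" by (auto simp: card_1_singleton_iff)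
    then show ?thesis using l by (intro exI[of _ c]) auto
  qed
  obtain c1 where c1: "tv i = {x, y, c1}" "c1 \<noteq> x" "c1 \<noteq> y" using apex[of i] e by auto
  obtain c2 where c2: "tv j = {x, y, c2}" "c2 \<noteq> x" "c2 \<noteq> y" using apex[OF j] by auto
  define m where "m = midpoint x y"
  \<comment> \<open>The first coordinate runs along the edge, the second away from it: the upper
    half is mapped into triangle \<open>i\<close>, the lower half into triangle
    \<open>j\<close>.\<close>
  define \<psi> where "\<psi> = (\<lambda>z :: real \<times> real. m + fst z *\<^sub>R (y - x) + max (snd z) 0 *\<^sub>R (c1 - m) + max (- snd z) 0 *\<^sub>R (c2 - m))"
  \<comment> \<open>With both coordinates below 1/4 in size, the barycentric coordinates
    \<open>1/2 - u - w/2\<close> and \<open>1/2 + u - w/2\<close> stay positive.\<close>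
  define N where "N = ({-1/4<..<1/4} \<times> {-1/4<..<1/4} :: (real \<times> real) set)"
  have expand: "m + u *\<^sub>R (y - x) + w *\<^sub>R (c - m) = (1/2 - u - w/2) *\<^sub>R x + (1/2 + u - w/2) *\<^sub>R y + w *\<^sub>R c" for u w c
    by (simp add: m_def midpoint_def algebra_simps)
  have in_hull: "m + u *\<^sub>R (y - x) + w *\<^sub>R (c - m) \<in> convex hull {x, y, c}"
    if "\<bar>u\<bar> < 1/4" "0 \<le> w" "w < 1/4" for u w c
    unfolding expand convex_hull_3 using that
    by (intro CollectI exI[of _ "1/2 - u - w/2"] exI[of _ "1/2 + u - w/2"] exI[of _ w]) auto
  have inj1: "u = u' \<and> w = w'"
    if eq: "m + u *\<^sub>R (y - x) + w *\<^sub>R (c - m) = m + u' *\<^sub>R (y - x) + w' *\<^sub>R (c - m)"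
      and tc: "\<not> affine_dependent {x, y, c}" "c \<noteq> x" "c \<noteq> y" for u w u' w' c
  proof -
    have "(u - u' - (w - w') / 2) *\<^sub>R (y - x) + (w - w') *\<^sub>R (c - x) = 0"
    proof -
      have "(u - u') *\<^sub>R (y - x) + (w - w') *\<^sub>R (c - m) = 0" using eq by (simp add: algebra_simps)
      moreover have "c - m = (c - x) - (1/2) *\<^sub>R (y - x)"
        by (simp add: m_def midpoint_def algebra_simps) (simp flip: scaleR_add_left)
      ultimately show ?thesis by (simp add: algebra_simps)
    qed
    then have "u - u' - (w - w') / 2 = 0 \<and> w - w' = 0"
      using affine_combination_unique[OF tc(1)] tc e(3) by metis
    then show ?thesis by simp
  qed
  have ind: "\<not> affine_dependent {x, y, c1}" "\<not> affine_dependent {x, y, c2}"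
    using tv_indep[of i] tv_indep[of j] c1 c2 by auto
  have seg: "\<Delta> i \<inter> \<Delta> j = closed_segment x y"
  proof -
    obtain w where w: "w \<subseteq> tv i" "w \<subseteq> tv j" "\<Delta> i \<inter> \<Delta> j = convex hull w" using tri_Int .
    have "{x, y} \<subseteq> w"
    proof -
      have "convex hull {x, y} \<subseteq> convex hull w"
        unfolding w(3)[symmetric] tri_hull using e j by (intro Int_greatest hull_mono) auto
      then have "{x, y} \<subseteq> convex hull w" using hull_subset[of "{x, y}" convex] by (meson order_trans)
      then show ?thesis using vertex_in_hull[OF w(1)] e by blast
    qed
    moreover have "w \<noteq> tv i"
      using ij tri_sub[of i j] w(3) tri_hull[of i] by auto
    ultimately have "w = {x, y}" using w(1) c1 by auto
    then show ?thesis using w(3) by (simp add: segment_convex_hull)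
  qed
  have segP: "z \<in> closed_segment x y \<Longrightarrow> \<exists>u. z = m + u *\<^sub>R (y - x)" for z
  proof -
    assume "z \<in> closed_segment x y"
    then obtain t where "z = (1 - t) *\<^sub>R x + t *\<^sub>R y" by (auto simp: closed_segment_def)
    then have "z = m + (t - 1/2) *\<^sub>R (y - x)"
      by (simp add: m_def midpoint_def algebra_simps) (simp flip: scaleR_add_left)
    then show ?thesis by blast
  qed
  have pos: "\<psi> z = m + fst z *\<^sub>R (y - x) + snd z *\<^sub>R (c1 - m)" if "snd z \<ge> 0" for z
    using that by (simp add: \<psi>_def)
  have neg: "\<psi> z = m + fst z *\<^sub>R (y - x) + (- snd z) *\<^sub>R (c2 - m)" if "snd z \<le> 0" for z
    using that by (simp add: \<psi>_def)
  have inI: "\<psi> z \<in> \<Delta> i" if "z \<in> N" "snd z \<ge> 0" for z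
    unfolding pos[OF that(2)] tri_hull c1(1) using that by (intro in_hull) (auto simp: N_def)
  have inJ: "\<psi> z \<in> \<Delta> j" if "z \<in> N" "snd z \<le> 0" for z
    unfolding neg[OF that(2)] tri_hull c2(1) using that by (intro in_hull) (auto simp: N_def)
  have crossing: "snd z = 0" if z: "z \<in> N" "z' \<in> N" and eq: "\<psi> z = \<psi> z'" and s: "snd z \<ge> 0" "snd z' \<le> 0" for z z'
  proof -
    have "\<psi> z \<in> \<Delta> i \<inter> \<Delta> j" using inI[OF z(1) s(1)] inJ[OF z(2) s(2)] eq by simp
    then obtain u where "\<psi> z = m + u *\<^sub>R (y - x)" using seg segP by blast
    then have "m + fst z *\<^sub>R (y - x) + snd z *\<^sub>R (c1 - m) = m + u *\<^sub>R (y - x) + 0 *\<^sub>R (c1 - m)"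
      using pos[OF s(1)] by simp
    then show ?thesis using inj1[OF _ ind(1) c1(2,3)] by blast
  qed
  have "inj_on \<psi> N"
  proof (rule inj_onI)
    have *: "z = z'" if z: "z \<in> N" "z' \<in> N" and eq: "\<psi> z = \<psi> z'" and s: "snd z \<ge> 0" for z z'
    proof (cases "snd z' \<ge> 0")
      case True
      then show ?thesis using inj1[OF eq[unfolded pos[OF s] pos[OF True]] ind(1) c1(2,3)] by (simp add: prod_eq_iff)
    next
      case False
      then have "snd z = 0" using crossing[OF z eq s] by simp
      then have "m + fst z *\<^sub>R (y - x) + (- snd z) *\<^sub>R (c2 - m) = m + fst z' *\<^sub>R (y - x) + (- snd z') *\<^sub>R (c2 - m)"
        using eq neg[of z] neg[of z'] False by simp
      then have "fst z = fst z' \<and> - snd z = - snd z'" by (rule inj1[OF _ ind(2) c2(2,3)])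
      then show ?thesis by (simp add: prod_eq_iff)
    qed
    fix z z' assume z: "z \<in> N" "z' \<in> N" and eq: "\<psi> z = \<psi> z'"
    show "z = z'"
    proof (cases "snd z \<ge> 0 \<or> snd z' \<ge> 0")
      case True
      then show ?thesis using *[OF z eq] *[OF z(2,1) eq[symmetric]] by metis
    next
      case False
      then have "m + fst z *\<^sub>R (y - x) + (- snd z) *\<^sub>R (c2 - m) = m + fst z' *\<^sub>R (y - x) + (- snd z') *\<^sub>R (c2 - m)"
        using eq neg[of z] neg[of z'] by simp
      then have "fst z = fst z' \<and> - snd z = - snd z'" by (rule inj1[OF _ ind(2) c2(2,3)])
      then show ?thesis by (simp add: prod_eq_iff)
    qed
  qed
  moreover have \<psi>X: "\<psi> ` N \<subseteq> X"
  proof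
    fix v assume "v \<in> \<psi> ` N"
    then obtain z where z: "z \<in> N" "v = \<psi> z" by blast
    have "snd z \<ge> 0 \<or> snd z \<le> 0" by linarith
    then have "v \<in> \<Delta> i \<or> v \<in> \<Delta> j" using inI[OF z(1)] inJ[OF z(1)] z(2) by blast
    then show "v \<in> X" using K_sub[OF tri_K] by blast
  qed
  ultimately have inj: "inj_on (g \<circ> \<psi>) N" using inj_g by (intro comp_inj_on) (auto intro: inj_on_subset)
  have "continuous_on N \<psi>" unfolding \<psi>_def by (intro continuous_intros)
  then have "continuous_on N (g \<circ> \<psi>)" using \<psi>X cont_g by (intro continuous_on_compose) (auto intro: continuous_on_subset)
  moreover have "open N" unfolding N_def by (intro open_Times) auto
  \<comment> \<open>By invariance of domain the image is open in the plane, and an open subset of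
    the closed disk avoids the circle.\<close>
  ultimately have "open ((g \<circ> \<psi>) ` N)" using inj by (intro invariance_of_domain_gen) auto
  moreover have "(g \<circ> \<psi>) ` N \<subseteq> cball 0 1" using \<psi>X g_in by auto
  ultimately have sub: "(g \<circ> \<psi>) ` N \<subseteq> interior (cball 0 1)" by (intro interior_maximal)
  have "(g \<circ> \<psi>) (0, 0) \<in> (g \<circ> \<psi>) ` N" by (intro imageI) (simp add: N_def)
  then have "(g \<circ> \<psi>) (0, 0) \<in> ball 0 1" using sub unfolding interior_cball by blast
  then show ?thesis by (simp add: \<psi>_def m_def)
qed

text \<open>If the midpoint were inside, the chart would map an open planar set around it into the
  open star of the edge, which lies in a single triangle. Invariance of domain then puts the
  midpoint in the relative interior of that triangle, although it lies on a proper face.\<close>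

lemma one_page:
  assumes i: "(x, y) \<in> directed_edges (ori i)" and only: "\<And>j. {x, y} \<subseteq> tv j \<Longrightarrow> j = i"
  shows "g (midpoint x y) \<notin> ball 0 1"
proof
  assume b: "g (midpoint x y) \<in> ball 0 1"
  note e = edge_tv[OF i] and E = edge_segment[OF i]
  define m where "m = midpoint x y"
  have "m \<in> star (closed_segment x y)" using E m_def rel_interior_star by blast
  then obtain U where U: "open U" "g m \<in> U" "U \<subseteq> ball 0 1" "f ` U \<subseteq> star (closed_segment x y)"
    using open_preimage[OF star_open] b m_def by metis
  have "star (closed_segment x y) \<subseteq> \<Delta> i"
  proof
    fix z assume "z \<in> star (closed_segment x y)"
    then obtain S where S: "S \<in> K" "closed_segment x y \<subseteq> S" "z \<in> S" using star_sub by blast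
    then obtain j where j: "S \<subseteq> \<Delta> j" using pure by blast
    then have "convex hull {x, y} \<subseteq> \<Delta> j" using S by (simp add: segment_convex_hull)
    then have "{x, y} \<subseteq> tv j" using hull_in_tri[of "{x, y}" i j] e by blast
    then show "z \<in> \<Delta> i" using only S j by blast
  qed
  then have fU: "f ` U \<subseteq> \<Delta> i" using U by blast
  have Uc: "U \<subseteq> cball 0 1" using U(3) ball_subset_cball by blast
  have "openin (top_of_set (affine hull \<Delta> i)) (f ` U)"
  proof (rule invariance_of_domain_affine_sets[where U = UNIV])
    show "continuous_on U f" "inj_on f U" using Uc cont_f continuous_on_subset inj_f inj_on_subset by blast+
    show "aff_dim (affine hull \<Delta> i) \<le> aff_dim (UNIV :: (real^2) set)" by (simp add: aff_dim_affine_hull tri_dim)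
    show "f \<in> U \<rightarrow> affine hull \<Delta> i" using fU hull_subset[of "\<Delta> i" affine] by blast
  qed (use U in auto)
  then have "f ` U \<subseteq> rel_interior (\<Delta> i)" using rel_interior_maximal fU by blast
  moreover have "m \<in> f ` U" using U(2) fg_id E(4) by (metis image_eqI m_def)
  ultimately have "m \<in> rel_interior (\<Delta> i)" by blast
  moreover have "m \<in> closed_segment x y" using E(3) rel_interior_subset[of "closed_segment x y"] unfolding m_def by blast
  moreover have "closed_segment x y face_of \<Delta> i" using sub_tri_face(1)[of "{x, y}" i] e by (simp add: segment_convex_hull)
  moreover have "card {x, y} = 2" using e(3) by simp
  then have "{x, y} \<noteq> tv i" using tv_card[of i] by auto
  then have "closed_segment x y \<noteq> \<Delta> i"
    using convex_hull_affine_independent_eq[of "{x, y}" "tv i"] sub_indep[of "{x, y}" i] tv_indep[of i] e tv_card[of i]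
    by (auto simp: segment_convex_hull tri_hull)
  ultimately show False using face_of_disjoint_rel_interior by blast
qed

text \<open>The midpoint lies on one of the four sides, which are simplices because the orientation
  traverses them. So the edge is a face of that side, and a segment has no other 1-dimensional face
  than itself.\<close>

lemma boundary_midpoint:
  assumes i: "(x, y) \<in> directed_edges (ori i)" and nb: "g (midpoint x y) \<notin> ball 0 1"
  shows "{x, y} \<in> {{p, q}, {q, r}, {r, s}, {s, p}}"
proof -
  note E = edge_segment[OF i] and e = edge_tv[OF i]
  have "g (midpoint x y) \<in> sphere 0 1" using nb g_in[OF E(4)] by auto
  then have "f (g (midpoint x y)) \<in> f ` sphere 0 1" by blast
  then have "midpoint x y \<in> f ` sphere 0 1" using fg_id E(4) by simp
  then have m: "midpoint x y \<in> closed_segment p q \<union> closed_segment q r \<union> closed_segment r s \<union> closed_segment s p"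
    using fg(2) by simp
  have *: "{x, y} = {a, b}" if m: "midpoint x y \<in> closed_segment a b" and ab: "\<exists>j. (a, b) \<in> directed_edges (ori j)" for a b
  proof -
    obtain j where j: "(a, b) \<in> directed_edges (ori j)" using ab by blast
    note E' = edge_segment[OF j] and e' = edge_tv[OF j]
    have "closed_segment x y \<subseteq> closed_segment a b" by (rule rel_interior_sub_K[OF E(1) E'(1) E(3) m])
    also have "\<dots> \<subseteq> \<Delta> j" by (rule E')
    finally have "{x, y} \<subseteq> tv j" using hull_in_tri[of "{x, y}" i j] e by (simp add: segment_convex_hull)
    have "closed_segment x y \<inter> closed_segment a b = closed_segment x y"
      using rel_interior_sub_K[OF E(1) E'(1) E(3) m] by blast
    then have "closed_segment x y face_of closed_segment a b"
      using Int_K[OF E'(1) E(1)] by (simp add: Int_commute)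
    then have "convex hull {x, y} face_of convex hull {a, b}" by (simp add: segment_convex_hull)
    then obtain w where w: "w \<subseteq> {a, b}" "convex hull {x, y} = convex hull w"
      using face_of_triangleE[OF sub_indep[of "{a, b}" j]] e' by (metis empty_subsetI insert_subset)
    have "{x, y} = w"
      using w e e' convex_hull_affine_independent_eq[of "{x, y}" w] sub_indep[of "{x, y}" i] sub_indep[of w j] by auto
    then show ?thesis using w(1) e(3) by auto
  qed
  from m consider "midpoint x y \<in> closed_segment p q" | "midpoint x y \<in> closed_segment q r"
    | "midpoint x y \<in> closed_segment r s" | "midpoint x y \<in> closed_segment s p" by blast
  then show ?thesis using *[OF _ boundary_edges(1)] *[OF _ boundary_edges(2)] *[OF _ boundary_edges(3)] *[OF _ boundary_edges(4)]
    by cases auto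
qed

text \<open>A second triangle at a side would put the midpoint of the side into the open
  disk.\<close>

lemma boundary_one_page:
  assumes xy: "(x, y) \<in> {(p, q), (q, r), (r, s), (s, p)}" shows "(y, x) \<notin> directed_edges (ori j)"
proof
  assume j: "(y, x) \<in> directed_edges (ori j)"
  obtain i where i: "(x, y) \<in> directed_edges (ori i)" using xy boundary_edges by auto
  have "i \<noteq> j" using edge_tv(4)[OF i] j by blast
  then have "g (midpoint x y) \<in> ball 0 1" using two_pages[OF i, of j] edge_tv(1,2)[OF j] by blast
  moreover have "midpoint x y \<in> f ` sphere 0 1"
    using xy unfolding fg(2) by (auto intro: midpoints_in_convex_hull simp: segment_convex_hull[symmetric])
  then have "g (midpoint x y) \<in> sphere 0 1" using gf_id by (force simp: sphere_cball)
  ultimately show False by auto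
qed

text \<open>Otherwise a single triangle contains the edge, its midpoint is on the boundary, and the
  edge is one of the four sides in one of the two directions.\<close>

lemma interior_edge_rev:
  assumes i: "(x, y) \<in> directed_edges (ori i)" and nb: "(x, y) \<notin> {(p, q), (q, r), (r, s), (s, p)}"
  shows "\<exists>j. (y, x) \<in> directed_edges (ori j)"
proof (rule ccontr)
  assume no: "\<not> ?thesis"
  have "j = i" if "{x, y} \<subseteq> tv j" for j
    using tv_edge[of x j y] that edge_tv(3)[OF i] no edges_disjoint i by auto
  then have "g (midpoint x y) \<notin> ball 0 1" by (rule one_page[OF i])
  then have "{x, y} \<in> {{p, q}, {q, r}, {r, s}, {s, p}}" by (rule boundary_midpoint[OF i])
  then have "(y, x) \<in> {(p, q), (q, r), (r, s), (s, p)}" using nb by (auto simp: doubleton_eq_iff)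
  then show False using no boundary_edges by auto
qed

end

section \<open>The oriented complex of the disk: cancellation, connectedness, cohomology\<close>

fun rots :: "'a \<times> 'a \<times> 'a \<Rightarrow> ('a \<times> 'a \<times> 'a) set" where
  "rots (a, b, c) = {(a, b, c), (b, c, a), (c, a, b)}"

context quad begin

definition V where "V = (\<Union>i. tv i)"

definition DT where "DT = (\<Union>i. rots (ori i))"

definition Bd where "Bd = {(p, q), (q, r), (r, s), (s, p)}"

lemma finite_V: "finite V"
  using tv_finite by (simp add: V_def)

lemma finite_DT: "finite DT"
proof -
  have "finite (rots t)" for t :: "'a \<times> 'a \<times> 'a" by (cases t) auto
  then show ?thesis by (simp add: DT_def)
qed

lemma rots_edge: "(x, y, z) \<in> rots (ori i) \<Longrightarrow> (x, y) \<in> directed_edges (ori i) \<and> tv i = {x, y, z}"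
  by (cases "ori i") (auto simp: tv_def)

lemma DT_edge:
  assumes "(x, y, z) \<in> DT"
  obtains i where "(x, y) \<in> directed_edges (ori i)" "tv i = {x, y, z}" "(x, y, z) \<in> rots (ori i)"
  using assms rots_edge by (auto simp: DT_def)

lemma edge_DT: "(x, y) \<in> directed_edges (ori i) \<Longrightarrow> \<exists>z. (x, y, z) \<in> rots (ori i)"
  by (cases "ori i") auto

lemma rots_DT: "t \<in> rots (ori i) \<Longrightarrow> t \<in> DT"
  unfolding DT_def by (rule UN_I[OF UNIV_I])

lemma edge_in_DT: "(x, y) \<in> directed_edges (ori i) \<Longrightarrow> \<exists>z. (x, y, z) \<in> DT"
proof -
  assume "(x, y) \<in> directed_edges (ori i)"
  then obtain z where "(x, y, z) \<in> rots (ori i)" using edge_DT by meson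
  then have "(x, y, z) \<in> DT" by (rule rots_DT)
  then show ?thesis ..
qed

lemma DT_rot: "(x, y, z) \<in> DT \<Longrightarrow> (y, z, x) \<in> DT"
proof -
  assume "(x, y, z) \<in> DT"
  then obtain i where i: "(x, y, z) \<in> rots (ori i)" by (auto simp: DT_def)
  then have "(y, z, x) \<in> rots (ori i)" by (cases "ori i") auto
  then show ?thesis by (rule rots_DT)
qed

lemma DT_dist: "(x, y, z) \<in> DT \<Longrightarrow> x \<noteq> y"
  using DT_edge edge_tv(3) by metis

lemma DT_V: "(x, y, z) \<in> DT \<Longrightarrow> x \<in> V \<and> y \<in> V \<and> z \<in> V"
proof -
  assume "(x, y, z) \<in> DT"
  then obtain i where "tv i = {x, y, z}" by (rule DT_edge)
  then have "{x, y, z} \<subseteq> V" unfolding V_def by blast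
  then show ?thesis by blast
qed

lemma DT_uniq:
  assumes "(x, y, z) \<in> DT" "(x, y, w) \<in> DT" shows "z = w"
proof -
  obtain i where i: "(x, y) \<in> directed_edges (ori i)" "tv i = {x, y, z}" "(x, y, z) \<in> rots (ori i)" using DT_edge[OF assms(1)] .
  obtain j where j: "(x, y) \<in> directed_edges (ori j)" "tv j = {x, y, w}" "(x, y, w) \<in> rots (ori j)" using DT_edge[OF assms(2)] .
  have "i = j" using edges_disjoint i(1) j(1) by blast
  then show ?thesis using i(2) j(2) DT_dist[OF assms(1)] DT_dist[OF DT_rot[OF assms(1)]] DT_dist[OF DT_rot[OF DT_rot[OF assms(1)]]]
    by auto
qed

lemma DT_rev: "(x, y, z) \<in> DT \<Longrightarrow> (x, y) \<notin> Bd \<Longrightarrow> \<exists>w. (y, x, w) \<in> DT"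
proof -
  assume d: "(x, y, z) \<in> DT" and nb: "(x, y) \<notin> Bd"
  obtain i where i: "(x, y) \<in> directed_edges (ori i)" using DT_edge[OF d] .
  obtain j where "(y, x) \<in> directed_edges (ori j)" using interior_edge_rev[OF i] nb by (auto simp: Bd_def)
  then show ?thesis using edge_in_DT by blast
qed

lemma Bd_DT: "(x, y) \<in> Bd \<Longrightarrow> \<exists>z. (x, y, z) \<in> DT"
proof -
  assume "(x, y) \<in> Bd"
  then obtain i where "(x, y) \<in> directed_edges (ori i)" using boundary_edges unfolding Bd_def by auto
  then show ?thesis by (rule edge_in_DT)
qed

lemma Bd_no_rev: "(x, y) \<in> Bd \<Longrightarrow> (y, x, z) \<notin> DT"
proof
  assume b: "(x, y) \<in> Bd" and d: "(y, x, z) \<in> DT"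
  obtain i where "(y, x) \<in> directed_edges (ori i)" using DT_edge[OF d] .
  then show False using boundary_one_page b unfolding Bd_def by blast
qed

lemma Bd_V: "p \<in> V" "q \<in> V" "r \<in> V" "s \<in> V"
  using Bd_DT[of p q] Bd_DT[of r s] DT_V by (auto simp: Bd_def)

text \<open>Interior edges cancel against their reversals; the four sides remain, each occurring in
  one direction only.\<close>

lemma chain_boundary: "chain_boundary ori p q r s"
  unfolding chain_boundary_def
proof (intro allI impI)
  fix \<kappa> :: "'a \<Rightarrow> 'a \<Rightarrow> real" assume anti: "\<forall>x y. \<kappa> y x = - \<kappa> x y"
  let ?k = "\<lambda>e. \<kappa> (fst e) (snd e)"
  define EE where "EE = (\<Union>i. directed_edges (ori i))"
  have fin: "finite (directed_edges t)" for t :: "'a \<times> 'a \<times> 'a" by (cases t) auto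
  have finE: "finite EE" using fin by (simp add: EE_def)
  have "tri_sum \<kappa> (ori i) = (\<Sum>e\<in>directed_edges (ori i). ?k e)" for i
  proof -
    obtain a b c where abc: "ori i = (a, b, c)" by (cases "ori i") auto
    then show ?thesis using ori_distinct[OF abc] by (simp add: tri_sum_def)
  qed
  then have "(\<Sum>i\<in>UNIV. tri_sum \<kappa> (ori i)) = (\<Sum>i\<in>UNIV. \<Sum>e\<in>directed_edges (ori i). ?k e)" by simp
  also have "\<dots> = (\<Sum>e\<in>EE. ?k e)"
    unfolding EE_def using fin edges_disjoint by (intro sum.UNION_disjoint[symmetric]) auto
  also have "\<dots> = (\<Sum>e\<in>Bd. ?k e) + (\<Sum>e\<in>EE - Bd. ?k e)"
  proof -
    have "Bd \<subseteq> EE" using boundary_edges by (auto simp: Bd_def EE_def)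
    then show ?thesis using sum.subset_diff[OF _ finE, of Bd ?k] by simp
  qed
  also have "(\<Sum>e\<in>EE - Bd. ?k e) = 0"
  proof -
    have sw: "prod.swap e \<in> EE - Bd" if e: "e \<in> EE - Bd" for e
    proof -
      obtain x y where xy: "e = (x, y)" by (cases e) auto
      obtain i where i: "(x, y) \<in> directed_edges (ori i)" using e xy by (auto simp: EE_def)
      obtain j where j: "(y, x) \<in> directed_edges (ori j)" using interior_edge_rev[OF i] e xy by (auto simp: Bd_def)
      have "(y, x) \<notin> Bd" using boundary_one_page[of y x i] i unfolding Bd_def by blast
      then show ?thesis using j xy by (auto simp: EE_def)
    qed
    have "(\<Sum>e\<in>EE - Bd. ?k e) = (\<Sum>e\<in>EE - Bd. ?k (prod.swap e))"
      by (rule sum.reindex_bij_witness[where i = prod.swap and j = prod.swap]) (use sw in auto)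
    also have "\<dots> = - (\<Sum>e\<in>EE - Bd. ?k e)"
      unfolding sum_negf[symmetric] by (intro sum.cong refl) (simp add: anti[rule_format, of "fst _" "snd _"])
    finally show ?thesis by simp
  qed
  finally show "(\<Sum>i\<in>UNIV. tri_sum \<kappa> (ori i)) = \<kappa> p q + \<kappa> q r + \<kappa> r s + \<kappa> s p"
    using dist4 by (simp add: Bd_def)
qed

text \<open>The open disk without the finitely many vertices is still connected. In it, triangles of
  \<open>G\<close> can meet the others only along shared edges, and closure of \<open>G\<close>
  excludes these.\<close>

lemma tri_connected:
  assumes ne: "G \<noteq> {}" and closed: "\<And>i j x y. i \<in> G \<Longrightarrow> (x, y) \<in> directed_edges (ori i) \<Longrightarrow> (y, x) \<in> directed_edges (ori j) \<Longrightarrow> j \<in> G"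
  shows "G = UNIV"
proof (rule ccontr)
  assume nU: "G \<noteq> UNIV"
  define Us where "Us = f ` (ball 0 1 - g ` V)"
  define C1 where "C1 = (\<Union>i\<in>G. \<Delta> i)"
  define C2 where "C2 = (\<Union>i\<in>- G. \<Delta> i)"
  have "connected (ball (0 :: real^2) 1 - g ` V)"
    using finite_V by (intro connected_open_delete_finite) auto
  moreover have "continuous_on (ball 0 1 - g ` V) f"
    using cont_f by (rule continuous_on_subset) auto
  ultimately have conn: "connected Us" unfolding Us_def by (intro connected_continuous_image)
  have cl: "closed C1" "closed C2" unfolding C1_def C2_def using K_closed tri_K by (auto intro!: closed_UN)
  have UsX: "Us \<subseteq> X" unfolding Us_def using f_in ball_subset_cball by blast
  have cover: "Us \<subseteq> C1 \<union> C2" using UsX X_cover unfolding C1_def C2_def by blast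
  \<comment> \<open>The open star of a triangle contains the image of a nonempty open set, which is
    infinite and so not exhausted by vertices.\<close>
  have meet: "\<Delta> i \<inter> Us \<noteq> {}" for i
  proof -
    have "\<Delta> i \<noteq> {}" using tri_dim[of i] by auto
    then obtain x where "x \<in> rel_interior (\<Delta> i)" using K_convex[OF tri_K] rel_interior_eq_empty[of "\<Delta> i"] by blast
    then have "x \<in> star (\<Delta> i)" by (rule rel_interior_star[OF tri_K])
    then obtain U where U: "open U" "U \<noteq> {}" "U \<subseteq> ball 0 1" "f ` U \<subseteq> star (\<Delta> i)"
      using open_preimage_nonempty[OF star_open] by metis
    have "star (\<Delta> i) \<subseteq> \<Delta> i"
    proof
      fix z assume "z \<in> star (\<Delta> i)"
      then obtain S where S: "S \<in> K" "\<Delta> i \<subseteq> S" "z \<in> S" using star_sub[of "\<Delta> i"] by blast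
      then obtain j where "S \<subseteq> \<Delta> j" using pure by blast
      then show "z \<in> \<Delta> i" using tri_sub[of i j] S by blast
    qed
    moreover have "infinite U"
      using U(1,2) finite_imp_not_open by blast
    then have "U - g ` V \<noteq> {}" using finite_V by (metis Diff_eq_empty_iff finite_imageI finite_subset)
    then obtain y where "y \<in> U" "y \<notin> g ` V" by blast
    ultimately show ?thesis using U(3,4) unfolding Us_def by blast
  qed
  have disj: "C1 \<inter> C2 \<inter> Us = {}"
  proof (rule ccontr)
    assume "C1 \<inter> C2 \<inter> Us \<noteq> {}"
    then obtain x i j where x: "x \<in> \<Delta> i" "x \<in> \<Delta> j" "i \<in> G" "j \<notin> G" "x \<in> Us" unfolding C1_def C2_def by blast
    have xV: "x \<notin> V"
    proof
      assume "x \<in> V"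
      obtain y where y: "y \<in> ball 0 1" "y \<notin> g ` V" "x = f y" using x(5) unfolding Us_def by blast
      then have "g x = y" using gf_id[of y] by (simp add: less_imp_le)
      then show False using y(2) \<open>x \<in> V\<close> by blast
    qed
    obtain w where w: "w \<subseteq> tv i" "w \<subseteq> tv j" "\<Delta> i \<inter> \<Delta> j = convex hull w" using tri_Int .
    have xw: "x \<in> convex hull w" using w(3) x by blast
    have finw: "finite w" using w(1) tv_finite finite_subset by blast
    have "card w \<noteq> 0" using xw finw by auto
    moreover have "card w \<noteq> 1"
    proof
      assume "card w = 1"
      then obtain v where "w = {v}" by (auto simp: card_1_singleton_iff)
      then have "x = v" "v \<in> tv i" using xw w(1) by auto
      then show False using xV unfolding V_def by blast
    qed
    moreover have "card w < 3"
    proof -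
      have "i \<noteq> j" using x by blast
      have "w \<noteq> tv i"
      proof
        assume "w = tv i"
        then have "\<Delta> i \<subseteq> \<Delta> j" using w(3) tri_hull[of i] by blast
        then show False using tri_sub \<open>i \<noteq> j\<close> by blast
      qed
      then have "w \<subset> tv i" using w(1) by blast
      then show ?thesis using psubset_card_mono[OF tv_finite] tv_card by metis
    qed
    ultimately have "card w = 2" by linarith
    then obtain a b where ab: "w = {a, b}" "a \<noteq> b" by (auto simp: card_2_iff)
    have "(a, b) \<in> directed_edges (ori i) \<or> (b, a) \<in> directed_edges (ori i)" using tv_edge[of a i b] w ab by blast
    moreover have "(a, b) \<in> directed_edges (ori j) \<or> (b, a) \<in> directed_edges (ori j)" using tv_edge[of a j b] w ab by blast
    moreover have "i \<noteq> j" using x by blast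
    ultimately have "j \<in> G" using closed[OF x(3)] edges_disjoint by blast
    then show False using x by blast
  qed
  have "C1 \<inter> Us = {} \<or> C2 \<inter> Us = {}"
    using conn cover disj cl unfolding connected_closed by blast
  moreover obtain i j where "i \<in> G" "j \<notin> G" using ne nU by blast
  ultimately show False using meet[of i] meet[of j] unfolding C1_def C2_def by blast
qed

lemma contractible_X: "contractible X"
proof -
  have "cball (0 :: real^2) 1 homeomorphic X" using fg(1) unfolding homeomorphic_def by blast
  then show ?thesis using homeomorphic_contractible_eq[of "cball (0 :: real^2) 1" X] convex_imp_contractible[OF convex_cball] by metis
qed

text \<open>An integral cocycle is integrated along a logarithm of the circle-valued map that winds
  around each edge according to the cocycle.\<close>
lemma coh_T:
  fixes h :: "'a \<Rightarrow> 'a \<Rightarrow> int"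
  assumes coc: "\<And>x y z. (x, y, z) \<in> DT \<Longrightarrow> h x y + h y z + h z x = 0"
    and anti: "\<And>x y z. (x, y, z) \<in> DT \<Longrightarrow> h y x = - h x y"
  shows "\<exists>\<theta> :: 'a \<Rightarrow> real. \<forall>x y z. (x, y, z) \<in> DT \<longrightarrow> of_int (h x y) = \<theta> x - \<theta> y"
proof -
  have "\<exists>(L :: 'a \<Rightarrow> real) k. linear L \<and> (\<forall>x\<in>tv i. \<forall>y\<in>tv i. x \<noteq> y \<longrightarrow> of_int (h x y) = L x - L y) \<and> (\<forall>x\<in>tv i. L x + k \<in> \<int>)" for i
  proof -
    obtain a b c where abc: "ori i = (a, b, c)" by (cases "ori i") auto
    have d: "a \<noteq> b" "b \<noteq> c" "a \<noteq> c" using ori_distinct[OF abc] by auto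
    have t: "(a, b, c) \<in> DT" "(b, c, a) \<in> DT" "(c, a, b) \<in> DT"
      by (rule rots_DT[of _ i]; simp add: abc)+
    have tv: "tv i = insert a {b, c}" using abc by (simp add: tv_def)
    have "{x - a |x. x \<in> {b, c}} = {b - a, c - a}" by auto
    then have ind: "independent {b - a, c - a}"
      using tv_indep[of i] affine_dependent_iff_dependent[of a "{b, c}"] d unfolding tv by auto
    \<comment> \<open>Prescribed on the independent edge vectors at \<open>a\<close>. The linear
      extension minus its value at \<open>a\<close> is an affine function with integer values at the
      vertices and differences \<open>h\<close>.\<close>
    define F :: "'a \<Rightarrow> real" where "F x = (if x = b - a then of_int (h b a) else of_int (h c a))" for x
    have "\<exists>L. linear L \<and> (\<forall>x\<in>{b - a, c - a}. L x = F x)" by (rule linear_independent_extend[OF ind])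
    then obtain L :: "'a \<Rightarrow> real" where L: "linear L" "\<forall>x\<in>{b - a, c - a}. L x = F x" by (elim exE conjE)
    have "L (b - a) = of_int (h b a)" "L (c - a) = of_int (h c a)"
      using L(2) d(2) by (simp_all add: F_def)
    then have Lb: "L b - L a = of_int (h b a)" and Lc: "L c - L a = of_int (h c a)"
      using linear_diff[OF L(1)] by simp_all
    have hs: "h a b = - h b a" "h c b = - h b c" "h a c = - h c a" "h b c = h b a - h c a"
      using anti[OF t(1)] anti[OF t(2)] anti[OF t(3)] coc[OF t(1)] by linarith+
    have "\<forall>x\<in>tv i. \<forall>y\<in>tv i. x \<noteq> y \<longrightarrow> of_int (h x y) = L x - L y"
      using Lb Lc hs unfolding tv by auto
    moreover have "\<forall>x\<in>tv i. L x + (- L a) \<in> \<int>"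
    proof -
      have "L b + - L a = of_int (h b a)" "L c + - L a = of_int (h c a)" using Lb Lc by auto
      then show ?thesis unfolding tv by (metis Ints_0 Ints_of_int empty_iff insert_iff right_minus)
    qed
    ultimately show ?thesis using L(1) by blast
  qed
  then obtain L :: "'n \<Rightarrow> 'a \<Rightarrow> real" and k where L: "\<And>i. linear (L i)" "\<And>i x y. x \<in> tv i \<Longrightarrow> y \<in> tv i \<Longrightarrow> x \<noteq> y \<Longrightarrow> of_int (h x y) = L i x - L i y"
      "\<And>i x. x \<in> tv i \<Longrightarrow> L i x + k i \<in> \<int>" by metis
  define H where "H i x = L i x + k i" for i x
  have contH: "continuous_on A (H i)" for A i
    unfolding H_def using L(1) by (intro continuous_intros linear_continuous_on) (simp add: linear_conv_bounded_linear)
  define \<phi> where "\<phi> i x = cis (2 * pi * H i x)" for i x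
  \<comment> \<open>On a common face the affine functions of two triangles differ by a constant,
    because their vertex differences are both given by \<open>h\<close>. The constant is an integer,
    so \<open>cis\<close> does not see it.\<close>
  have agree: "\<phi> i x = \<phi> j x" if x: "x \<in> \<Delta> i" "x \<in> \<Delta> j" for i j x
  proof -
    obtain w where w: "w \<subseteq> tv i" "w \<subseteq> tv j" "\<Delta> i \<inter> \<Delta> j = convex hull w" using tri_Int .
    have xw: "x \<in> convex hull w" using w(3) x by blast
    then have "w \<noteq> {}" by auto
    then obtain v where v: "v \<in> w" by blast
    define \<delta> where "\<delta> = H i v - H j v"
    have "H i u - H j u = \<delta>" if u: "u \<in> w" for u
    proof (cases "u = v")
      case False
      have "u \<in> tv i" "v \<in> tv i" "u \<in> tv j" "v \<in> tv j" using w(1,2) u v by blast+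
      then have "L i u - L i v = L j u - L j v" using L(2)[of u i v] L(2)[of u j v] False by simp
      then show ?thesis by (simp add: \<delta>_def H_def)
    qed (simp add: \<delta>_def)
    then have "w \<subseteq> {u. L i u - L j u = \<delta> - k i + k j}" by (force simp: H_def)
    moreover have "convex {u. L i u - L j u = \<delta> - k i + k j}"
    proof -
      have lin: "linear (\<lambda>u. L i u - L j u)" using L(1) by (intro linear_compose_sub)
      have "{u. L i u - L j u = \<delta> - k i + k j} = (\<lambda>u. L i u - L j u) -` {\<delta> - k i + k j}" by auto
      then show ?thesis using convex_linear_vimage[OF lin convex_singleton] by metis
    qed
    ultimately have "convex hull w \<subseteq> {u. L i u - L j u = \<delta> - k i + k j}"
      by (rule hull_minimal[where S = convex])
    then have "L i x - L j x = \<delta> - k i + k j" using xw by blast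
    then have "H i x - H j x = \<delta>" by (simp add: H_def)
    moreover have "\<delta> \<in> \<int>" unfolding \<delta>_def H_def using L(3)[of v i] L(3)[of v j] v w(1,2) by (intro Ints_diff) blast+
    then obtain n where n: "\<delta> = of_int n" by (auto elim: Ints_cases)
    ultimately have "H i x = H j x + of_int n" by linarith
    then have "\<phi> i x = cis (2 * pi * H j x + 2 * pi * of_int n)"
      by (simp only: \<phi>_def distrib_left)
    also have "\<dots> = cis (2 * pi * H j x) * cis (2 * pi * of_int n)" by (simp only: cis_mult)
    also have "cis (2 * pi * of_int n) = 1" by (rule cis_multiple_2pi) simp
    finally show ?thesis by (simp add: \<phi>_def)
  qed
  obtain \<Phi> where \<Phi>: "continuous_map (top_of_set X) euclidean \<Phi>" "\<And>x i. x \<in> X \<inter> \<Delta> i \<Longrightarrow> \<Phi> x = \<phi> i x"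
  proof (rule pasting_lemma_exists_closed[where I = UNIV and T = \<Delta> and f = \<phi> and X = "top_of_set X" and Y = euclidean])
    show "finite (UNIV :: 'n set)" by simp
    show "topspace (top_of_set X) \<subseteq> \<Union> (range \<Delta>)" using X_cover by auto
    show "closedin (top_of_set X) (\<Delta> i)" for i
      using K_closed[OF tri_K] K_sub[OF tri_K] by (simp add: closed_subset)
    show "continuous_map (subtopology (top_of_set X) (\<Delta> i)) euclidean (\<phi> i)" for i
    proof -
      have "continuous_on (\<Delta> i) (\<phi> i)" unfolding \<phi>_def cis_conv_exp
        by (intro continuous_intros continuous_on_of_real contH)
      moreover have "subtopology (top_of_set X) (\<Delta> i) = top_of_set (\<Delta> i)"
        using K_sub[OF tri_K, of i] by (simp add: subtopology_subtopology Int_absorb1)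
      ultimately show ?thesis by simp
    qed
    show "\<phi> i x = \<phi> j x" if "x \<in> topspace (top_of_set X) \<inter> \<Delta> i \<inter> \<Delta> j" for i j x
      using that agree by auto
  qed auto
  have "continuous_on X \<Phi>" using \<Phi>(1) by simp
  moreover have "\<Phi> x \<noteq> 0" if xX: "x \<in> X" for x
  proof -
    obtain i where "x \<in> \<Delta> i" using X_cover xX by blast
    then show ?thesis using \<Phi>(2)[of x i] xX by (simp add: \<phi>_def)
  qed
  ultimately obtain l where l: "continuous_on X l" "\<And>x. x \<in> X \<Longrightarrow> \<Phi> x = exp (l x)"
    using continuous_logarithm_on_contractible[OF _ contractible_X] by metis
  \<comment> \<open>The logarithm of the pasted circle-valued map, counted in turns. It differs from
    each \<open>H i\<close> by a continuous integer-valued function on a connected triangle, hence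
    by a constant.\<close>
  define \<theta> where "\<theta> x = Im (l x) / (2 * pi)" for x
  have const: "\<theta> x - H i x = \<theta> y - H i y" if xy: "x \<in> \<Delta> i" "y \<in> \<Delta> i" for i x y
  proof -
    have int: "\<theta> z - H i z \<in> \<int>" if z: "z \<in> \<Delta> i" for z
    proof -
      have zX: "z \<in> X" using K_sub[OF tri_K] z by blast
      then have "exp (l z) = exp (\<i> * complex_of_real (2 * pi * H i z))"
        using l(2)[OF zX] \<Phi>(2)[of z i] z by (simp add: \<phi>_def cis_conv_exp)
      then obtain n :: int where "l z = \<i> * complex_of_real (2 * pi * H i z) + (of_int (2 * n) * pi) * \<i>"
        unfolding exp_eq by blast
      then have "Im (l z) = 2 * pi * H i z + 2 * of_int n * pi" by simp
      then have "\<theta> z - H i z = of_int n" by (simp add: \<theta>_def field_simps)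
      then show ?thesis by simp
    qed
    have "(\<lambda>z. \<theta> z - H i z) constant_on \<Delta> i"
    proof (rule continuous_discrete_range_constant)
      show "connected (\<Delta> i)" using K_convex[OF tri_K] by (rule convex_connected)
      have "continuous_on (\<Delta> i) l" using l(1) K_sub[OF tri_K] continuous_on_subset by blast
      then show "continuous_on (\<Delta> i) (\<lambda>z. \<theta> z - H i z)" unfolding \<theta>_def by (intro continuous_intros contH) auto
      fix x assume x: "x \<in> \<Delta> i"
      show "\<exists>e>0. \<forall>y. y \<in> \<Delta> i \<and> \<theta> y - H i y \<noteq> \<theta> x - H i x \<longrightarrow> e \<le> norm (\<theta> y - H i y - (\<theta> x - H i x))"
      proof (intro exI[of _ 1] conjI allI impI)
        fix y assume y: "y \<in> \<Delta> i \<and> \<theta> y - H i y \<noteq> \<theta> x - H i x"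
        then have "\<theta> y - H i y - (\<theta> x - H i x) \<in> \<int>" "\<theta> y - H i y - (\<theta> x - H i x) \<noteq> 0" using int x by auto
        then show "1 \<le> norm (\<theta> y - H i y - (\<theta> x - H i x))" unfolding real_norm_def by (rule Ints_nonzero_abs_ge1)
      qed simp
    qed
    then show ?thesis using xy unfolding constant_on_def by metis
  qed
  have "of_int (h x y) = \<theta> x - \<theta> y" if d: "(x, y, z) \<in> DT" for x y z
  proof -
    obtain i where i: "(x, y) \<in> directed_edges (ori i)" "tv i = {x, y, z}" using DT_edge[OF d] .
    have "x \<in> \<Delta> i" "y \<in> \<Delta> i" unfolding tri_hull using i(2) by (auto intro: hull_inc)
    then have "\<theta> x - \<theta> y = H i x - H i y" using const by fastforce
    also have "\<dots> = of_int (h x y)" using L(2)[of x i y] i(2) DT_dist[OF d] by (simp add: H_def)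
    finally show ?thesis by simp
  qed
  then show ?thesis by blast
qed

end

lemma stress_free_mono:
  assumes "stress_free V E z" "\<And>x y. E' x y \<Longrightarrow> E x y" shows "stress_free V E' z"
  using assms unfolding stress_free_def by blast

section \<open>The sphere obtained by coning off the boundary\<close>

context quad begin

text \<open>A mere label for the cone point: any element that is not a vertex.\<close>

definition apex where "apex = (SOME c. c \<notin> V)"

lemma apex: "apex \<notin> V"
proof -
  have "\<not> bounded (UNIV :: 'a set)" by simp
  then have "V \<noteq> UNIV" using finite_imp_bounded[OF finite_V] by metis
  then have "\<exists>c. c \<notin> V" by blast
  then show ?thesis unfolding apex_def by (rule someI_ex)
qed

text \<open>The sides are reversed in the cone faces, so each is traversed once in either direction.
  The three alternatives are the rotations of a cone face.\<close>

definition DP where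
  "DP = DT \<union> {(x, y, z). (y, x) \<in> Bd \<and> z = apex \<or> (x, z) \<in> Bd \<and> y = apex \<or> (z, y) \<in> Bd \<and> x = apex}"

lemma DP_cases:
  assumes "(x, y, z) \<in> DP"
  obtains (tri) "(x, y, z) \<in> DT" | (base) "(y, x) \<in> Bd" "z = apex" | (up) "(x, z) \<in> Bd" "y = apex" | (down) "(z, y) \<in> Bd" "x = apex"
  using assms unfolding DP_def by blast

lemma DPI: "(x, y, z) \<in> DT \<Longrightarrow> (x, y, z) \<in> DP"
  "(y, x) \<in> Bd \<Longrightarrow> (x, y, apex) \<in> DP" "(x, z) \<in> Bd \<Longrightarrow> (x, apex, z) \<in> DP" "(z, y) \<in> Bd \<Longrightarrow> (apex, y, z) \<in> DP"
  unfolding DP_def by blast+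

lemma Bd_facts:
  assumes "(x, y) \<in> Bd"
  shows "x \<in> V" "y \<in> V" "x \<noteq> y" "(y, x) \<notin> Bd" "\<exists>z. (y, z) \<in> Bd" "\<exists>z. (z, x) \<in> Bd"
    "(x, y') \<in> Bd \<Longrightarrow> y = y'" "(x', y) \<in> Bd \<Longrightarrow> x = x'" "x \<noteq> apex" "y \<noteq> apex"
  using assms Bd_V dist4 apex unfolding Bd_def by auto

lemma Bd_inj: "(x, y) \<in> Bd \<Longrightarrow> (x, y') \<in> Bd \<Longrightarrow> y = y'"
  and Bd_inj2: "(x, y) \<in> Bd \<Longrightarrow> (x', y) \<in> Bd \<Longrightarrow> x = x'"
  and Bd_anti: "(x, y) \<in> Bd \<Longrightarrow> (y, x) \<notin> Bd"
  and Bd_apex: "(apex, y) \<notin> Bd" "(x, apex) \<notin> Bd"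
  and Bd_irrefl: "(x, x) \<notin> Bd"
  by (rule Bd_facts(7), assumption+) (rule Bd_facts(8), assumption+, rule Bd_facts(4), assumption,
      use Bd_facts(3,9,10) in \<open>blast+\<close>)

lemma DT_apex: "(x, y, z) \<in> DT \<Longrightarrow> x \<noteq> apex \<and> y \<noteq> apex \<and> z \<noteq> apex"
  using DT_V apex by blast

lemma DP_rot: "(x, y, z) \<in> DP \<Longrightarrow> (y, z, x) \<in> DP"
  by (erule DP_cases) (auto intro: DPI DT_rot)

lemma DP_uniq:
  assumes 1: "(x, y, z) \<in> DP" and 2: "(x, y, w) \<in> DP" shows "z = w"
  using 1
proof (cases rule: DP_cases)
  case tri
  show ?thesis using 2 by (cases rule: DP_cases) (use tri DT_uniq DT_apex Bd_no_rev Bd_inj Bd_inj2 Bd_apex in blast)+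
next
  case base
  show ?thesis using 2 by (cases rule: DP_cases) (use base Bd_no_rev Bd_apex in blast)+
next
  case up
  show ?thesis using 2 by (cases rule: DP_cases) (use up DT_apex Bd_inj Bd_inj2 Bd_apex Bd_anti in blast)+
next
  case down
  show ?thesis using 2 by (cases rule: DP_cases) (use down DT_apex Bd_inj Bd_inj2 Bd_apex Bd_anti in blast)+
qed

lemma DP_dist: "(x, y, z) \<in> DP \<Longrightarrow> x \<noteq> y"
  by (erule DP_cases) (use DT_dist Bd_irrefl Bd_apex in blast)+

lemma DP_rev: "(x, y, z) \<in> DP \<Longrightarrow> \<exists>w. (y, x, w) \<in> DP"
proof (erule DP_cases)
  assume "(x, y, z) \<in> DT"
  then show ?thesis using DT_rev[of x y z] DPI(1,2) by blast
next
  assume "(y, x) \<in> Bd"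
  then show ?thesis using Bd_DT DPI(1) by blast
next
  assume "(x, z) \<in> Bd" "y = apex"
  then show ?thesis using Bd_facts(6) DPI(4) by blast
next
  assume "(z, y) \<in> Bd" "x = apex"
  then show ?thesis using Bd_facts(5) DPI(3) by blast
qed

lemma DP_conn:
  assumes AD: "A \<subseteq> DP" and ne: "A \<noteq> {}" and rot: "\<And>x y z. (x, y, z) \<in> A \<Longrightarrow> (y, z, x) \<in> A"
    and adj: "\<And>x y z w. (x, y, z) \<in> A \<Longrightarrow> (y, x, w) \<in> DP \<Longrightarrow> (y, x, w) \<in> A"
  shows "A = DP"
proof -
  define G where "G = {i. rots (ori i) \<subseteq> A}"
  have inG: "i \<in> G" if "t \<in> A" "t \<in> rots (ori i)" for t i
  proof -
    obtain a b c where abc: "ori i = (a, b, c)" by (cases "ori i") auto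
    have "t = (a, b, c) \<or> t = (b, c, a) \<or> t = (c, a, b)" using that(2) by (simp add: abc)
    then have a: "(a, b, c) \<in> A" using that(1) rot by blast
    then have "(b, c, a) \<in> A" by (rule rot)
    moreover from this have "(c, a, b) \<in> A" by (rule rot)
    ultimately show ?thesis using a by (simp add: G_def abc)
  qed
  have base: "(y, x, apex) \<in> A" if "t \<in> A" "t = (y, x, apex) \<or> t = (x, apex, y) \<or> t = (apex, y, x)" for x y t
    using that rot by blast
  have "G \<noteq> {}"
  proof -
    obtain x y z where t: "(x, y, z) \<in> A" using ne by auto
    have "\<exists>t\<in>A. t \<in> DT"
    proof -
      have bd: "\<exists>t\<in>A. t \<in> DT" if "(u, v) \<in> Bd" "(v, u, apex) \<in> A" for u v
      proof -
        obtain w where "(u, v, w) \<in> DT" using Bd_DT \<open>(u, v) \<in> Bd\<close> by blast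
        then show ?thesis using adj[OF \<open>(v, u, apex) \<in> A\<close>] DPI(1) by blast
      qed
      have "(x, y, z) \<in> DP" using t AD by blast
      then show ?thesis
      proof (cases rule: DP_cases)
        case tri then show ?thesis using t by blast
      next
        case base then show ?thesis using bd t by blast
      next
        case up
        then have "(z, x, apex) \<in> A" using t rot by blast
        then show ?thesis using bd up by blast
      next
        case down
        then have "(y, z, apex) \<in> A" using t rot by blast
        then show ?thesis using bd down by blast
      qed
    qed
    then show ?thesis using inG unfolding DT_def by blast
  qed
  moreover have "j \<in> G" if i: "i \<in> G" "(x, y) \<in> directed_edges (ori i)" "(y, x) \<in> directed_edges (ori j)" for i j x y
  proof -
    obtain z where "(x, y, z) \<in> rots (ori i)" using edge_DT[OF i(2)] by blast
    then have "(x, y, z) \<in> A" using i(1) unfolding G_def by blast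
    moreover obtain w where w: "(y, x, w) \<in> rots (ori j)" using edge_DT[OF i(3)] by blast
    moreover have "(y, x, w) \<in> DP" using DPI(1) rots_DT[OF w] by blast
    ultimately have "(y, x, w) \<in> A" using adj by blast
    then show ?thesis using inG w by blast
  qed
  ultimately have "G = UNIV" by (rule tri_connected)
  then have DTA: "DT \<subseteq> A" unfolding G_def DT_def by blast
  have bd: "(y, x, apex) \<in> A" if xy: "(x, y) \<in> Bd" for x y
  proof -
    obtain z where "(x, y, z) \<in> DT" using Bd_DT[OF xy] by blast
    then show ?thesis using adj DTA DPI(2)[OF xy] by blast
  qed
  have "t \<in> A" if "t \<in> DP" for t
  proof -
    obtain x y z where t: "t = (x, y, z)" by (cases t) auto
    have "(x, y, z) \<in> DP" using that t by simp
    then have "(x, y, z) \<in> A"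
      by (cases rule: DP_cases) (use DTA bd rot in blast)+
    then show ?thesis using t by simp
  qed
  then show ?thesis using AD by blast
qed

text \<open>The potential on the disk is extended to the apex by prescribing its difference to
  \<open>p\<close>; the cone faces carry the equation on to \<open>q\<close>, \<open>r\<close> and
  \<open>s\<close> in turn.\<close>

lemma DP_coh:
  fixes h :: "'a \<Rightarrow> 'a \<Rightarrow> int"
  assumes coc: "\<And>x y z. (x, y, z) \<in> DP \<Longrightarrow> h x y + h y z + h z x = 0"
    and anti: "\<And>x y z. (x, y, z) \<in> DP \<Longrightarrow> h y x = - h x y"
  shows "\<exists>\<theta> :: 'a \<Rightarrow> real. \<forall>x y z. (x, y, z) \<in> DP \<longrightarrow> of_int (h x y) = \<theta> x - \<theta> y"
proof -
  obtain \<theta>0 :: "'a \<Rightarrow> real" where th0: "\<And>x y z. (x, y, z) \<in> DT \<Longrightarrow> of_int (h x y) = \<theta>0 x - \<theta>0 y"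
    using coh_T[of h] coc anti DPI(1) by metis
  define \<theta> where "\<theta> = \<theta>0(apex := \<theta>0 p + of_int (h apex p))"
  have th: "of_int (h x y) = \<theta> x - \<theta> y" if "(x, y, z) \<in> DT" for x y z
    using th0[OF that] DT_apex[OF that] by (simp add: \<theta>_def)
  have thB: "of_int (h x y) = \<theta> x - \<theta> y" "of_int (h y x) = \<theta> y - \<theta> x" if "(x, y) \<in> Bd" for x y
  proof -
    obtain z where z: "(x, y, z) \<in> DT" using Bd_DT \<open>(x, y) \<in> Bd\<close> by blast
    show "of_int (h x y) = \<theta> x - \<theta> y" using th[OF z] .
    then show "of_int (h y x) = \<theta> y - \<theta> x" using anti[OF DPI(1)[OF z]] by simp
  qed
  have step: "of_int (h apex y) = \<theta> apex - \<theta> y" if "(x, y) \<in> Bd" "of_int (h apex x) = \<theta> apex - \<theta> x" for x y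
  proof -
    have t: "(y, x, apex) \<in> DP" using DPI(2)[OF that(1)] .
    have "h y x + h x apex + h apex y = 0" using coc[OF t] .
    moreover have "h x apex = - h apex x" using anti[OF DPI(4)[OF that(1)]] anti t DP_rot by (metis minus_minus)
    ultimately have "h apex y = h apex x - h y x" by linarith
    then have "real_of_int (h apex y) = of_int (h apex x) - of_int (h y x)" by simp
    then show ?thesis using thB(2)[OF that(1)] that(2) by simp
  qed
  have "p \<noteq> apex" using Bd_V(1) apex by blast
  then have ap: "of_int (h apex p) = \<theta> apex - \<theta> p" by (simp add: \<theta>_def)
  have aq: "of_int (h apex q) = \<theta> apex - \<theta> q" by (rule step[OF _ ap]) (simp add: Bd_def)
  have ar: "of_int (h apex r) = \<theta> apex - \<theta> r" by (rule step[OF _ aq]) (simp add: Bd_def)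
  have as: "of_int (h apex s) = \<theta> apex - \<theta> s" by (rule step[OF _ ar]) (simp add: Bd_def)
  have apx: "of_int (h apex x) = \<theta> apex - \<theta> x" if "(x, y) \<in> Bd \<or> (y, x) \<in> Bd" for x y
    using that ap aq ar as unfolding Bd_def by auto
  have "of_int (h x y) = \<theta> x - \<theta> y" if d: "(x, y, z) \<in> DP" for x y z
    using d
  proof (cases rule: DP_cases)
    case tri then show ?thesis by (rule th)
  next
    case base then show ?thesis using thB(2) by blast
  next
    case up
    have "h y x = - h x y" using anti[OF d] .
    moreover have "of_int (h apex x) = \<theta> apex - \<theta> x" using apx up(1) by blast
    ultimately show ?thesis using up by simp
  next
    case down
    then show ?thesis using apx by blast
  qed
  then show ?thesis by blast
qed

lemma sphere_tri_DP: "sphere_tri DP"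
proof
  have "DP \<subseteq> DT \<union> insert apex V \<times> insert apex V \<times> insert apex V"
    unfolding DP_def using Bd_facts(1,2) by blast
  then show "finite DP" using finite_DT finite_V by (auto intro: finite_subset)
  show "DP \<noteq> {}" using DPI(2)[of p q] by (auto simp: Bd_def)
  show "A = DP" if "A \<subseteq> DP" "A \<noteq> {}" "\<And>x y z. (x, y, z) \<in> A \<Longrightarrow> (y, z, x) \<in> A"
    "\<And>x y z w. (x, y, z) \<in> A \<Longrightarrow> (y, x, w) \<in> DP \<Longrightarrow> (y, x, w) \<in> A" for A
    using that by (rule DP_conn)
  show "\<exists>\<theta>. \<forall>x y z. (x, y, z) \<in> DP \<longrightarrow> real_of_int (h x y) = \<theta> x - \<theta> y"
    if "\<And>x y z. (x, y, z) \<in> DP \<Longrightarrow> h x y + h y z + h z x = 0"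
      "\<And>x y z. (x, y, z) \<in> DP \<Longrightarrow> h y x = - h x y" for h
    using that by (rule DP_coh)
qed (fact DP_rot DP_dist DP_uniq DP_rev)+

definition edge :: "'a \<Rightarrow> 'a \<Rightarrow> bool" where
  "edge x y \<longleftrightarrow> (\<exists>i. (x, y) \<in> directed_edges (ori i) \<or> (y, x) \<in> directed_edges (ori i))"

lemma adj_DP_edge:
  assumes "x \<noteq> apex" "y \<noteq> apex" shows "sphere_tri.adj DP x y \<longleftrightarrow> edge x y"
proof
  interpret D: sphere_tri DP by (rule sphere_tri_DP)
  show "edge x y" if "D.adj x y"
  proof -
    obtain z where d: "(x, y, z) \<in> DP" using \<open>D.adj x y\<close> by (auto simp: D.adj_def)
    then have "(x, y, z) \<in> DT \<or> (y, x) \<in> Bd" by (cases rule: DP_cases) (use assms in auto)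
    then have "(\<exists>z. (x, y, z) \<in> DT) \<or> (\<exists>z. (y, x, z) \<in> DT)" using Bd_DT by blast
    then show ?thesis unfolding edge_def by (meson DT_edge)
  qed
  show "D.adj x y" if "edge x y"
  proof -
    have "D.adj x y \<or> D.adj y x" using \<open>edge x y\<close> edge_in_DT DPI(1) unfolding edge_def D.adj_def by meson
    then show ?thesis using D.adj_sym by blast
  qed
qed

text \<open>The 3-cycle \<open>apex p r\<close> separates \<open>s\<close> from \<open>q\<close>.
  Its region contains the face \<open>apex p s\<close>; as \<open>s\<close> and \<open>q\<close> are
  off the cycle, an edge \<open>q s\<close> would carry the region on to the face
  \<open>apex q p\<close> on the other side of \<open>apex p\<close>.\<close>

lemma diagonals_not_both: "\<not> (edge p r \<and> edge q s)"
proof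
  assume e: "edge p r \<and> edge q s"
  interpret D: sphere_tri DP by (rule sphere_tri_DP)
  have na: "p \<noteq> apex" "q \<noteq> apex" "r \<noteq> apex" "s \<noteq> apex" using Bd_V apex by blast+
  have d: "p \<noteq> q" "p \<noteq> r" "p \<noteq> s" "q \<noteq> r" "q \<noteq> s" "r \<noteq> s" using dist4 by auto
  have cps: "(apex, p, s) \<in> DP" and cqp: "(apex, q, p) \<in> DP" and rcs: "(r, apex, s) \<in> DP"
    using DPI(3,4) by (auto simp: Bd_def)
  have adj: "D.adj apex p" "D.adj p r" "D.adj r apex"
    using cps rcs e adj_DP_edge na by (auto simp: D.adj_def)
  have qs: "D.adj q s" "D.adj s q" "D.adj q apex"
    using e adj_DP_edge na D.adj_sym D.adj_tri[OF cqp] by blast+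
  obtain B where B: "D.region B apex p r" using D.region_exists[OF adj] .
  have rc: "D.rotclosed B" and bd: "\<And>x y. D.bdry B x y = D.cyc apex p r x y" using B by (auto simp: D.region_def)
  have s0: "D.bdry B s y = 0" and q0: "D.bdry B q y = 0" for y
    unfolding bd D.cyc_def using na d by auto
  have "D.bdry B apex p = 1" unfolding bd D.cyc_def using na d by auto
  then have l: "D.left B apex p" "\<not> D.left B p apex" using D.bdry_eq_1 by blast+
  have "(apex, p, s) \<in> B" using D.leftD[OF rc l(1) cps] .
  then have "D.left B s apex" using D.rotclosed_rot2[OF rc] unfolding D.left_def by blast
  then have "D.left B q s" using D.star_inside(2)[OF rc s0 _ qs(2)] by blast
  then have "D.left B apex q" using D.star_inside(2)[OF rc q0 _ qs(3)] by blast
  then have "(apex, q, p) \<in> B" using D.leftD[OF rc _ cqp] by blast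
  then have "(p, apex, q) \<in> B" using D.rotclosed_rot2[OF rc] by blast
  then show False using l(2) unfolding D.left_def by blast
qed

lemma DP_no_opposite: "(x, y, z) \<in> DP \<Longrightarrow> (y, x, z) \<notin> DP"
proof
  assume 1: "(x, y, z) \<in> DP" and 2: "(y, x, z) \<in> DP"
  have DT2: False if d: "(u, v, w) \<in> DT" "(v, u, w) \<in> DT" for u v w
  proof -
    obtain i where i: "(u, v) \<in> directed_edges (ori i)" "tv i = {u, v, w}" using DT_edge[OF d(1)] .
    obtain j where j: "(v, u) \<in> directed_edges (ori j)" "tv j = {v, u, w}" using DT_edge[OF d(2)] .
    have "tv i = tv j" using i(2) j(2) by auto
    then have "i = j" using inj_tri tri_hull by metis
    then show False using edge_tv(4)[OF i(1)] j(1) by blast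
  qed
  have two: "(b, c) \<notin> Bd" if "(a, b) \<in> Bd" "(c, a) \<in> Bd" for a b c
    using that dist4 unfolding Bd_def by auto
  from 1 show False
  proof (cases rule: DP_cases)
    case tri
    from 2 show ?thesis by (cases rule: DP_cases) (use tri DT2 DT_apex in blast)+
  next
    case base
    from 2 show ?thesis by (cases rule: DP_cases) (use base DT_apex Bd_inj Bd_inj2 Bd_apex Bd_anti in blast)+
  next
    case up
    from 2 show ?thesis by (cases rule: DP_cases) (use up DT_apex Bd_inj Bd_inj2 Bd_apex Bd_anti in blast)+
  next
    case down
    from 2 show ?thesis by (cases rule: DP_cases) (use down DT_apex Bd_inj Bd_inj2 Bd_apex Bd_anti in blast)+
  qed
qed

text \<open>Contracting the edge from \<open>apex\<close> to \<open>p\<close> removes the apex and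
  turns its edge to \<open>r\<close> into \<open>p r\<close>. The link condition is where
  \<open>p r\<close> must not be an edge: \<open>r\<close> would be a third common neighbour of
  \<open>p\<close> and the apex.\<close>

theorem generic_positions:
  assumes npr: "\<not> edge p r"
  shows "\<exists>z. stress_free V (\<lambda>x y. edge x y \<or> {x, y} = {p, r}) z"
proof -
  interpret D: sphere_tri DP by (rule sphere_tri_DP)
  have na: "p \<noteq> apex" "q \<noteq> apex" "r \<noteq> apex" "s \<noteq> apex" using Bd_V apex by blast+
  have apex_nbr: "w \<in> {p, q, r, s}" if "D.adj apex w" for w
  proof -
    obtain z where "(apex, w, z) \<in> DP" using \<open>D.adj apex w\<close> by (auto simp: D.adj_def)
    then show ?thesis by (cases rule: DP_cases) (use DT_apex Bd_facts(9,10) in \<open>auto simp: Bd_def\<close>)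
  qed
  interpret C: contraction DP p apex q s
  proof
    show "(p, apex, q) \<in> DP" "(apex, p, s) \<in> DP" using DPI(3,4) by (auto simp: Bd_def)
    show "w = q \<or> w = s" if w: "D.adj p w" "D.adj apex w" for w
    proof -
      have "w \<noteq> p" using D.adj_irrefl[OF w(1)] by blast
      moreover have "w \<noteq> r" using w(1) npr adj_DP_edge[of p r] na by blast
      ultimately show ?thesis using apex_nbr[OF w(2)] by blast
    qed
    show "(y, x, z) \<notin> DP" if "(x, y, z) \<in> DP" for x y z using that by (rule DP_no_opposite)
  qed
  interpret D': sphere_tri "D.contract p apex" by (rule C.sphere_tri_contract)
  have V': "fst ` D.contract p apex \<subseteq> V"
  proof
    fix x assume "x \<in> fst ` D.contract p apex"
    then obtain y z where "(x, y, z) \<in> D.contract p apex" by auto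
    then obtain x0 y0 z0 where x0: "(x0, y0, z0) \<in> DP" "x = C.\<pi> x0" by (rule C.D'E)
    from x0(1) have "x0 \<in> V \<or> x0 = apex" by (cases rule: DP_cases) (use DT_V Bd_facts(1,2) in blast)+
    then show "x \<in> V" using x0(2) Bd_V by (auto simp: C.\<pi>_def)
  qed
  obtain z where z: "stress_free V D'.adj z"
    using stress_free_exists[OF C.sphere_tri_contract finite_V V'] by blast
  have e: "D'.adj (C.\<pi> x) (C.\<pi> y)" if a: "D.adj x y" "{x, y} \<noteq> {p, apex}" for x y
  proof -
    obtain w where "(x, y, w) \<in> DP" using a(1) by (auto simp: D.adj_def)
    then show ?thesis using C.edge_D' a(2) unfolding D'.adj_def by blast
  qed
  have "stress_free V (\<lambda>x y. edge x y \<or> {x, y} = {p, r}) z"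
  proof (rule stress_free_mono[OF z])
    fix x y assume "edge x y \<or> {x, y} = {p, r}"
    then show "D'.adj x y"
    proof
      assume ed: "edge x y"
      then obtain i where "(x, y) \<in> directed_edges (ori i) \<or> (y, x) \<in> directed_edges (ori i)" unfolding edge_def by blast
      then have "x \<in> tv i" "y \<in> tv i" using edge_tv by blast+
      then have n: "x \<noteq> apex" "y \<noteq> apex" using apex unfolding V_def by blast+
      then have "D.adj x y" using adj_DP_edge ed by blast
      moreover have "{x, y} \<noteq> {p, apex}" using n by auto
      ultimately have "D'.adj (C.\<pi> x) (C.\<pi> y)" by (rule e)
      then show ?thesis using n by (simp add: C.\<pi>_def)
    next
      assume xy: "{x, y} = {p, r}"
      have "(apex, r, q) \<in> DP" using DPI(4) by (auto simp: Bd_def)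
      then have "D.adj apex r" "D.adj r apex" using D.adj_tri by blast+
      then have "D'.adj (C.\<pi> apex) (C.\<pi> r)" "D'.adj (C.\<pi> r) (C.\<pi> apex)"
        using e[of apex r] e[of r apex] na dist4 by auto
      then have "D'.adj p r" "D'.adj r p" using na by (auto simp: C.\<pi>_def)
      then show ?thesis using xy by (auto simp: doubleton_eq_iff)
    qed
  qed
  then show ?thesis by blast
qed

end

lemma quad_rotate: "quad K p q r s \<Delta> ori \<Longrightarrow> quad K q r s p \<Delta> ori"
proof -
  assume "quad K p q r s \<Delta> ori"
  then interpret quad K p q r s \<Delta> ori .
  obtain f g where fg: "homeomorphism (cball (0 :: real^2) 1) (\<Union>K) f g" "complex_vertices K \<inter> f ` sphere 0 1 = {p, q, r, s}"
    "f ` sphere 0 1 = closed_segment p q \<union> closed_segment q r \<union> closed_segment r s \<union> closed_segment s p"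
    using quad unfolding quad_triangulation_def by (elim conjE exE) (rule that)
  show ?thesis
  proof
    have "complex_vertices K \<inter> f ` sphere 0 1 = {q, r, s, p}" using fg(2) by auto
    moreover have "f ` sphere 0 1 = closed_segment q r \<union> closed_segment r s \<union> closed_segment s p \<union> closed_segment p q"
      using fg(3) by (simp add: Un_ac)
    ultimately show "quad_triangulation K q r s p"
      unfolding quad_triangulation_def using sc dist4 fg(1) by (intro conjI exI[of _ f] exI[of _ g]) auto
    show "boundary_orientation \<Delta> q r s p ori"
      using ori unfolding boundary_orientation_def by auto
  qed (rule bij)
qed

section \<open>The derivative of the area map\<close>

text \<open>Cramer's rule with the denominator cleared.\<close>

lemma triple_expand:
  fixes x u v w :: "real^3"
  shows "triple u v w *\<^sub>R x = triple x v w *\<^sub>R u + triple u x w *\<^sub>R v + triple u v x *\<^sub>R w"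
  unfolding vec3_eq_iff by (simp add: triple_def) (intro conjI; algebra)

lemma crs_sum_right: "crs u (sum f A) = (\<Sum>x\<in>A. crs u (f x))"
  by (simp add: crs_def sum_distrib_left sum_subtractf)

lemma crs_scaleR_right: "crs u (c *\<^sub>R v) = c * crs u v"
  by (simp add: crs_def algebra_simps)

lemma crs_all_0: "(\<And>e. crs e u = 0) \<Longrightarrow> u = 0"
proof -
  assume a: "\<And>e. crs e u = 0"
  show "u = 0" using a[of "vector [1, 0]"] a[of "vector [0, 1]"]
    by (simp add: crs_def vec_eq_iff forall_2)
qed

text \<open>The antisymmetric 1-chain of a single directed edge.\<close>

definition bde :: "'a \<Rightarrow> 'a \<Rightarrow> 'a \<Rightarrow> 'a \<Rightarrow> real" where
  "bde a b x y = of_bool (x = a \<and> y = b) - of_bool (x = b \<and> y = a)"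

lemma bde_swap: "bde a b y x = - bde a b x y"
  by (simp add: bde_def conj_commute)

context quad begin

lemma edge_V: "edge x y \<Longrightarrow> x \<in> V \<and> y \<in> V \<and> x \<noteq> y"
proof -
  assume "edge x y"
  then obtain i where "(x, y) \<in> directed_edges (ori i) \<or> (y, x) \<in> directed_edges (ori i)"
    unfolding edge_def ..
  then have "x \<in> tv i \<and> y \<in> tv i \<and> x \<noteq> y" using edge_tv[of x y i] edge_tv[of y x i] by metis
  then show ?thesis unfolding V_def by blast
qed

lemma edge_sym: "edge x y \<Longrightarrow> edge y x"
  unfolding edge_def by blast

text \<open>The planar form of \<open>stress_free\<close>: the condition on plain row sums takes the
  place of the homogenising third coordinate.\<close>

definition flat_stress_free :: "('a \<Rightarrow> real^2) \<Rightarrow> bool" where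
  "flat_stress_free \<rho> \<longleftrightarrow> (\<forall>t. (\<forall>x y. t y x = - t x y) \<longrightarrow> (\<forall>x y. t x y \<noteq> 0 \<longrightarrow> edge x y \<or> {x, y} = {p, r}) \<longrightarrow>
     (\<forall>x\<in>V. (\<Sum>y\<in>V. t x y) = 0) \<longrightarrow> (\<forall>x\<in>V. (\<Sum>y\<in>V. t x y *\<^sub>R \<rho> y) = 0) \<longrightarrow> (\<forall>x y. t x y = 0))"

text \<open>A projective map takes four points in general position to the corners of the unit
  square. In homogeneous coordinates it is a linear change of basis followed by rescaling each
  vector, and both carry stresses to stresses.\<close>

lemma square_drawing_exists:
  assumes npr: "\<not> edge p r"
  shows "\<exists>\<rho>. \<rho> p = vector [0, 0] \<and> \<rho> q = vector [1, 0] \<and> \<rho> r = vector [1, 1] \<and> \<rho> s = vector [0, 1] \<and> flat_stress_free \<rho>"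
proof -
  define E where "E x y \<longleftrightarrow> edge x y \<or> {x, y} = {p, r}" for x y
  have EV: "x \<in> V \<and> y \<in> V" if "E x y" for x y
    using that edge_V Bd_V unfolding E_def by (auto simp: doubleton_eq_iff)
  obtain z0 where z0: "stress_free V E z0" using generic_positions[OF npr] unfolding E_def by blast
  obtain z where z: "stress_free V E z"
    and gen: "\<And>a b c. a \<in> V \<Longrightarrow> b \<in> V \<Longrightarrow> c \<in> V \<Longrightarrow> distinct [a, b, c] \<Longrightarrow> triple (z a) (z b) (z c) \<noteq> 0"
    using stress_free_generic[OF finite_V EV z0] by metis
  \<comment> \<open>These determinants are, up to sign, the coefficients of the linear relation
    between the four corner vectors. Used as scale factors they turn it into the parallelogram
    relation \<open>v + w - u\<close> for the fourth corner.\<close>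
  define \<alpha> where "\<alpha> = triple (z q) (z r) (z s)"
  define \<beta> where "\<beta> = triple (z p) (z r) (z s)"
  define \<gamma> where "\<gamma> = triple (z p) (z q) (z s)"
  define \<delta> where "\<delta> = triple (z p) (z q) (z r)"
  have nz: "\<alpha> \<noteq> 0" "\<beta> \<noteq> 0" "\<gamma> \<noteq> 0" "\<delta> \<noteq> 0"
    unfolding \<alpha>_def \<beta>_def \<gamma>_def \<delta>_def
    using gen[of q r s] gen[of p r s] gen[of p q s] gen[of p q r] dist4 Bd_V by simp_all
  define u where "u = \<alpha> *\<^sub>R z p"
  define v where "v = \<beta> *\<^sub>R z q"
  define w where "w = \<delta> *\<^sub>R z s"
  define T where "T = triple u v w"
  have T: "T \<noteq> 0"
  proof -
    have "T = \<alpha> * \<beta> * \<delta> * \<gamma>" unfolding T_def u_def v_def w_def \<gamma>_def triple_def by (simp add: algebra_simps)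
    then show ?thesis using nz by simp
  qed
  have rel: "\<gamma> *\<^sub>R z r = v + w - u"
    unfolding u_def v_def w_def \<alpha>_def \<beta>_def \<gamma>_def \<delta>_def vec3_eq_iff triple_def by (simp; intro conjI; algebra)
  define A where "A x = triple x v w / T" for x
  define B where "B x = triple u x w / T" for x
  define C where "C x = triple u v x / T" for x
  \<comment> \<open>The functional that is 1 on the three scaled corners, hence also on the fourth;
    dividing by it dehomogenises.\<close>
  define l where "l x = A x + B x + C x" for x
  have ABC: "A (c *\<^sub>R x) = c * A x" "B (c *\<^sub>R x) = c * B x" "C (c *\<^sub>R x) = c * C x"
      "A (x + y) = A x + A y" "B (x + y) = B x + B y" "C (x + y) = C x + C y" for c x y
    unfolding A_def B_def C_def triple_def using T by (simp_all add: field_simps)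
  have l_lin: "l (c *\<^sub>R x) = c * l x" "l (x + y) = l x + l y" for c x y
    by (simp_all add: l_def ABC algebra_simps)
  have corner: "A u = 1" "B u = 0" "C u = 0" "A v = 0" "B v = 1" "C v = 0" "A w = 0" "B w = 0" "C w = 1"
    using T unfolding A_def B_def C_def T_def by (simp_all add: triple_def algebra_simps)
  have expand: "x = A x *\<^sub>R u + B x *\<^sub>R v + C x *\<^sub>R w" for x
  proof -
    have "T *\<^sub>R x = T *\<^sub>R (A x *\<^sub>R u + B x *\<^sub>R v + C x *\<^sub>R w)"
      using triple_expand[of u v w x] T by (simp add: A_def B_def C_def T_def[symmetric] scaleR_add_right)
    then show ?thesis using T by (simp only: scaleR_left_imp_eq[OF T])
  qed
  have luvw: "l u = 1" "l v = 1" "l w = 1" by (simp_all add: l_def corner)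
  obtain \<epsilon> where \<epsilon>: "\<epsilon> > 0" "\<And>z'. (\<And>x. x \<in> V \<Longrightarrow> norm (z' x - z x) < \<epsilon>) \<Longrightarrow> stress_free V E z'"
    using stress_free_open[OF finite_V EV z] by metis
  have "finite ((\<lambda>x. - l (z x)) ` V)" using finite_V by simp
  moreover have "infinite {0<..<\<epsilon> / (norm u + 1)}" using \<epsilon>(1) by (intro infinite_Ioo divide_pos_pos) (auto intro: add_nonneg_pos)
  ultimately obtain t where t: "t \<in> {0<..<\<epsilon> / (norm u + 1)}" "t \<notin> (\<lambda>x. - l (z x)) ` V"
    by (meson finite_subset subsetI)
  \<comment> \<open>Since \<open>l u = 1\<close>, the shift adds \<open>t\<close> to
    \<open>l\<close>, and all but finitely many \<open>t\<close> avoid a zero. The corners, where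
    \<open>l\<close> is nonzero already, stay put.\<close>
  define z' where "z' x = (if x \<in> {p, q, r, s} then z x else z x + t *\<^sub>R u)" for x
  have sf: "stress_free V E z'"
  proof (rule \<epsilon>(2))
    fix x assume "x \<in> V"
    have "t * norm u \<le> t * (norm u + 1)" using t by (intro mult_left_mono) auto
    also have "\<dots> < \<epsilon>"
    proof -
      have "norm u + 1 > 0" by (intro add_nonneg_pos) auto
      then show ?thesis using t(1) by (simp add: pos_less_divide_eq)
    qed
    finally show "norm (z' x - z x) < \<epsilon>" using t \<epsilon>(1) by (simp add: z'_def)
  qed
  have lp: "\<alpha> * l (z p) = 1" "\<beta> * l (z q) = 1" "\<delta> * l (z s) = 1"
    using luvw by (simp_all add: u_def v_def w_def l_lin)
  have lr: "\<gamma> * l (z r) = 1"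
  proof -
    have "l (\<gamma> *\<^sub>R z r) = l (v + w + (- 1) *\<^sub>R u)" using rel by simp
    then show ?thesis by (simp only: l_lin luvw)
  qed
  have lz': "l (z' x) \<noteq> 0" if "x \<in> V" for x
  proof (cases "x \<in> {p, q, r, s}")
    case True
    then have "l (z x) \<noteq> 0" using lp lr by auto
    then show ?thesis using True by (simp add: z'_def)
  next
    case False
    have "t \<noteq> - l (z x)" using t(2) that by blast
    then show ?thesis using False luvw by (simp add: z'_def l_lin)
  qed
  define \<zeta> where "\<zeta> x = (1 / l (z' x)) *\<^sub>R z' x" for x
  have \<zeta>c: "\<zeta> p = u" "\<zeta> q = v" "\<zeta> s = w" "\<zeta> r = v + w - u"
  proof -
    have "1 / l (z p) = \<alpha>" "1 / l (z q) = \<beta>" "1 / l (z s) = \<delta>" "1 / l (z r) = \<gamma>"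
      using lp lr inverse_unique[of "l (z p)" \<alpha>] inverse_unique[of "l (z q)" \<beta>] inverse_unique[of "l (z s)" \<delta>]
        inverse_unique[of "l (z r)" \<gamma>] by (simp_all add: inverse_eq_divide mult.commute)
    then show "\<zeta> p = u" "\<zeta> q = v" "\<zeta> s = w" "\<zeta> r = v + w - u"
      using rel by (simp_all add: \<zeta>_def z'_def u_def v_def w_def)
  qed
  have l1: "l (\<zeta> x) = 1" if "x \<in> V" for x using lz'[OF that] by (simp add: \<zeta>_def l_lin)
  define \<rho> :: "'a \<Rightarrow> real^2" where "\<rho> x = vector [B (\<zeta> x), C (\<zeta> x)]" for x
  have "\<rho> r = vector [1, 1]"
  proof -
    have "\<zeta> r = v + w + (- 1) *\<^sub>R u" by (simp add: \<zeta>c)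
    then show ?thesis by (simp only: \<rho>_def ABC corner) simp
  qed
  moreover have "\<rho> p = vector [0, 0]" "\<rho> q = vector [1, 0]" "\<rho> s = vector [0, 1]"
    by (simp_all add: \<rho>_def \<zeta>c corner)
  moreover have "flat_stress_free \<rho>"
    unfolding flat_stress_free_def
  proof (intro allI impI)
    fix k :: "'a \<Rightarrow> 'a \<Rightarrow> real" and x0 y0
    assume anti: "\<forall>x y. k y x = - k x y" and supp: "\<forall>x y. k x y \<noteq> 0 \<longrightarrow> edge x y \<or> {x, y} = {p, r}"
      and row0: "\<forall>x\<in>V. (\<Sum>y\<in>V. k x y) = 0" and row: "\<forall>x\<in>V. (\<Sum>y\<in>V. k x y *\<^sub>R \<rho> y) = 0"
    have rowz: "(\<Sum>y\<in>V. k x y *\<^sub>R \<zeta> y) = 0" if x: "x \<in> V" for x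
    proof -
      have b: "(\<Sum>y\<in>V. k x y * B (\<zeta> y)) = 0" "(\<Sum>y\<in>V. k x y * C (\<zeta> y)) = 0"
        using arg_cong[OF row[rule_format, OF x], of "\<lambda>v. v $ 1"] arg_cong[OF row[rule_format, OF x], of "\<lambda>v. v $ 2"]
        by (simp_all add: \<rho>_def)
      have "(\<Sum>y\<in>V. k x y * A (\<zeta> y)) = (\<Sum>y\<in>V. k x y * (1 - B (\<zeta> y) - C (\<zeta> y)))"
      proof (intro sum.cong refl)
        fix y assume "y \<in> V"
        then have "A (\<zeta> y) = 1 - B (\<zeta> y) - C (\<zeta> y)" using l1[of y] by (simp add: l_def)
        then show "k x y * A (\<zeta> y) = k x y * (1 - B (\<zeta> y) - C (\<zeta> y))" by (rule arg_cong)
      qed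
      also have "\<dots> = 0" using b row0[rule_format, OF x] by (simp add: right_diff_distrib sum_subtractf)
      finally have a: "(\<Sum>y\<in>V. k x y * A (\<zeta> y)) = 0" .
      have "(\<Sum>y\<in>V. k x y *\<^sub>R \<zeta> y) = (\<Sum>y\<in>V. k x y *\<^sub>R (A (\<zeta> y) *\<^sub>R u + B (\<zeta> y) *\<^sub>R v + C (\<zeta> y) *\<^sub>R w))"
        by (intro sum.cong refl arg_cong[where f = "\<lambda>v. _ *\<^sub>R v"]) (rule expand)
      also have "\<dots> = (\<Sum>y\<in>V. k x y * A (\<zeta> y)) *\<^sub>R u + (\<Sum>y\<in>V. k x y * B (\<zeta> y)) *\<^sub>R v + (\<Sum>y\<in>V. k x y * C (\<zeta> y)) *\<^sub>R w"
        by (simp add: scaleR_add_right sum.distrib scaleR_sum_left)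
      finally show ?thesis using a b by simp
    qed
    \<comment> \<open>Dividing the positions by \<open>l\<close> is compensated by dividing the edge
      values at both ends.\<close>
    define k' where "k' x y = k x y / (l (z' x) * l (z' y))" for x y
    have "\<forall>x y. k' x y = 0"
    proof (rule sf[unfolded stress_free_def, THEN spec, THEN mp, THEN mp, THEN mp]; (intro allI ballI impI)?)
      fix x y
      show "k' y x = - k' x y" using anti[rule_format, of x y] by (simp add: k'_def mult.commute)
      show "E x y" if "k' x y \<noteq> 0" using that supp unfolding E_def k'_def by fastforce
      show "(\<Sum>y\<in>V. k' x y *\<^sub>R z' y) = 0" if x: "x \<in> V"
      proof -
        have "(\<Sum>y\<in>V. k' x y *\<^sub>R z' y) = (1 / l (z' x)) *\<^sub>R (\<Sum>y\<in>V. k x y *\<^sub>R \<zeta> y)"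
          unfolding scaleR_sum_right by (intro sum.cong refl) (simp add: k'_def \<zeta>_def)
        then show ?thesis using rowz[OF x] by simp
      qed
    qed
    then have k0: "k x0 y0 / (l (z' x0) * l (z' y0)) = 0" unfolding k'_def by blast
    show "k x0 y0 = 0"
    proof (rule ccontr)
      assume n: "k x0 y0 \<noteq> 0"
      then have "E x0 y0" using supp unfolding E_def by blast
      then have "x0 \<in> V" "y0 \<in> V" using EV by blast+
      then show False using lz' k0 n by simp
    qed
  qed
  ultimately show ?thesis by blast
qed

section \<open>The cokernel of the area derivative\<close>

definition area_deriv :: "('a \<Rightarrow> real^2) \<Rightarrow> ('a \<Rightarrow> real^2) \<Rightarrow> 'n \<Rightarrow> real" where
  "area_deriv \<rho> \<mu> i = tri_sum (\<lambda>x y. (crs (\<mu> x) (\<rho> y) - crs (\<mu> y) (\<rho> x)) / 2) (ori i)"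

definition wt :: "real^'n \<Rightarrow> 'a \<Rightarrow> 'a \<Rightarrow> real" where
  "wt \<omega> x y = (\<Sum>i\<in>UNIV. \<omega> $ i * of_bool ((x, y) \<in> directed_edges (ori i)))"

text \<open>Difference of the weights on the two sides of an edge, the outside of the disk counting
  0. In this way weights on triangles become antisymmetric edge functions.\<close>

definition jump :: "real^'n \<Rightarrow> 'a \<Rightarrow> 'a \<Rightarrow> real" where
  "jump \<omega> x y = wt \<omega> x y - wt \<omega> y x"

lemma tri_sum_pairs: "tri_sum \<kappa> (ori i) = (\<Sum>x\<in>V. \<Sum>y\<in>V. of_bool ((x, y) \<in> directed_edges (ori i)) * \<kappa> x y)"
proof -
  obtain a b c where abc: "ori i = (a, b, c)" by (cases "ori i") auto
  have sub: "directed_edges (ori i) \<subseteq> V \<times> V" unfolding V_def using edge_tv(1,2) by fastforce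
  have "tri_sum \<kappa> (ori i) = (\<Sum>e\<in>directed_edges (ori i). \<kappa> (fst e) (snd e))"
    using ori_distinct[OF abc] abc by (simp add: tri_sum_def)
  also have "\<dots> = (\<Sum>e\<in>V \<times> V. of_bool (e \<in> directed_edges (ori i)) * \<kappa> (fst e) (snd e))"
    using sub finite_V by (intro sum.mono_neutral_cong_left) auto
  also have "\<dots> = (\<Sum>x\<in>V. \<Sum>y\<in>V. of_bool ((x, y) \<in> directed_edges (ori i)) * \<kappa> x y)"
    by (simp add: sum.cartesian_product split_def)
  finally show ?thesis .
qed

lemma pairing: "(\<Sum>i\<in>UNIV. \<omega> $ i * tri_sum \<kappa> (ori i)) = (\<Sum>x\<in>V. \<Sum>y\<in>V. wt \<omega> x y * \<kappa> x y)"
proof -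
  have "(\<Sum>i\<in>UNIV. \<omega> $ i * tri_sum \<kappa> (ori i)) =
      (\<Sum>i\<in>UNIV. \<Sum>x\<in>V. \<Sum>y\<in>V. \<omega> $ i * of_bool ((x, y) \<in> directed_edges (ori i)) * \<kappa> x y)"
    by (simp only: tri_sum_pairs sum_distrib_left mult.assoc)
  also have "\<dots> = (\<Sum>x\<in>V. \<Sum>i\<in>UNIV. \<Sum>y\<in>V. \<omega> $ i * of_bool ((x, y) \<in> directed_edges (ori i)) * \<kappa> x y)"
    by (rule sum.swap)
  also have "\<dots> = (\<Sum>x\<in>V. \<Sum>y\<in>V. \<Sum>i\<in>UNIV. \<omega> $ i * of_bool ((x, y) \<in> directed_edges (ori i)) * \<kappa> x y)"
    by (intro sum.cong refl sum.swap)
  finally show ?thesis by (simp only: wt_def sum_distrib_right)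
qed

text \<open>Each triangle at \<open>x\<close> enters with one outgoing and one incoming edge;
  formally, the coboundary of the indicator of \<open>x\<close> sums to zero on every
  triangle.\<close>

lemma jump_row: assumes x: "x \<in> V" shows "(\<Sum>y\<in>V. jump \<omega> x y) = 0"
proof -
  define \<kappa> :: "'a \<Rightarrow> 'a \<Rightarrow> real" where "\<kappa> a b = of_bool (a = x) - of_bool (b = x)" for a b
  have t0: "tri_sum \<kappa> (ori i) = 0" for i by (cases "ori i") (simp add: tri_sum_def \<kappa>_def)
  have "0 = (\<Sum>a\<in>V. \<Sum>b\<in>V. wt \<omega> a b * \<kappa> a b)" unfolding pairing[symmetric] by (simp add: t0)
  also have "\<dots> = (\<Sum>a\<in>V. \<Sum>b\<in>V. wt \<omega> a b * of_bool (a = x)) - (\<Sum>a\<in>V. \<Sum>b\<in>V. wt \<omega> a b * of_bool (b = x))"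
    by (simp only: \<kappa>_def right_diff_distrib sum_subtractf)
  also have "(\<Sum>a\<in>V. \<Sum>b\<in>V. wt \<omega> a b * of_bool (a = x)) = (\<Sum>b\<in>V. wt \<omega> x b)"
    by (subst sum.swap) (use x finite_V in simp)
  also have "(\<Sum>a\<in>V. \<Sum>b\<in>V. wt \<omega> a b * of_bool (b = x)) = (\<Sum>a\<in>V. wt \<omega> a x)"
    using x finite_V by simp
  finally show ?thesis by (simp add: jump_def sum_subtractf)
qed

lemma jump_anti: "jump \<omega> y x = - jump \<omega> x y"
  by (simp add: jump_def)

lemma jump_edge: "jump \<omega> x y \<noteq> 0 \<Longrightarrow> edge x y"
proof (rule ccontr)
  assume "jump \<omega> x y \<noteq> 0" "\<not> edge x y"
  then have "wt \<omega> x y = 0" "wt \<omega> y x = 0" unfolding wt_def edge_def by (auto intro!: sum.neutral)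
  then show False using \<open>jump \<omega> x y \<noteq> 0\<close> by (simp add: jump_def)
qed

text \<open>The transpose of the area derivative: weights on triangles act on displacements only
  through their jumps, which is where stresses come in.\<close>

lemma area_deriv_pairing:
  "(\<Sum>i\<in>UNIV. \<omega> $ i * area_deriv \<rho> \<mu> i) = (\<Sum>x\<in>V. crs (\<mu> x) (\<Sum>y\<in>V. jump \<omega> x y *\<^sub>R \<rho> y)) / 2"
proof -
  have "(\<Sum>i\<in>UNIV. \<omega> $ i * area_deriv \<rho> \<mu> i) = (\<Sum>x\<in>V. \<Sum>y\<in>V. wt \<omega> x y * ((crs (\<mu> x) (\<rho> y) - crs (\<mu> y) (\<rho> x)) / 2))"
    unfolding area_deriv_def by (rule pairing)
  also have "\<dots> = ((\<Sum>x\<in>V. \<Sum>y\<in>V. wt \<omega> x y * crs (\<mu> x) (\<rho> y)) - (\<Sum>x\<in>V. \<Sum>y\<in>V. wt \<omega> x y * crs (\<mu> y) (\<rho> x))) / 2"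
    by (simp add: sum_divide_distrib sum_subtractf[symmetric] algebra_simps diff_divide_distrib)
  also have "(\<Sum>x\<in>V. \<Sum>y\<in>V. wt \<omega> x y * crs (\<mu> y) (\<rho> x)) = (\<Sum>x\<in>V. \<Sum>y\<in>V. wt \<omega> y x * crs (\<mu> x) (\<rho> y))"
    by (rule sum.swap)
  also have "(\<Sum>x\<in>V. \<Sum>y\<in>V. wt \<omega> x y * crs (\<mu> x) (\<rho> y)) - (\<Sum>x\<in>V. \<Sum>y\<in>V. wt \<omega> y x * crs (\<mu> x) (\<rho> y))
     = (\<Sum>x\<in>V. \<Sum>y\<in>V. jump \<omega> x y * crs (\<mu> x) (\<rho> y))"
    by (simp add: jump_def left_diff_distrib sum_subtractf)
  finally show ?thesis by (simp add: crs_sum_right crs_scaleR_right)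
qed

definition coker :: "('a \<Rightarrow> real^2) \<Rightarrow> (real^'n) set" where
  "coker \<rho> = {\<omega>. \<forall>\<mu>. parallelogram_drawing p q r s \<mu> \<longrightarrow> (\<Sum>i\<in>UNIV. \<omega> $ i * area_deriv \<rho> \<mu> i) = 0}"

definition residue :: "('a \<Rightarrow> real^2) \<Rightarrow> real^'n \<Rightarrow> 'a \<Rightarrow> real^2" where
  "residue \<rho> \<omega> x = (\<Sum>y\<in>V. jump \<omega> x y *\<^sub>R \<rho> y)"

text \<open>Tested with displacements that keep the parallelogram: of a single inner vertex, of
  \<open>r\<close> and \<open>p\<close> by opposite vectors, and of \<open>q\<close>,
  \<open>r\<close> or of \<open>s\<close>, \<open>r\<close> by the same vector.\<close>

lemma coker_residue:
  assumes \<omega>: "\<omega> \<in> coker \<rho>"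
  shows "x \<in> V \<Longrightarrow> x \<notin> {p, q, r, s} \<Longrightarrow> residue \<rho> \<omega> x = 0"
    and "residue \<rho> \<omega> r = residue \<rho> \<omega> p" "residue \<rho> \<omega> q = - residue \<rho> \<omega> p" "residue \<rho> \<omega> s = - residue \<rho> \<omega> p"
proof -
  note d = dist4
  have c0: "(\<Sum>x\<in>V. crs (\<mu> x) (residue \<rho> \<omega> x)) = 0" if "parallelogram_drawing p q r s \<mu>" for \<mu>
    using \<omega> that area_deriv_pairing[of \<omega> \<rho> \<mu>] unfolding coker_def residue_def by auto
  have two: "crs e (residue \<rho> \<omega> a) + k * crs e (residue \<rho> \<omega> b) = 0"
    if par: "parallelogram_drawing p q r s (\<lambda>x. if x = a then e else if x = b then k *\<^sub>R e else 0)"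
      and ab: "a \<in> V" "b \<in> V" "a \<noteq> b" for a b e k
  proof -
    have "(\<Sum>x\<in>V. crs (if x = a then e else if x = b then k *\<^sub>R e else 0) (residue \<rho> \<omega> x)) =
        (\<Sum>x\<in>{a, b}. crs (if x = a then e else if x = b then k *\<^sub>R e else 0) (residue \<rho> \<omega> x))"
      by (rule sum.mono_neutral_right) (use finite_V ab in \<open>auto simp: crs_def\<close>)
    then show ?thesis using c0[OF par] ab(3) by (simp add: crs_def algebra_simps)
  qed
  show "residue \<rho> \<omega> x = 0" if x: "x \<in> V" "x \<notin> {p, q, r, s}" for x
  proof (rule crs_all_0)
    fix e
    have "crs e (residue \<rho> \<omega> x) + 0 * crs e (residue \<rho> \<omega> p) = 0"
      using x Bd_V by (intro two) (auto simp: parallelogram_drawing_def)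
    then show "crs e (residue \<rho> \<omega> x) = 0" by simp
  qed
  have diff: "crs e (a - b) = crs e a - crs e b" and add: "crs e (a + b) = crs e a + crs e b" for e a b
    by (simp_all add: crs_def algebra_simps)
  have "residue \<rho> \<omega> r - residue \<rho> \<omega> p = 0"
  proof (rule crs_all_0)
    fix e
    have "crs e (residue \<rho> \<omega> r) + (- 1) * crs e (residue \<rho> \<omega> p) = 0"
      using d Bd_V by (intro two) (auto simp: parallelogram_drawing_def)
    then show "crs e (residue \<rho> \<omega> r - residue \<rho> \<omega> p) = 0" by (simp add: diff)
  qed
  then show rp: "residue \<rho> \<omega> r = residue \<rho> \<omega> p" by simp
  have "residue \<rho> \<omega> q + residue \<rho> \<omega> r = 0"
  proof (rule crs_all_0)
    fix e
    have "crs e (residue \<rho> \<omega> q) + 1 * crs e (residue \<rho> \<omega> r) = 0"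
      using d Bd_V by (intro two) (auto simp: parallelogram_drawing_def)
    then show "crs e (residue \<rho> \<omega> q + residue \<rho> \<omega> r) = 0" by (simp add: add)
  qed
  then show "residue \<rho> \<omega> q = - residue \<rho> \<omega> p" using rp by (simp add: eq_neg_iff_add_eq_0)
  have "residue \<rho> \<omega> s + residue \<rho> \<omega> r = 0"
  proof (rule crs_all_0)
    fix e
    have "crs e (residue \<rho> \<omega> s) + 1 * crs e (residue \<rho> \<omega> r) = 0"
      using d Bd_V by (intro two) (auto simp: parallelogram_drawing_def)
    then show "crs e (residue \<rho> \<omega> s + residue \<rho> \<omega> r) = 0" by (simp add: add)
  qed
  then show "residue \<rho> \<omega> s = - residue \<rho> \<omega> p" using rp by (simp add: eq_neg_iff_add_eq_0)
qed

lemma wt_edge: "(x, y) \<in> directed_edges (ori i) \<Longrightarrow> wt \<omega> x y = \<omega> $ i"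
proof -
  assume i: "(x, y) \<in> directed_edges (ori i)"
  have "wt \<omega> x y = (\<Sum>j\<in>UNIV. if j = i then \<omega> $ i else 0)"
    unfolding wt_def
  proof (intro sum.cong refl)
    fix j show "\<omega> $ j * of_bool ((x, y) \<in> directed_edges (ori j)) = (if j = i then \<omega> $ i else 0)"
    proof (cases "j = i")
      case True then show ?thesis using i by simp
    next
      case False
      then have "(x, y) \<notin> directed_edges (ori j)" using edges_disjoint[OF i, of j] by blast
      then show ?thesis using False by simp
    qed
  qed
  then show ?thesis by simp
qed

text \<open>No jump across \<open>p q\<close> means weight 0 on the triangle there, and
  connectedness spreads this to all triangles.\<close>

lemma jump_zero:
  assumes j: "\<And>x y. jump \<omega> x y = 0" shows "\<omega> = 0"
proof -
  define G where "G = {i. \<omega> $ i = 0}"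
  obtain i where i: "(p, q) \<in> directed_edges (ori i)" using boundary_edges(1) by blast
  have "wt \<omega> q p = 0"
    unfolding wt_def using boundary_one_page[of p q] by (intro sum.neutral) auto
  then have "i \<in> G" using j[of p q] wt_edge[OF i] by (simp add: jump_def G_def)
  then have "G = UNIV"
  proof (intro tri_connected)
    show "k \<in> G" if "l \<in> G" "(x, y) \<in> directed_edges (ori l)" "(y, x) \<in> directed_edges (ori k)" for l k x y
      using that j[of x y] wt_edge[OF that(2)] wt_edge[OF that(3)] by (simp add: jump_def G_def)
  qed auto
  then show ?thesis by (auto simp: G_def vec_eq_iff)
qed

text \<open>The condition \<open>k\<close> puts the residue at \<open>p\<close> in the direction of
  the diagonal \<open>p r\<close>, the direction of the residues that the bisected square can
  produce.\<close>

lemma coker_zero: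
  assumes npr: "\<not> edge p r" and \<rho>: "\<rho> p = vector [0, 0]" "\<rho> q = vector [1, 0]" "\<rho> r = vector [1, 1]" "\<rho> s = vector [0, 1]"
    and sf: "flat_stress_free \<rho>" and \<omega>: "\<omega> \<in> coker \<rho>" and k: "residue \<rho> \<omega> p $ 1 = residue \<rho> \<omega> p $ 2"
  shows "\<omega> = 0"
proof (rule jump_zero)
  define m where "m = - residue \<rho> \<omega> p $ 1"
  have lam: "residue \<rho> \<omega> p = vector [- m, - m]" unfolding vec_eq_iff forall_2 m_def using k by simp
  have d: "p \<noteq> q" "p \<noteq> r" "p \<noteq> s" "q \<noteq> r" "q \<noteq> s" "r \<noteq> s" using dist4 by auto
  \<comment> \<open>\<open>S\<close> is carried by the two halves of the square cut along \<open>pr\<close>. A multiple of it cancels the residues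
    at the corners, and as the jump itself has no component on \<open>pr\<close> this multiple is zero.\<close>
  define S where "S x y = bde p q x y + bde q r x y + bde r p x y - (bde p r x y + bde r s x y + bde s p x y)" for x y
  define t where "t x y = jump \<omega> x y - m * S x y" for x y
  have S_anti: "S y x = - S x y" for x y
    unfolding S_def bde_swap[of _ _ y x] by simp
  have edges: "edge p q" "edge q r" "edge r s" "edge s p" unfolding edge_def using boundary_edges by blast+
  then have edges': "edge q p" "edge r q" "edge s r" "edge p s" using edge_sym by blast+
  have S_supp: "edge x y \<or> {x, y} = {p, r}" if "S x y \<noteq> 0" for x y
  proof (rule ccontr)
    assume n: "\<not> ?thesis"
    then have "bde p q x y = 0" "bde q r x y = 0" "bde r p x y = 0" "bde p r x y = 0" "bde r s x y = 0" "bde s p x y = 0"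
      using edges edges' unfolding bde_def by auto
    then show False using that by (simp add: S_def)
  qed
  have bsum: "(\<Sum>y\<in>V. bde a b x y *\<^sub>R f y) = of_bool (x = a) *\<^sub>R f b - of_bool (x = b) *\<^sub>R f a"
    if "a \<in> V" "b \<in> V" for a b x and f :: "'a \<Rightarrow> 'z::real_vector"
  proof -
    have "(\<Sum>y\<in>V. bde a b x y *\<^sub>R f y) = (\<Sum>y\<in>V. (if y = b then of_bool (x = a) *\<^sub>R f b else 0) - (if y = a then of_bool (x = b) *\<^sub>R f a else 0))"
      by (intro sum.cong refl) (auto simp: bde_def)
    then show ?thesis using that finite_V by (simp add: sum_subtractf)
  qed
  have S_row: "(\<Sum>y\<in>V. S x y *\<^sub>R f y) = of_bool (x = p) *\<^sub>R f q - of_bool (x = q) *\<^sub>R f p + (of_bool (x = q) *\<^sub>R f r - of_bool (x = r) *\<^sub>R f q)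
      + (of_bool (x = r) *\<^sub>R f p - of_bool (x = p) *\<^sub>R f r) - ((of_bool (x = p) *\<^sub>R f r - of_bool (x = r) *\<^sub>R f p)
      + (of_bool (x = r) *\<^sub>R f s - of_bool (x = s) *\<^sub>R f r) + (of_bool (x = s) *\<^sub>R f p - of_bool (x = p) *\<^sub>R f s))"
    for x and f :: "'a \<Rightarrow> 'z::real_vector"
    unfolding S_def scaleR_diff_left scaleR_add_left sum.distrib sum_subtractf using Bd_V by (simp only: bsum)
  have "\<forall>x y. t x y = 0"
  proof (rule sf[unfolded flat_stress_free_def, THEN spec, THEN mp, THEN mp, THEN mp, THEN mp]; (intro allI ballI impI)?)
    fix x y
    show "t y x = - t x y" using jump_anti[of \<omega> x y] S_anti[of x y] by (simp add: t_def)
    show "edge x y \<or> {x, y} = {p, r}" if "t x y \<noteq> 0"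
    proof (cases "jump \<omega> x y = 0")
      case True
      then have "S x y \<noteq> 0" using that unfolding t_def by (metis diff_zero mult_zero_right)
      then show ?thesis by (rule S_supp)
    next
      case False
      then show ?thesis using jump_edge by blast
    qed
    show "(\<Sum>y\<in>V. t x y) = 0" if x: "x \<in> V"
    proof -
      have "(\<Sum>y\<in>V. S x y) = 0" using S_row[of x "\<lambda>_. 1 :: real"] by simp
      then show ?thesis using jump_row[OF x, of \<omega>] by (simp add: t_def sum_subtractf sum_distrib_left[symmetric])
    qed
    show "(\<Sum>y\<in>V. t x y *\<^sub>R \<rho> y) = 0" if x: "x \<in> V"
    proof -
      have "(\<Sum>y\<in>V. t x y *\<^sub>R \<rho> y) = residue \<rho> \<omega> x - m *\<^sub>R (\<Sum>y\<in>V. S x y *\<^sub>R \<rho> y)"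
        by (simp add: t_def residue_def scaleR_diff_left sum_subtractf scaleR_sum_right)
      moreover consider "x = p" | "x = q" | "x = r" | "x = s" | "x \<notin> {p, q, r, s}" by blast
      then have "residue \<rho> \<omega> x = m *\<^sub>R (\<Sum>y\<in>V. S x y *\<^sub>R \<rho> y)"
      proof cases
        case 1 then show ?thesis using d by (simp add: S_row lam \<rho> vec_eq_iff forall_2)
      next
        case 2 then show ?thesis using d by (simp add: S_row lam \<rho> coker_residue[OF \<omega>] vec_eq_iff forall_2)
      next
        case 3 then show ?thesis using d by (simp add: S_row lam \<rho> coker_residue[OF \<omega>] vec_eq_iff forall_2)
      next
        case 4 then show ?thesis using d by (simp add: S_row lam \<rho> coker_residue[OF \<omega>] vec_eq_iff forall_2)
      next
        case 5 then show ?thesis using d x by (simp add: S_row coker_residue(1)[OF \<omega>])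
      qed
      ultimately show ?thesis by simp
    qed
  qed
  then have j: "jump \<omega> x y = m * S x y" for x y by (simp add: t_def)
  have "jump \<omega> p r = 0" using npr jump_edge by blast
  moreover have "S p r = - 2" using d by (simp add: S_def bde_def)
  ultimately have "m = 0" using j[of p r] by simp
  then show "jump \<omega> x y = 0" for x y using j by simp
qed

end

lemma has_derivative_mult_linear_at_0:
  fixes f g :: "'b::real_normed_vector \<Rightarrow> real"
  assumes "bounded_linear f" "bounded_linear g"
  shows "((\<lambda>y. f y * g y) has_derivative (\<lambda>_. 0)) (at 0)"
proof -
  interpret f: bounded_linear f by fact
  interpret g: bounded_linear g by fact
  have "(f has_derivative f) (at 0)" "(g has_derivative g) (at 0)"
    using assms by (simp_all add: bounded_linear_imp_has_derivative)
  from has_derivative_mult[OF this] show ?thesis by simp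
qed

lemma box_in_ball:
  fixes z :: "real^'n::finite"
  assumes "e > 0"
  obtains \<delta> where "\<delta> > 0" "\<And>v. (\<And>j. \<bar>v $ j - z $ j\<bar> < \<delta>) \<Longrightarrow> v \<in> ball z e"
proof
  let ?\<delta> = "e / (real CARD('n) + 1)"
  show "?\<delta> > 0" using assms by simp
  fix v :: "real^'n" assume v: "\<And>j. \<bar>v $ j - z $ j\<bar> < ?\<delta>"
  have "norm (v - z) \<le> (\<Sum>j\<in>UNIV. \<bar>(v - z) $ j\<bar>)" by (rule norm_le_l1_cart)
  also have "\<dots> \<le> of_nat CARD('n) * ?\<delta>"
    by (rule sum_bounded_above) (use v in \<open>simp add: less_imp_le\<close>)
  also have "\<dots> < e" using assms by (simp add: field_simps)
  finally show "v \<in> ball z e" by (simp add: dist_norm norm_minus_commute)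
qed

section \<open>From the cokernel to independent areas\<close>

context quad begin

lemma residue_lin: "residue \<rho> (a *\<^sub>R v + b *\<^sub>R w) x = a *\<^sub>R residue \<rho> v x + b *\<^sub>R residue \<rho> w x"
proof -
  have "wt (a *\<^sub>R v + b *\<^sub>R w) x y = a * wt v x y + b * wt w x y" for x y
    unfolding wt_def sum_distrib_left sum.distrib[symmetric] by (intro sum.cong refl) (simp add: algebra_simps)
  then have "jump (a *\<^sub>R v + b *\<^sub>R w) x y = a * jump v x y + b * jump w x y" for x y
    by (simp add: jump_def algebra_simps)
  then show ?thesis by (simp add: residue_def scaleR_add_left sum.distrib scaleR_sum_right)
qed

lemma coker_lin: "v \<in> coker \<rho> \<Longrightarrow> w \<in> coker \<rho> \<Longrightarrow> a *\<^sub>R v + b *\<^sub>R w \<in> coker \<rho>"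
proof -
  assume v: "v \<in> coker \<rho>" and w: "w \<in> coker \<rho>"
  have "(\<Sum>i\<in>UNIV. (a *\<^sub>R v + b *\<^sub>R w) $ i * area_deriv \<rho> \<mu> i) =
      a * (\<Sum>i\<in>UNIV. v $ i * area_deriv \<rho> \<mu> i) + b * (\<Sum>i\<in>UNIV. w $ i * area_deriv \<rho> \<mu> i)" for \<mu>
    by (simp add: sum.distrib sum_distrib_left distrib_right mult.assoc)
  then show ?thesis using v w unfolding coker_def by simp
qed

text \<open>The difference of the two coordinates of the residue at \<open>p\<close> is a linear
  functional that is injective on the cokernel, so the latter has dimension at most one, and a
  nonzero coordinate of a spanning vector detects it.\<close>

lemma coker_coordinate:
  assumes npr: "\<not> edge p r" and \<rho>: "\<rho> p = vector [0, 0]" "\<rho> q = vector [1, 0]" "\<rho> r = vector [1, 1]" "\<rho> s = vector [0, 1]"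
    and sf: "flat_stress_free \<rho>"
  shows "\<exists>i0. \<forall>\<omega>\<in>coker \<rho>. \<omega> $ i0 = 0 \<longrightarrow> \<omega> = 0"
proof (cases "coker \<rho> \<subseteq> {0}")
  case True then show ?thesis by blast
next
  case False
  define k where "k \<omega> = residue \<rho> \<omega> p $ 1 - residue \<rho> \<omega> p $ 2" for \<omega>
  have k0: "\<omega> = 0" if "\<omega> \<in> coker \<rho>" "k \<omega> = 0" for \<omega>
    using coker_zero[OF npr \<rho> sf that(1)] that(2) by (simp add: k_def)
  obtain v where v: "v \<in> coker \<rho>" "v \<noteq> 0" using False by blast
  then obtain i0 where i0: "v $ i0 \<noteq> 0" by (auto simp: vec_eq_iff)
  have "\<omega> = 0" if \<omega>: "\<omega> \<in> coker \<rho>" "\<omega> $ i0 = 0" for \<omega>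
  proof -
    let ?u = "k v *\<^sub>R \<omega> + (- k \<omega>) *\<^sub>R v"
    have "k ?u = 0" unfolding k_def residue_lin by (simp add: algebra_simps)
    then have "?u = 0" using k0 coker_lin[OF \<omega>(1) v(1)] by blast
    then have "?u $ i0 = 0" by (simp only: zero_index)
    then have "k \<omega> = 0" using i0 \<omega>(2) by simp
    then show ?thesis using k0 \<omega>(1) by blast
  qed
  then show ?thesis by blast
qed

lemma area_deriv_lin:
  "area_deriv \<rho> (\<lambda>x. a *\<^sub>R \<mu> x + b *\<^sub>R \<nu> x) i = a * area_deriv \<rho> \<mu> i + b * area_deriv \<rho> \<nu> i"
  by (cases "ori i") (simp add: area_deriv_def tri_sum_def crs_def algebra_simps add_divide_distrib diff_divide_distrib)

lemma area_deriv_sum: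
  assumes "finite A"
  shows "area_deriv \<rho> (\<lambda>x. \<Sum>j\<in>A. c j *\<^sub>R \<mu> j x) i = (\<Sum>j\<in>A. c j * area_deriv \<rho> (\<mu> j) i)"
  using assms
proof induction
  case empty
  show ?case using area_deriv_lin[of \<rho> 0 "\<lambda>_. 0" 0 "\<lambda>_. 0" i] by simp
next
  case (insert j A)
  then show ?case using area_deriv_lin[of \<rho> "c j" "\<mu> j" 1 "\<lambda>x. \<Sum>j\<in>A. c j *\<^sub>R \<mu> j x" i] by simp
qed

lemma signed_area_add:
  "signed_area (\<lambda>x. \<rho> x + \<mu> x) (ori i) = signed_area \<rho> (ori i) + area_deriv \<rho> \<mu> i + signed_area \<mu> (ori i)"
  by (cases "ori i") (simp add: area_deriv_def tri_sum_def crs_def field_simps)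

text \<open>A covector orthogonal to all these vectors belongs to the cokernel and has coordinate 0
  at \<open>i0\<close>, so it vanishes. The number \<open>t\<close> is free slack in that
  coordinate.\<close>

lemma area_deriv_surj:
  assumes i0: "\<forall>\<omega>\<in>coker \<rho>. \<omega> $ i0 = 0 \<longrightarrow> \<omega> = 0"
  shows "\<exists>\<mu> t. parallelogram_drawing p q r s \<mu> \<and> (\<forall>i. area_deriv \<rho> \<mu> i + (if i = i0 then t else 0) = v $ i)"
proof -
  define W :: "(real^'n) set" where
    "W = {u. \<exists>\<mu> t. parallelogram_drawing p q r s \<mu> \<and> (\<forall>i. area_deriv \<rho> \<mu> i + (if i = i0 then t else 0) = u $ i)}"
  have d0: "area_deriv \<rho> (\<lambda>_. 0) i = 0" for i
    using area_deriv_lin[of \<rho> 0 "\<lambda>_. 0" 0 "\<lambda>_. 0" i] by simp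
  have comb: "a *\<^sub>R u + b *\<^sub>R w \<in> W" if u: "u \<in> W" and w: "w \<in> W" for a b u w
  proof -
    obtain \<mu> t where \<mu>: "parallelogram_drawing p q r s \<mu>" "\<And>i. area_deriv \<rho> \<mu> i + (if i = i0 then t else 0) = u $ i"
      using u unfolding W_def by blast
    obtain \<nu> t' where \<nu>: "parallelogram_drawing p q r s \<nu>" "\<And>i. area_deriv \<rho> \<nu> i + (if i = i0 then t' else 0) = w $ i"
      using w unfolding W_def by blast
    let ?\<mu> = "\<lambda>x. a *\<^sub>R \<mu> x + b *\<^sub>R \<nu> x"
    have "?\<mu> q - ?\<mu> p = a *\<^sub>R (\<mu> q - \<mu> p) + b *\<^sub>R (\<nu> q - \<nu> p)" by (simp add: algebra_simps)
    also have "\<dots> = ?\<mu> r - ?\<mu> s"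
      using \<mu>(1) \<nu>(1) unfolding parallelogram_drawing_def by (simp only:) (simp add: algebra_simps)
    finally have "parallelogram_drawing p q r s ?\<mu>" by (simp add: parallelogram_drawing_def)
    moreover have "area_deriv \<rho> ?\<mu> i + (if i = i0 then a * t + b * t' else 0) = (a *\<^sub>R u + b *\<^sub>R w) $ i" for i
      unfolding area_deriv_lin by (simp add: \<mu>(2)[symmetric] \<nu>(2)[symmetric] algebra_simps)
    ultimately show ?thesis unfolding W_def by blast
  qed
  have W0: "0 \<in> W"
    unfolding W_def by (auto simp: d0 parallelogram_drawing_def intro!: exI[of _ "\<lambda>_. 0"] exI[of _ 0])
  have "subspace W"
    unfolding subspace_def using W0 comb[of _ _ 1 1] comb[OF _ W0, of _ _ 0] by simp
  then have "span W = W" by (simp add: span_eq_iff)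
  have "W = UNIV"
  proof (rule ccontr)
    assume "W \<noteq> UNIV"
    then obtain a where a: "a \<noteq> 0" "\<And>x. x \<in> W \<Longrightarrow> a \<bullet> x = 0"
      using span_not_UNIV_orthogonal[of W] \<open>span W = W\<close> by auto
    have "a \<in> coker \<rho>"
      unfolding coker_def
    proof (intro CollectI allI impI)
      fix \<mu> :: "'a \<Rightarrow> real^2" assume "parallelogram_drawing p q r s \<mu>"
      then have "vec_lambda (area_deriv \<rho> \<mu>) \<in> W" unfolding W_def by (auto intro!: exI[of _ \<mu>] exI[of _ 0])
      from a(2)[OF this] show "(\<Sum>i\<in>UNIV. a $ i * area_deriv \<rho> \<mu> i) = 0" by (simp add: inner_vec_def)
    qed
    moreover have "axis i0 1 \<in> W"
      unfolding W_def by (auto simp: d0 parallelogram_drawing_def axis_def intro!: exI[of _ "\<lambda>_. 0"] exI[of _ 1])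
    then have "a $ i0 = 0" using a(2) by (metis inner_axis inner_real_def mult.right_neutral)
    ultimately show False using i0 a(1) by blast
  qed
  then show ?thesis unfolding W_def by blast
qed

text \<open>An open mapping argument at the square drawing fills a box, and a point of the box with
  independent coordinates off \<open>i0\<close> is picked. Off \<open>i0\<close> there is no slack,
  so these coordinates are areas of a drawing.\<close>

theorem independent_areas:
  assumes npr: "\<not> edge p r"
  shows "\<exists>\<rho> i0. parallelogram_drawing p q r s \<rho> \<and>
     alg_indep (\<lambda>i. signed_area \<rho> (ori i)) (UNIV - {i0}) \<and>
     comp_int_closed (gen_ring (\<lambda>i. signed_area \<rho> (ori i)) (UNIV - {i0}))"
proof -
  obtain \<rho> where \<rho>: "\<rho> p = vector [0, 0]" "\<rho> q = vector [1, 0]" "\<rho> r = vector [1, 1]" "\<rho> s = vector [0, 1]"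
    and sf: "flat_stress_free \<rho>" using square_drawing_exists[OF npr] by blast
  have par: "parallelogram_drawing p q r s \<rho>" by (simp add: parallelogram_drawing_def \<rho> vec_eq_iff forall_2)
  obtain i0 where i0: "\<forall>\<omega>\<in>coker \<rho>. \<omega> $ i0 = 0 \<longrightarrow> \<omega> = 0" using coker_coordinate[OF npr \<rho> sf] by blast
  have "\<forall>j. \<exists>\<mu> t. parallelogram_drawing p q r s \<mu> \<and>
      (\<forall>i. area_deriv \<rho> \<mu> i + (if i = i0 then t else 0) = axis j 1 $ i)"
    using area_deriv_surj[OF i0] by blast
  then obtain \<mu> where "\<forall>j. \<exists>t. parallelogram_drawing p q r s (\<mu> j) \<and>
      (\<forall>i. area_deriv \<rho> (\<mu> j) i + (if i = i0 then t else 0) = axis j 1 $ i)" by metis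
  then obtain t where \<mu>: "\<And>j. parallelogram_drawing p q r s (\<mu> j)"
    and t: "\<And>i j. area_deriv \<rho> (\<mu> j) i + (if i = i0 then t j else 0) = axis j 1 $ i" by metis
  define M where "M y x = (\<Sum>j\<in>UNIV. y $ j *\<^sub>R \<mu> j x)" for y :: "real^'n" and x
  have M_lin: "M (y + z) x = M y x + M z x" "M (c *\<^sub>R y) x = c *\<^sub>R M y x" for y z c x
    by (simp_all add: M_def scaleR_add_left sum.distrib scaleR_sum_right)
  define Q where "Q i y = signed_area (M y) (ori i)" for i y
  \<comment> \<open>The areas of the displaced drawing, corrected in coordinate \<open>i0\<close> so
    that the derivative at 0 is the identity; \<open>Q\<close> is the part quadratic in the
    displacement.\<close>
  define F :: "real^'n \<Rightarrow> real^'n" where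
    "F y = vec_lambda (\<lambda>i. signed_area (\<lambda>x. \<rho> x + M y x) (ori i) + (if i = i0 then \<Sum>j\<in>UNIV. y $ j * t j else 0))" for y
  have FQ: "F y $ i = signed_area \<rho> (ori i) + y $ i + Q i y" for y i
  proof -
    have "area_deriv \<rho> (M y) i + (if i = i0 then \<Sum>j\<in>UNIV. y $ j * t j else 0) =
        (\<Sum>j\<in>UNIV. y $ j * (area_deriv \<rho> (\<mu> j) i + (if i = i0 then t j else 0)))"
      unfolding M_def by (simp add: area_deriv_sum distrib_left sum.distrib)
    also have "\<dots> = y $ i" unfolding t by (simp add: axis_def if_distrib cong: if_cong)
    finally show ?thesis by (simp add: F_def Q_def signed_area_add)
  qed
  have Q: "(Q i has_derivative (\<lambda>_. 0)) (at 0)" "continuous_on UNIV (Q i)" for i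
  proof -
    obtain a b c where abc: "ori i = (a, b, c)" by (cases "ori i") auto
    define L where "L x k y = M y x $ k - M y a $ k" for x k y
    have L: "bounded_linear (L x k)" for x k
      unfolding linear_conv_bounded_linear[symmetric] L_def by (rule linearI) (simp_all add: M_lin algebra_simps)
    have e: "Q i = (\<lambda>y. 1 / 2 * (L b 1 y * L c 2 y - L c 1 y * L b 2 y))"
      by (simp add: Q_def L_def abc fun_eq_iff)
    have "((\<lambda>y. 1 / 2 * (L b 1 y * L c 2 y - L c 1 y * L b 2 y)) has_derivative (\<lambda>h. 1 / 2 * (0 - 0))) (at 0)"
      by (intro has_derivative_mult_right has_derivative_diff has_derivative_mult_linear_at_0 L)
    then show "(Q i has_derivative (\<lambda>_. 0)) (at 0)" unfolding e by simp
    show "continuous_on UNIV (Q i)"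
      unfolding e by (intro continuous_intros linear_continuous_on L)
  qed
  have contF: "continuous_on UNIV F"
  proof -
    have "F = (\<lambda>y. vec_lambda (\<lambda>i. signed_area \<rho> (ori i) + y $ i + Q i y))"
      by (simp add: fun_eq_iff vec_eq_iff FQ)
    then show ?thesis by (simp only:) (intro continuous_intros Q)
  qed
  have derF: "(F has_derivative id) (at 0)"
  proof (subst has_derivative_componentwise_within, intro ballI)
    fix b :: "real^'n" assume "b \<in> Basis"
    then obtain i where b: "b = axis i 1" by (auto simp: Basis_vec_def)
    have "((\<lambda>y. signed_area \<rho> (ori i) + y $ i + Q i y) has_derivative (\<lambda>h. 0 + h $ i + 0)) (at 0)"
      by (intro has_derivative_add has_derivative_const Q bounded_linear_imp_has_derivative bounded_linear_vec_nth)
    then show "((\<lambda>y. F y \<bullet> b) has_derivative (\<lambda>h. id h \<bullet> b)) (at 0)" by (simp add: b inner_axis FQ)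
  qed
  have "F 0 \<in> interior (F ` UNIV)"
    by (rule sussmann_open_mapping[OF open_UNIV contF _ derF bounded_linear_ident]) auto
  then obtain e where e: "e > 0" "ball (F 0) e \<subseteq> range F" unfolding mem_interior by blast
  obtain \<delta> where \<delta>: "\<delta> > 0" "\<And>v. (\<And>j. \<bar>v $ j - F 0 $ j\<bar> < \<delta>) \<Longrightarrow> v \<in> ball (F 0) e"
    using box_in_ball[OF e(1)] by blast
  obtain a where a: "\<forall>j. F 0 $ j - \<delta> < a j \<and> a j < F 0 $ j + \<delta>"
    and ind: "alg_indep a (UNIV - {i0})" "comp_int_closed (gen_ring a (UNIV - {i0}))"
    using alg_indep_point[of "\<lambda>j. F 0 $ j - \<delta>" "\<lambda>j. F 0 $ j + \<delta>" "UNIV - {i0}"] \<delta>(1) by auto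
  have "vec_lambda a \<in> ball (F 0) e"
  proof (rule \<delta>(2))
    show "\<bar>vec_lambda a $ j - F 0 $ j\<bar> < \<delta>" for j using a[rule_format, of j] by (simp add: abs_less_iff)
  qed
  then obtain y where y: "F y = vec_lambda a" using e(2) by auto
  define \<rho>' where "\<rho>' x = \<rho> x + M y x" for x
  have ar: "a i = signed_area \<rho>' (ori i)" if "i \<in> UNIV - {i0}" for i
    using arg_cong[OF y, of "\<lambda>v. v $ i"] that by (simp add: F_def \<rho>'_def[abs_def])
  have "M y q - M y p = M y r - M y s"
    using \<mu> unfolding M_def sum_subtractf[symmetric] scaleR_diff_right[symmetric] parallelogram_drawing_def by simp
  then have "parallelogram_drawing p q r s \<rho>'"
    using par by (simp add: parallelogram_drawing_def \<rho>'_def algebra_simps)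
  moreover have "alg_indep (\<lambda>i. signed_area \<rho>' (ori i)) (UNIV - {i0})"
    unfolding alg_indep_def
  proof (intro allI impI)
    fix G assume G: "varsin (UNIV - {i0}) G" "ev (\<lambda>i. signed_area \<rho>' (ori i)) G = 0"
    then have "ev a G = 0" using ev_cong[OF G(1) ar] by simp
    then show "G = 0" using ind(1) G(1) unfolding alg_indep_def by blast
  qed
  moreover have "comp_int_closed (gen_ring (\<lambda>i. signed_area \<rho>' (ori i)) (UNIV - {i0}))"
    using ind(2) gen_ring_cong[of "UNIV - {i0}" a "\<lambda>i. signed_area \<rho>' (ori i)"] ar by simp
  ultimately show ?thesis by blast
qed

text \<open>Two indices are at play: integrality of the area \<open>i0\<close> left out of the
  independent family makes \<open>P\<close> generate the relations, while integrality of the area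
  \<open>i\<close> supplies the relation monic in that variable.\<close>

lemma area_polynomial_monic:
  assumes npr: "\<not> edge p r" and P: "area_polynomial ori p q r s P"
  shows "Poly_Mapping.lookup P (Poly_Mapping.single i (total_degree P)) \<in> {1, -1}"
proof -
  obtain \<rho> i0 where par: "parallelogram_drawing p q r s \<rho>"
    and ind: "alg_indep (\<lambda>i. signed_area \<rho> (ori i)) (UNIV - {i0})"
    and cic: "comp_int_closed (gen_ring (\<lambda>i. signed_area \<rho> (ori i)) (UNIV - {i0}))"
    using independent_areas[OF npr] by blast
  have "ev (\<lambda>i. signed_area \<rho> (ori i)) P = 0"
    using P par unfolding area_polynomial_def mpoly_eval_ev by blast
  then have dvd: "ev (\<lambda>i. signed_area \<rho> (ori i)) F = 0 \<Longrightarrow> P dvd F" for F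
    using irreducible_generates_vanishing_ideal[OF ind cic area_integral[OF chain_boundary par]] P
    unfolding area_polynomial_def by blast
  show ?thesis
    using pure_power_coeff[OF _ dvd area_integral[OF chain_boundary par]] P unfolding area_polynomial_def by blast
qed

end

theorem theorem3:
  fixes K :: "'a::euclidean_space set set"
    and p q r s :: 'a
    and \<Delta> :: "'n::finite \<Rightarrow> 'a set"
    and ori :: "'n \<Rightarrow> 'a \<times> 'a \<times> 'a"
    and P :: "'n int_mpoly"
  assumes "quad_triangulation K p q r s"
    and "bij_betw \<Delta> UNIV (complex_triangles K)"
    and "boundary_orientation \<Delta> p q r s ori"
    and "area_polynomial ori p q r s P"
  shows "\<forall>i. Poly_Mapping.lookup P (Poly_Mapping.single i (total_degree P)) \<in> {1, -1}"
proof
  fix i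
  interpret Q: quad K p q r s \<Delta> ori using assms(1-3) by (rule quad.intro)
  interpret R: quad K q r s p \<Delta> ori by (rule quad_rotate) (rule Q.quad_axioms)
  \<comment> \<open>The rotated labelling has the same drawings, hence the same area polynomial. It
    takes over when \<open>p r\<close> is an edge, because then \<open>q s\<close> is not.\<close>
  have "parallelogram_drawing q r s p \<rho> \<longleftrightarrow> parallelogram_drawing p q r s \<rho>" for \<rho>
    by (auto simp: parallelogram_drawing_def algebra_simps)
  then have P': "area_polynomial ori q r s p P" using assms(4) by (simp add: area_polynomial_def)
  show "Poly_Mapping.lookup P (Poly_Mapping.single i (total_degree P)) \<in> {1, -1}"
  proof (cases "Q.edge p r")
    case False
    then show ?thesis by (rule Q.area_polynomial_monic) (rule assms(4))
  next
    case True
    then have "\<not> R.edge q s" using Q.diagonals_not_both unfolding Q.edge_def R.edge_def by blast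
    then show ?thesis by (rule R.area_polynomial_monic) (rule P')
  qed
qed

end
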